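(* Let $k$ be an algebraically closed field of characteristic $0$ and $M=\mathbf Z^n$. Assume that $P$ is a strongly convex polytope (with vertices in $M$) satisfying the basis condition, and that $X(P)/k$ and $\mathcal L(P)$ are the corresponding smooth toric variety and very ample line bundle, with $V=\bigoplus_{m\in P\cap M}kx^m=\Gamma(X(P),\mathcal L(P))$. Let $\{\xi_r\}$ be the generic points of the orbits of the action of the torus on $X(P)$, $\xi_r$ corresponding to the face $P_r$ of $P$. (1) $$n_{inj}(\xi_r)=\max\{\,N_{inj}(H\cap P)+d_H\ \mid\ H=m+H_r\text{ is a parallel translate of }H_r,\ H\cap P\ne\emptyset\,\}.$$ (2) Let $P^v$ be the set of vertices of $P$ and let $\xi_i$ be a closed orbit, i.e. a closed point, with corresponding vertex $m_i\in P^v$. Then $$n_{inj}(\xi_i)=\max\Big\{\sum_{j=1}^nm_{i,j}\ \Big|\ m\in P^v\Big\}$$ (the maximal distance from $m_i$ to any other vertex), where $m-m_i=\sum_{j=1}^nm_{i,j}e_{ij}$. (3) $$n_{inj}(V)=\max\Big\{\max\Big\{\sum_{j=1}^nm_{i,j}\ \Big|\ m\in P^v\Big\}\ \Big|\ m_i\in P^v\Big\}$$ (the maximal length between vertices of $P$).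
   Context: Toric set-up. For $m\in M$ let $x^m=x_1^{m_1}\cdots x_n^{m_n}\in k[T]=k[x_1^{\pm1},\dots,x_n^{\pm1}]$; the torus is $T=\operatorname{Spec}k[T]$. For a vertex $m_i$ of $P$ let $M_i\subset M$ be the semigroup generated by $\{p-m_i\mid p\in P\cap M\}$, $U_i=\operatorname{Spec}k[M_i]$ and $L_i=k[M_i]x^{m_i}\subset k[T]$; these glue to the projective toric variety $X(P)$ and line bundle $\mathcal L(P)$. Basis condition: at each vertex $m_i$ exactly $n$ edges $E_{i1},\dots,E_{in}$ of $P$ meet, and if $e_{ij}$ is the minimal element of $M$ pointing from $m_i$ along $E_{ij}$ (to another lattice point of $E_{ij}$), then $\{e_{ij}\}_{j=1}^n$ is a basis of $M$ ("the basis at the vertex $m_i$"). Torus orbits on $X(P)$ correspond bijectively to faces $P_r$ of $P$. Given $P_r$, choose a vertex $m_i\in P_r$ and let $J_r=\{j\mid e_{ij}\text{ is parallel to }P_r\}$ (the basis vectors along edges contained in $P_r$); the closure of the orbit in $U_i=\operatorname{Spec}k[x^{e_{i1}},\dots,x^{e_{in}}]$ is defined by the ideal $(x^{e_{ij}},\,j\notin J_r)$. Put $H_r=\{m_i+\sum_{j\in J_r}a_{ij}e_{ij}\mid a_{ij}\in\mathbf Z\}$. For $m=\sum_jm_{ij}e_{ij}\in M$ and $H=m+H_r$, the distance of $H$ from $H_r$ is $d_H=\sum_{j\notin J_r}m_{ij}$. Injectivity orders. For a $k$-scheme $X$, a locally free module $F$ and a finite-dimensional subspace $V\subset\Gamma(X,F)$,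 the Taylor map is $d^l_V:\mathcal O_X\otimes_kV\to\mathcal P^l_{X/k}(F)=\mathcal P^l_{X/k}\otimes_{\mathcal O_X}F$, $\phi\otimes v\mapsto\phi\cdot(1\otimes v)$, where $\mathcal P^l_{X/k}$ is the sheaf of principal parts of order $l$. $n_{inj}(x)$ is the smallest integer $l$ such that the map of fibres $k_x\otimes_kV\to k_x\otimes_{\mathcal O_x}\mathcal P^l_{X/k}(F)_x$ is injective, and $n_{inj}(V)=\sup_xn_{inj}(x)$. In (1)–(3) these refer to $X=X(P)$, $F=\mathcal L(P)$. For a finite set $Q\subset M$ (or a polytope, identified with its set of lattice points), $N_{inj}(Q)$ is the value $n_{inj}(\xi)$ at the generic point $\xi$ of $T$ for the subspace $\bigoplus_{m\in Q}kx^m\subset k[T]=\Gamma(T,\mathcal O_T)$. *)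

theory Defs
  imports
    "HOL-Analysis.Analysis"
    "HOL-Library.Poly_Mapping"
    "HOL-Library.Extended_Nat"
    "HOL-Computational_Algebra.Fraction_Field"
    "HOL-Computational_Algebra.Polynomial"
    "HOL-Algebra.Module"
    "HOL-Algebra.QuotRing"
    "HOL-Algebra.Ideal_Product"
begin

section \<open>Tensor products of modules\<close>

text \<open>
  An element of \<open>M \<otimes>\<^sub>R N\<close> is a class of finite formal sums of pairs, i.e. of multisets over
  \<open>carrier M \<times> carrier N\<close>, under the least congruence making the pairing bilinear.  The rule
  \<open>zero\<close> makes the quotient of this commutative monoid a group, with \<open>(- x) \<otimes> y\<close> as the
  inverse of \<open>x \<otimes> y\<close>.
\<close>

inductive tensor_rel ::
  "('r, 'z) ring_scheme \<Rightarrow> ('r, 'm, 'y) module_scheme \<Rightarrow> ('r, 'n, 'x) module_scheme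
    \<Rightarrow> ('m \<times> 'n) multiset \<Rightarrow> ('m \<times> 'n) multiset \<Rightarrow> bool"
  for R M N
where
  refl: "set_mset X \<subseteq> carrier M \<times> carrier N \<Longrightarrow> tensor_rel R M N X X"
| sym: "tensor_rel R M N X Y \<Longrightarrow> tensor_rel R M N Y X"
| trans: "tensor_rel R M N X Y \<Longrightarrow> tensor_rel R M N Y Z \<Longrightarrow> tensor_rel R M N X Z"
| add: "tensor_rel R M N X X' \<Longrightarrow> tensor_rel R M N Y Y' \<Longrightarrow> tensor_rel R M N (X + Y) (X' + Y')"
| zero: "y \<in> carrier N \<Longrightarrow> tensor_rel R M N {#(\<zero>\<^bsub>M\<^esub>, y)#} {#}"
| distr_left: "x \<in> carrier M \<Longrightarrow> x' \<in> carrier M \<Longrightarrow> y \<in> carrier N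
    \<Longrightarrow> tensor_rel R M N {#(x \<oplus>\<^bsub>M\<^esub> x', y)#} {#(x, y), (x', y)#}"
| distr_right: "x \<in> carrier M \<Longrightarrow> y \<in> carrier N \<Longrightarrow> y' \<in> carrier N
    \<Longrightarrow> tensor_rel R M N {#(x, y \<oplus>\<^bsub>N\<^esub> y')#} {#(x, y), (x, y')#}"
| balanced: "r \<in> carrier R \<Longrightarrow> x \<in> carrier M \<Longrightarrow> y \<in> carrier N
    \<Longrightarrow> tensor_rel R M N {#(r \<odot>\<^bsub>M\<^esub> x, y)#} {#(x, r \<odot>\<^bsub>N\<^esub> y)#}"

definition tensor_class ::
  "('r, 'z) ring_scheme \<Rightarrow> ('r, 'm, 'y) module_scheme \<Rightarrow> ('r, 'n, 'x) module_scheme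
    \<Rightarrow> ('m \<times> 'n) multiset \<Rightarrow> ('m \<times> 'n) multiset set"
  where "tensor_class R M N X = {Y. tensor_rel R M N X Y}"

definition pure_tensor ::
  "('r, 'z) ring_scheme \<Rightarrow> ('r, 'm, 'y) module_scheme \<Rightarrow> ('r, 'n, 'x) module_scheme
    \<Rightarrow> 'm \<Rightarrow> 'n \<Rightarrow> ('m \<times> 'n) multiset set"
  where "pure_tensor R M N x y = tensor_class R M N {#(x, y)#}"

text \<open>
  The map \<open>f \<otimes> g\<close> into \<open>M \<otimes>\<^sub>R N\<close>.  As for the operations of \<open>tensor\<close> below, the union runs over
  all representatives; whenever the map is well defined, all members of the union coincide.
\<close>

definition tensor_map ::
  "('r, 'z) ring_scheme \<Rightarrow> ('r, 'm, 'y) module_scheme \<Rightarrow> ('r, 'n, 'x) module_scheme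
    \<Rightarrow> ('a \<Rightarrow> 'm) \<Rightarrow> ('b \<Rightarrow> 'n) \<Rightarrow> ('a \<times> 'b) multiset set \<Rightarrow> ('m \<times> 'n) multiset set"
  where "tensor_map R M N f g A = (\<Union>X\<in>A. tensor_class R M N (image_mset (map_prod f g) X))"

text \<open>
  The fields \<open>mult\<close> and \<open>one\<close> are meaningful only if \<open>M\<close> and \<open>N\<close> are \<open>R\<close>-algebras.
\<close>

definition tensor ::
  "('r, 'z) ring_scheme \<Rightarrow> ('r, 'm, 'y) module_scheme \<Rightarrow> ('r, 'n, 'x) module_scheme
    \<Rightarrow> ('r, ('m \<times> 'n) multiset set) module"
  where "tensor R M N =
    \<lparr>carrier = tensor_class R M N ` {X. set_mset X \<subseteq> carrier M \<times> carrier N},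
     mult = (\<lambda>A B. \<Union>X\<in>A. \<Union>Y\<in>B. tensor_class R M N
       (\<Sum>u\<in>#X. image_mset (\<lambda>v. (fst u \<otimes>\<^bsub>M\<^esub> fst v, snd u \<otimes>\<^bsub>N\<^esub> snd v)) Y)),
     one = pure_tensor R M N \<one>\<^bsub>M\<^esub> \<one>\<^bsub>N\<^esub>,
     zero = tensor_class R M N {#},
     add = (\<lambda>A B. \<Union>X\<in>A. \<Union>Y\<in>B. tensor_class R M N (X + Y)),
     smult = (\<lambda>r. tensor_map R M N (\<lambda>x. r \<odot>\<^bsub>M\<^esub> x) id)\<rparr>"

section \<open>Principal parts and injectivity orders\<close>

definition regular_module :: "('b, 'z) ring_scheme \<Rightarrow> ('b, 'b) module"
  where "regular_module B =
    \<lparr>carrier = carrier B, mult = mult B, one = \<one>\<^bsub>B\<^esub>, zero = \<zero>\<^bsub>B\<^esub>, add = add B, smult = mult B\<rparr>"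

definition restrict_scalars :: "('r \<Rightarrow> 's) \<Rightarrow> ('s, 'm, 'z) module_scheme \<Rightarrow> ('r, 'm) module"
  where "restrict_scalars h M =
    \<lparr>carrier = carrier M, mult = mult M, one = \<one>\<^bsub>M\<^esub>, zero = \<zero>\<^bsub>M\<^esub>, add = add M,
     smult = (\<lambda>r. smult M (h r))\<rparr>"

primrec ideal_power :: "('a, 'z) ring_scheme \<Rightarrow> 'a set \<Rightarrow> nat \<Rightarrow> 'a set"
  where
    "ideal_power R I 0 = carrier R"
  | "ideal_power R I (Suc l) = ideal_prod R (ideal_power R I l) I"

text \<open>The multiplication map \<open>A \<otimes>\<^sub>k A \<rightarrow> A\<close> of a \<open>k\<close>-algebra \<open>A\<close>.\<close>

definition mult_map :: "('k, 'a, 'z) module_scheme \<Rightarrow> ('a \<times> 'a) multiset set \<Rightarrow> 'a"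
  where "mult_map A t = the_elem
    ((\<lambda>X. finsum A (\<lambda>u. add_pow A (count X u) (fst u \<otimes>\<^bsub>A\<^esub> snd u)) (set_mset X)) ` t)"

definition diagonal_ideal ::
  "('k, 'y) ring_scheme \<Rightarrow> ('k, 'a, 'z) module_scheme \<Rightarrow> ('a \<times> 'a) multiset set set"
  where "diagonal_ideal k A = a_kernel (tensor k A A) A (mult_map A)"

text \<open>\<open>P\<^sup>l\<^bsub>A/k\<^esub> = (A \<otimes>\<^sub>k A) / I\<^bsup>l+1\<^esup>\<close>, where \<open>I\<close> is the ideal of the diagonal.\<close>

definition pp_ring ::
  "('k, 'y) ring_scheme \<Rightarrow> ('k, 'a, 'z) module_scheme \<Rightarrow> nat
    \<Rightarrow> ('a \<times> 'a) multiset set set ring"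
  where "pp_ring k A l = tensor k A A Quot ideal_power (tensor k A A) (diagonal_ideal k A) (Suc l)"

definition pp_left ::
  "('k, 'y) ring_scheme \<Rightarrow> ('k, 'a, 'z) module_scheme \<Rightarrow> nat
    \<Rightarrow> 'a \<Rightarrow> ('a \<times> 'a) multiset set set"
  where "pp_left k A l a =
    ideal_power (tensor k A A) (diagonal_ideal k A) (Suc l) +>\<^bsub>tensor k A A\<^esub> pure_tensor k A A a \<one>\<^bsub>A\<^esub>"

definition pp_right ::
  "('k, 'y) ring_scheme \<Rightarrow> ('k, 'a, 'z) module_scheme \<Rightarrow> nat
    \<Rightarrow> 'a \<Rightarrow> ('a \<times> 'a) multiset set set"
  where "pp_right k A l a =
    ideal_power (tensor k A A) (diagonal_ideal k A) (Suc l) +>\<^bsub>tensor k A A\<^esub> pure_tensor k A A \<one>\<^bsub>A\<^esub> a"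

text \<open>
  \<open>P\<^sup>l\<^bsub>A/k\<^esub>(F) = P\<^sup>l\<^bsub>A/k\<^esub> \<otimes>\<^sub>A F\<close>: the tensor product uses the right \<open>A\<close>-module structure of
  \<open>P\<^sup>l\<^bsub>A/k\<^esub>\<close>, and the result is an \<open>A\<close>-module through the left one.
\<close>

abbreviation pp_right_module ::
  "('k, 'y) ring_scheme \<Rightarrow> ('k, 'a, 'z) module_scheme \<Rightarrow> nat
    \<Rightarrow> ('a, ('a \<times> 'a) multiset set set) module"
  where "pp_right_module k A l \<equiv> restrict_scalars (pp_right k A l) (regular_module (pp_ring k A l))"

definition principal_parts ::
  "('k, 'y) ring_scheme \<Rightarrow> ('k, 'a, 'z) module_scheme \<Rightarrow> ('a, 'f, 'x) module_scheme \<Rightarrow> nat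
    \<Rightarrow> ('a, (('a \<times> 'a) multiset set set \<times> 'f) multiset set) module"
  where "principal_parts k A F l =
    tensor A (pp_right_module k A l) F
      \<lparr>smult := \<lambda>a. tensor_map A (pp_right_module k A l) F
        (\<lambda>p. pp_left k A l a \<otimes>\<^bsub>pp_ring k A l\<^esub> p) id\<rparr>"

definition taylor ::
  "('k, 'y) ring_scheme \<Rightarrow> ('k, 'a, 'z) module_scheme \<Rightarrow> ('a, 'f, 'x) module_scheme \<Rightarrow> nat
    \<Rightarrow> 'f \<Rightarrow> (('a \<times> 'a) multiset set set \<times> 'f) multiset set"
  where "taylor k A F l v = pure_tensor A (pp_right_module k A l) F \<one>\<^bsub>pp_ring k A l\<^esub> v"

text \<open>
  Now let \<open>A\<close> be the local ring of a \<open>k\<close>-scheme at a point \<open>x\<close>, \<open>F\<close> the stalk of a locally free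
  module and \<open>V\<close> a \<open>k\<close>-subspace of \<open>F\<close>.  Forming principal parts commutes with localisation, so
  \<open>principal_parts k A F l\<close> is the stalk at \<open>x\<close> of the sheaf of principal parts.
\<close>

abbreviation max_ideal :: "('a, 'z) ring_scheme \<Rightarrow> 'a set"
  where "max_ideal A \<equiv> carrier A - Units A"

definition residue_field :: "('a, 'z) ring_scheme \<Rightarrow> ('a, 'a set) module"
  where "residue_field A =
    restrict_scalars (\<lambda>a. max_ideal A +>\<^bsub>A\<^esub> a) (regular_module (A Quot max_ideal A))"

definition structure_map :: "('k, 'a, 'z) module_scheme \<Rightarrow> 'k \<Rightarrow> 'a"
  where "structure_map A c = c \<odot>\<^bsub>A\<^esub> \<one>\<^bsub>A\<^esub>"

definition fibre_source ::
  "('k, 'y) ring_scheme \<Rightarrow> ('k, 'a, 'z) module_scheme \<Rightarrow> ('a, 'f, 'x) module_scheme \<Rightarrow> 'f set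
    \<Rightarrow> ('k, ('a set \<times> 'f) multiset set) module"
  where "fibre_source k A F V =
    tensor k (restrict_scalars (structure_map A) (residue_field A))
      ((restrict_scalars (structure_map A) F) \<lparr>carrier := V\<rparr>)"

text \<open>
  The map \<open>k\<^sub>x \<otimes>\<^sub>k V \<rightarrow> k\<^sub>x \<otimes>\<^sub>A P\<^sup>l(F)\<close>, \<open>c \<otimes> v \<mapsto> c \<otimes> (1 \<otimes> v)\<close>, induced on fibres by
  the Taylor map, after the identification \<open>k\<^sub>x \<otimes>\<^sub>A (A \<otimes>\<^sub>k V) = k\<^sub>x \<otimes>\<^sub>k V\<close>.
\<close>

definition taylor_fibre ::
  "('k, 'y) ring_scheme \<Rightarrow> ('k, 'a, 'z) module_scheme \<Rightarrow> ('a, 'f, 'x) module_scheme \<Rightarrow> nat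
    \<Rightarrow> ('a set \<times> 'f) multiset set
    \<Rightarrow> ('a set \<times> (('a \<times> 'a) multiset set set \<times> 'f) multiset set) multiset set"
  where "taylor_fibre k A F l =
    tensor_map A (residue_field A) (principal_parts k A F l) id (taylor k A F l)"

text \<open>The value is \<open>\<infinity>\<close> if no Taylor map is injective on the fibre.\<close>

definition injectivity_order ::
  "('k, 'y) ring_scheme \<Rightarrow> ('k, 'a, 'z) module_scheme \<Rightarrow> ('a, 'f, 'x) module_scheme \<Rightarrow> 'f set \<Rightarrow> enat"
  where "injectivity_order k A F V =
    (INF l \<in> {l. inj_on (taylor_fibre k A F l) (carrier (fibre_source k A F V))}. enat l)"

section \<open>The ring of Laurent polynomials\<close>

text \<open>
  The group algebra of \<open>M = int ^ 'n\<close> over \<open>'k\<close>.  It is a type of its own because the type of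
  finitely supported functions is an instance of \<open>idom\<close> only for linearly ordered exponents.
\<close>

typedef (overloaded) ('k, 'n) laurent = "UNIV :: ((int ^ 'n::finite) \<Rightarrow>\<^sub>0 'k::zero) set"
  morphisms laurent_coeffs Laurent by simp

setup_lifting type_definition_laurent

instantiation laurent :: (comm_ring_1, finite) comm_ring_1
begin

lift_definition zero_laurent :: "('a, 'b) laurent" is 0 .
lift_definition one_laurent :: "('a, 'b) laurent" is 1 .
lift_definition plus_laurent :: "('a, 'b) laurent \<Rightarrow> ('a, 'b) laurent \<Rightarrow> ('a, 'b) laurent" is "(+)" .
lift_definition minus_laurent :: "('a, 'b) laurent \<Rightarrow> ('a, 'b) laurent \<Rightarrow> ('a, 'b) laurent" is "(-)" .
lift_definition uminus_laurent :: "('a, 'b) laurent \<Rightarrow> ('a, 'b) laurent" is uminus .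
lift_definition times_laurent :: "('a, 'b) laurent \<Rightarrow> ('a, 'b) laurent \<Rightarrow> ('a, 'b) laurent" is "(*)" .

instance by standard (transfer; simp add: algebra_simps)+

end

lemma exists_linearly_ordered_embedding:
  "\<exists>f :: int ^ 'n::finite \<Rightarrow> (nat \<Rightarrow>\<^sub>0 int). inj f \<and> (\<forall>u v. f (u + v) = f u + f v)"
proof -
  obtain h :: "'n \<Rightarrow> nat" where h: "inj h"
    using finite_imp_inj_to_nat_seg[of "UNIV :: 'n set"] by auto
  define f :: "int ^ 'n \<Rightarrow> (nat \<Rightarrow>\<^sub>0 int)"
    where "f v = (\<Sum>i\<in>UNIV. Poly_Mapping.single (h i) (v $ i))" for v
  have "Poly_Mapping.lookup (f v) (h i) = v $ i" for v i
  proof -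
    have "Poly_Mapping.lookup (f v) (h i) = (\<Sum>j\<in>UNIV. if j = i then v $ j else 0)"
      unfolding f_def Poly_Mapping.lookup_sum
      by (rule sum.cong) (auto simp: lookup_single when_def inj_eq[OF h])
    then show ?thesis by simp
  qed
  then have "inj f" by (metis (mono_tags, lifting) injI vec_eq_iff)
  moreover have "f (u + v) = f u + f v" for u v
    by (simp add: f_def single_add sum.distrib)
  ultimately show ?thesis by blast
qed

lemma group_algebra_no_zero_divisors:
  fixes p q :: "(int ^ 'n::finite) \<Rightarrow>\<^sub>0 'k::idom"
  assumes "p \<noteq> 0" "q \<noteq> 0"
  shows "p * q \<noteq> 0"
proof -
  obtain f :: "int ^ 'n \<Rightarrow> (nat \<Rightarrow>\<^sub>0 int)" where f: "inj f" "\<And>u v. f (u + v) = f u + f v"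
    using exists_linearly_ordered_embedding by blast
  have ex: "\<exists>a\<in>Poly_Mapping.keys r. \<forall>b\<in>Poly_Mapping.keys r. f b \<le> f a"
    if "r \<noteq> 0" for r :: "(int ^ 'n) \<Rightarrow>\<^sub>0 'k"
  proof -
    have "Max (f ` Poly_Mapping.keys r) \<in> f ` Poly_Mapping.keys r" using that by simp
    then obtain a where "a \<in> Poly_Mapping.keys r" "f a = Max (f ` Poly_Mapping.keys r)" by auto
    then show ?thesis by (metis Max_ge finite_imageI finite_keys image_eqI)
  qed
  obtain a where a: "a \<in> Poly_Mapping.keys p" "\<And>u. u \<in> Poly_Mapping.keys p \<Longrightarrow> f u \<le> f a"
    using ex[OF assms(1)] by blast
  obtain b where b: "b \<in> Poly_Mapping.keys q" "\<And>u. u \<in> Poly_Mapping.keys q \<Longrightarrow> f u \<le> f b"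
    using ex[OF assms(2)] by blast
  have inner: "Sum_any (\<lambda>v. Poly_Mapping.lookup q v when a + b = u + v) = Poly_Mapping.lookup q (a + b - u)" for u
  proof -
    have "Sum_any (\<lambda>v. Poly_Mapping.lookup q v when a + b = u + v) = Sum_any (\<lambda>v. Poly_Mapping.lookup q v when v = a + b - u)"
      by (rule arg_cong[where f = Sum_any]) (auto simp: when_def fun_eq_iff algebra_simps)
    then show ?thesis by simp
  qed
  have vanish: "Poly_Mapping.lookup p u * Poly_Mapping.lookup q (a + b - u) = 0" if "u \<noteq> a" for u
  proof (rule ccontr)
    assume "\<not> ?thesis"
    then have "u \<in> Poly_Mapping.keys p" "a + b - u \<in> Poly_Mapping.keys q"
      by (auto simp: in_keys_iff)
    with a b have "f u \<le> f a" "f (a + b - u) \<le> f b" by auto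
    moreover have "f u \<noteq> f a" using f(1) that by (auto dest: injD)
    ultimately have "f u + f (a + b - u) < f a + f b" by (simp add: add_less_le_mono)
    moreover have "f u + f (a + b - u) = f a + f b"
      using f(2)[of u "a + b - u"] f(2)[of a b] by simp
    ultimately show False by simp
  qed
  have "Poly_Mapping.lookup (p * q) (a + b) = Sum_any (\<lambda>u. Poly_Mapping.lookup p u * Poly_Mapping.lookup q (a + b - u))"
    by (simp only: lookup_mult inner)
  also have "\<dots> = Sum_any (\<lambda>u. (Poly_Mapping.lookup p u * Poly_Mapping.lookup q (a + b - u)) when u = a)"
    using vanish by (intro arg_cong[where f = Sum_any]) (auto simp: when_def fun_eq_iff)
  also have "\<dots> = Poly_Mapping.lookup p a * Poly_Mapping.lookup q b" by simp
  finally have "Poly_Mapping.lookup (p * q) (a + b) \<noteq> 0" using a(1) b(1) by (simp add: in_keys_iff)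
  then show ?thesis by auto
qed

instance laurent :: (idom, finite) idom
  by standard (transfer, rule group_algebra_no_zero_divisors)

lift_definition monomial :: "int ^ 'n::finite \<Rightarrow> ('k::comm_ring_1, 'n) laurent"
  is "\<lambda>m. Poly_Mapping.single m 1" .

lift_definition const :: "'k::comm_ring_1 \<Rightarrow> ('k, 'n::finite) laurent"
  is "\<lambda>c. Poly_Mapping.single 0 c" .

lift_definition support :: "('k::comm_ring_1, 'n::finite) laurent \<Rightarrow> (int ^ 'n) set"
  is Poly_Mapping.keys .

text \<open>
  \<open>\<Oplus>\<^bsub>m \<in> S\<^esub> k x\<^sup>m\<close>; this is the semigroup algebra \<open>k[S]\<close> if \<open>S\<close> is a semigroup containing \<open>0\<close>.
\<close>

definition monomial_span :: "(int ^ 'n::finite) set \<Rightarrow> ('k::comm_ring_1, 'n) laurent set"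
  where "monomial_span S = {f. support f \<subseteq> S}"

section \<open>Stalks inside the function field\<close>

text \<open>
  The torus and the toric varieties considered here are integral with function field
  \<open>K = ('k, 'n) laurent fract\<close>; local rings and stalks of invertible sheaves are realised as
  subsets of \<open>K\<close>.
\<close>

definition ring_on :: "'a::comm_ring_1 set \<Rightarrow> 'a ring"
  where "ring_on S = \<lparr>carrier = S, mult = (*), one = 1, zero = 0, add = (+)\<rparr>"

definition algebra_on :: "('k::idom, 'n::finite) laurent fract set \<Rightarrow> ('k, ('k, 'n) laurent fract) module"
  where "algebra_on S = \<lparr>carrier = S, mult = (*), one = 1, zero = 0, add = (+),
    smult = (\<lambda>c f. Fract (const c) 1 * f)\<rparr>"

definition embed :: "('k::idom, 'n::finite) laurent \<Rightarrow> ('k, 'n) laurent fract"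
  where "embed f = Fract f 1"

definition local_ring ::
  "('k::idom, 'n::finite) laurent set \<Rightarrow> ('k, 'n) laurent set \<Rightarrow> ('k, 'n) laurent fract set"
  where "local_ring A \<pp> = {Fract f g | f g. f \<in> A \<and> g \<in> A - \<pp>}"

definition stalk_injectivity_order ::
  "('k::idom, 'n::finite) laurent fract set \<Rightarrow> ('k, 'n) laurent fract set
    \<Rightarrow> ('k, 'n) laurent fract set \<Rightarrow> enat"
  where "stalk_injectivity_order A L V =
    injectivity_order (ring_on (UNIV :: 'k set)) (algebra_on A) (regular_module (ring_on L)) V"

text \<open>
  \<open>N\<^bsub>inj\<^esub>(Q)\<close>: the injectivity order of \<open>\<Oplus>\<^bsub>m \<in> Q\<^esub> k x\<^sup>m\<close> at the generic point of the torus,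
  which is the zero ideal of \<open>k[T]\<close>.
\<close>

definition N_inj :: "'k::idom itself \<Rightarrow> (int ^ 'n::finite) set \<Rightarrow> enat"
  where "N_inj _ Q =
    (let K\<^sub>T = local_ring (UNIV :: ('k, 'n) laurent set) {0}
     in stalk_injectivity_order K\<^sub>T K\<^sub>T (embed ` monomial_span Q))"

section \<open>Lattice polytopes\<close>

definition lattice_pt :: "int ^ 'n \<Rightarrow> real ^ 'n"
  where "lattice_pt m = (\<chi> i. real_of_int (m $ i))"

definition lattice_points :: "(real ^ 'n) set \<Rightarrow> (int ^ 'n) set"
  where "lattice_points P = {m. lattice_pt m \<in> P}"

definition lattice_vertices :: "(real ^ 'n) set \<Rightarrow> (int ^ 'n) set"
  where "lattice_vertices P = {m. lattice_pt m extreme_point_of P}"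

definition lattice_polytope :: "(real ^ 'n) set \<Rightarrow> bool"
  where "lattice_polytope P \<longleftrightarrow> polytope P \<and> P \<noteq> {} \<and>
    (\<forall>v. v extreme_point_of P \<longrightarrow> v \<in> range lattice_pt)"

definition edge_vector :: "int ^ 'n \<Rightarrow> (real ^ 'n) set \<Rightarrow> int ^ 'n \<Rightarrow> bool"
  where "edge_vector m E e \<longleftrightarrow> e \<noteq> 0 \<and> lattice_pt (m + e) \<in> E \<and>
    (\<forall>e'. e' \<noteq> 0 \<and> lattice_pt (m + e') \<in> E \<longrightarrow> norm (lattice_pt e) \<le> norm (lattice_pt e'))"

text \<open>
  The vectors \<open>e\<^bsub>ij\<^esub>\<close> at the vertex \<open>m\<^sub>i\<close> are indexed by themselves instead of by \<open>j\<close>.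
\<close>

definition edge_basis :: "(real ^ 'n) set \<Rightarrow> int ^ 'n \<Rightarrow> (int ^ 'n) set"
  where "edge_basis P m = {e. \<exists>E. E edge_of P \<and> lattice_pt m \<in> E \<and> edge_vector m E e}"

definition coordinates :: "(int ^ 'n) set \<Rightarrow> int ^ 'n \<Rightarrow> (int ^ 'n \<Rightarrow> int) \<Rightarrow> bool"
  where "coordinates B m c \<longleftrightarrow> (\<forall>e. e \<notin> B \<longrightarrow> c e = 0) \<and> m = (\<Sum>e\<in>B. c e *s e)"

definition lattice_basis :: "(int ^ 'n) set \<Rightarrow> bool"
  where "lattice_basis B \<longleftrightarrow> finite B \<and> (\<forall>m. \<exists>!c. coordinates B m c)"

definition coord :: "(int ^ 'n) set \<Rightarrow> int ^ 'n \<Rightarrow> int ^ 'n \<Rightarrow> int"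
  where "coord B m = (THE c. coordinates B m c)"

definition basis_condition :: "(real ^ 'n) set \<Rightarrow> bool"
  where "basis_condition P \<longleftrightarrow> (\<forall>m \<in> lattice_vertices P.
    card {E. E edge_of P \<and> lattice_pt m \<in> E} = CARD('n) \<and> lattice_basis (edge_basis P m))"

text \<open>For a vertex \<open>m\<close> of a face \<open>F\<close>: the part \<open>{e\<^bsub>ij\<^esub> | j \<in> J\<^sub>r}\<close> of the basis parallel to \<open>F\<close>.\<close>

definition face_basis :: "(real ^ 'n) set \<Rightarrow> (real ^ 'n) set \<Rightarrow> int ^ 'n \<Rightarrow> (int ^ 'n) set"
  where "face_basis P F m =
    {e. \<exists>E. E edge_of P \<and> lattice_pt m \<in> E \<and> E \<subseteq> F \<and> edge_vector m E e}"

definition face_lattice :: "(real ^ 'n) set \<Rightarrow> (real ^ 'n) set \<Rightarrow> int ^ 'n \<Rightarrow> (int ^ 'n) set"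
  where "face_lattice P F m = {m + (\<Sum>e\<in>face_basis P F m. a e *s e) | a. True}"

text \<open>\<open>face_distance P F m u\<close> is the distance \<open>d\<^sub>H\<close> of \<open>H = u + H\<^sub>r\<close> from \<open>H\<^sub>r\<close>.\<close>

definition face_distance :: "(real ^ 'n) set \<Rightarrow> (real ^ 'n) set \<Rightarrow> int ^ 'n \<Rightarrow> int ^ 'n \<Rightarrow> int"
  where "face_distance P F m u =
    (\<Sum>e \<in> edge_basis P m - face_basis P F m. coord (edge_basis P m) u e)"

definition vertex_length :: "(real ^ 'n) set \<Rightarrow> int ^ 'n \<Rightarrow> int ^ 'n \<Rightarrow> int"
  where "vertex_length P m m' = (\<Sum>e \<in> edge_basis P m. coord (edge_basis P m) (m' - m) e)"

section \<open>The toric variety of a polytope\<close>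

inductive_set generated_semigroup :: "(int ^ 'n) set \<Rightarrow> (int ^ 'n) set"
  for S
where
  gen: "s \<in> S \<Longrightarrow> s \<in> generated_semigroup S"
| add: "s \<in> generated_semigroup S \<Longrightarrow> t \<in> generated_semigroup S \<Longrightarrow> s + t \<in> generated_semigroup S"

definition vertex_semigroup :: "(real ^ 'n) set \<Rightarrow> int ^ 'n \<Rightarrow> (int ^ 'n) set"
  where "vertex_semigroup P m = generated_semigroup ((\<lambda>p. p - m) ` lattice_points P)"

definition chart :: "(real ^ 'n::finite) set \<Rightarrow> int ^ 'n \<Rightarrow> ('k::comm_ring_1, 'n) laurent set"
  where "chart P m = monomial_span (vertex_semigroup P m)"

definition overlap :: "(real ^ 'n::finite) set \<Rightarrow> int ^ 'n \<Rightarrow> int ^ 'n \<Rightarrow> ('k::comm_ring_1, 'n) laurent set"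
  where "overlap P m m' =
    monomial_span {s + t | s t. s \<in> vertex_semigroup P m \<and> t \<in> vertex_semigroup P m'}"

text \<open>
  The disjoint union of the charts \<open>U\<^sub>i = Spec k[M\<^sub>i]\<close>, and the gluing of \<open>U\<^sub>i\<close> and \<open>U\<^sub>j\<close>
  along their common open subscheme \<open>Spec k[M\<^sub>i + M\<^sub>j]\<close>.
\<close>

definition chart_points ::
  "(real ^ 'n::finite) set \<Rightarrow> ((int ^ 'n) \<times> ('k::comm_ring_1, 'n) laurent set) set"
  where "chart_points P =
    {(m, \<pp>). m \<in> lattice_vertices P \<and> primeideal \<pp> (ring_on (chart P m))}"

definition glue ::
  "(real ^ 'n::finite) set \<Rightarrow> ((int ^ 'n) \<times> ('k::comm_ring_1, 'n) laurent set) rel"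
  where "glue P = {((m, \<pp>), (m', \<pp>')). (m, \<pp>) \<in> chart_points P \<and> (m', \<pp>') \<in> chart_points P \<and>
    (\<exists>\<qq>. primeideal \<qq> (ring_on (overlap P m m')) \<and>
      \<qq> \<inter> chart P m = \<pp> \<and> \<qq> \<inter> chart P m' = \<pp>')}"

type_synonym ('k, 'n) toric_point = "((int ^ 'n) \<times> ('k, 'n) laurent set) set"

definition toric_variety :: "(real ^ 'n::finite) set \<Rightarrow> ('k::comm_ring_1, 'n) toric_point set"
  where "toric_variety P = chart_points P // glue P"

text \<open>
  The stalks at \<open>x\<close> of the structure sheaf and of the line bundle \<open>\<L>(P)\<close>, which is generated by
  \<open>x\<^bsup>m\<^sub>i\<^esup>\<close> on \<open>U\<^sub>i\<close>; the charts containing \<open>x\<close> all contribute the same subset of \<open>K\<close>.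
\<close>

definition structure_stalk ::
  "(real ^ 'n::finite) set \<Rightarrow> ('k::idom, 'n) toric_point \<Rightarrow> ('k, 'n) laurent fract set"
  where "structure_stalk P x = (\<Union>(m, \<pp>)\<in>x. local_ring (chart P m) \<pp>)"

definition bundle_stalk ::
  "(real ^ 'n::finite) set \<Rightarrow> ('k::idom, 'n) toric_point \<Rightarrow> ('k, 'n) laurent fract set"
  where "bundle_stalk P x =
    (\<Union>(m, \<pp>)\<in>x. (\<lambda>f. f * embed (monomial m)) ` local_ring (chart P m) \<pp>)"

definition n_inj :: "(real ^ 'n::finite) set \<Rightarrow> ('k::idom, 'n) toric_point \<Rightarrow> enat"
  where "n_inj P x = stalk_injectivity_order (structure_stalk P x) (bundle_stalk P x)
    (embed ` monomial_span (lattice_points P))"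

definition n_inj_total :: "'k::idom itself \<Rightarrow> (real ^ 'n::finite) set \<Rightarrow> enat"
  where "n_inj_total _ P = (SUP x \<in> (toric_variety P :: ('k, 'n) toric_point set). n_inj P x)"

text \<open>
  The generic point of the torus orbit of the face \<open>F\<close>, given in the chart of a vertex \<open>m\<close> of \<open>F\<close>
  by the ideal \<open>(x\<^bsup>e\<^esup>)\<close>, \<open>e\<close> running through the basis vectors at \<open>m\<close> not parallel to \<open>F\<close>.
\<close>

definition orbit_generic_point ::
  "'k::idom itself \<Rightarrow> (real ^ 'n::finite) set \<Rightarrow> (real ^ 'n) set \<Rightarrow> int ^ 'n \<Rightarrow> ('k, 'n) toric_point"
  where "orbit_generic_point _ P F m =
    glue P `` {(m, genideal (ring_on (chart P m)) (monomial ` (edge_basis P m - face_basis P F m)))}"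

end

theory Submission
  imports Defs
begin

text \<open>
  Let \<open>x\<^sub>e\<close> be the coordinates of the chart at a vertex \<open>m\<close>. In the fibre of \<open>P\<^sup>l\<close> at a point the
  Taylor map is the substitution \<open>x\<^sub>e \<mapsto> x\<^sub>e + y\<^sub>e\<close> modulo degree \<open>l + 1\<close> in \<open>y\<close>, its coefficients
  being the divided derivatives of the section: differential operators of order at most \<open>l\<close> kill
  \<open>I\<^sup>l\<^sup>+\<^sup>1\<close>, and the \<open>y\<close>-monomials of degree at most \<open>l\<close> span the fibre. At the generic point of an
  orbit the coordinates \<open>x\<^sub>e\<close> with \<open>e\<close> not parallel to the face vanish. A section \<open>x\<^sup>u\<close> then carries
  the \<open>y\<close>-monomial given by the exponents of \<open>u - m\<close> in these directions, so the map splits into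
  the slices of \<open>P\<close> by the translates of the face lattice, each of which uses up its distance from
  the order \<open>l\<close>. On a slice the remaining coordinates are units, and injectivity says that
  polynomials of degree at most \<open>l - d\<close> separate its lattice points linearly; this is the condition
  at the generic point of the torus as well.

  At an arbitrary point of the chart nothing is truncated once \<open>l\<close> is at least the largest degree
  of \<open>u - m\<close>, and the substitution is then injective. This degree is the order at the fixed point
  \<open>m\<close>, and it is attained at a vertex because the degree extends to a linear functional.
\<close>

section \<open>Tensor products\<close>

text \<open>The modules are quotients by a generated congruence, so no basis of the fibre of P^l is
  at hand. Injectivity is squeezed from two sides: differential operators of order at most l give
  well-defined functionals on the fibre, and failure is shown by expanding a formal sum into terms
  that visibly vanish there. Both sides meet in one matrix condition, \<open>crit\<close>, on the
  Taylor coefficients modulo the maximal ideal. Characteristic 0 enters when iterated derivations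
  are divided by factorials. The residue field at a generic point may be larger than k, whereas
  \<open>separated\<close> is a condition over k; a k-linear functional on the function field that
  kills the maximal ideal bridges the gap. All stalks are subsets of one function field. Gluing thus
  becomes equality of subsets, and the generic point of the torus becomes the zero ideal of any
  vertex chart, so that N_inj is computed in the same coordinates as the orders on orbits. Orders
  are not computed as minima: two of them agree if they have the same upper bounds
  \<open>enat l\<close>.\<close>

lemma tensor_rel_lift:
  fixes \<phi> :: "'m \<times> 'n \<Rightarrow> 'p::comm_monoid_add"
  assumes XY: "tensor_rel R M N X Y"
    and refl: "\<And>x y. x \<in> carrier M \<Longrightarrow> y \<in> carrier N \<Longrightarrow> E (\<phi> (x, y)) (\<phi> (x, y))"
    and zero: "E 0 0"
    and sym: "\<And>p q. E p q \<Longrightarrow> E q p"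
    and trans: "\<And>p q r. E p q \<Longrightarrow> E q r \<Longrightarrow> E p r"
    and add: "\<And>p q p' q'. E p p' \<Longrightarrow> E q q' \<Longrightarrow> E (p + q) (p' + q')"
    and zero_left: "\<And>y. y \<in> carrier N \<Longrightarrow> E (\<phi> (\<zero>\<^bsub>M\<^esub>, y)) 0"
    and left: "\<And>x x' y. x \<in> carrier M \<Longrightarrow> x' \<in> carrier M \<Longrightarrow> y \<in> carrier N
      \<Longrightarrow> E (\<phi> (x \<oplus>\<^bsub>M\<^esub> x', y)) (\<phi> (x, y) + \<phi> (x', y))"
    and right: "\<And>x y y'. x \<in> carrier M \<Longrightarrow> y \<in> carrier N \<Longrightarrow> y' \<in> carrier N
      \<Longrightarrow> E (\<phi> (x, y \<oplus>\<^bsub>N\<^esub> y')) (\<phi> (x, y) + \<phi> (x, y'))"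
    and balanced: "\<And>r x y. r \<in> carrier R \<Longrightarrow> x \<in> carrier M \<Longrightarrow> y \<in> carrier N
      \<Longrightarrow> E (\<phi> (r \<odot>\<^bsub>M\<^esub> x, y)) (\<phi> (x, r \<odot>\<^bsub>N\<^esub> y))"
  shows "E (\<Sum>u\<in>#X. \<phi> u) (\<Sum>u\<in>#Y. \<phi> u)"
  using XY
proof induction
  case (refl X)
  then show ?case
  proof (induction X)
    case (add u X)
    then have "E (\<phi> u) (\<phi> u)" using assms(2) by (cases u) auto
    with add show ?case using assms(6) by simp
  qed (simp add: zero)
next
  case (sym X Y)
  then show ?case using assms(4) by blast
next
  case (trans X Y Z)
  then show ?case using assms(5) by blast
next
  case (add X X' Y Y')
  then show ?case using assms(6) by simp
next
  case (balanced r x y)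
  then show ?case using assms(10) by simp
qed (simp_all add: zero_left left right)

text \<open>The universal property of the tensor product in a form that tolerates maps that are
  bilinear only modulo a subgroup \<open>S\<close>. Maps on the residue field are built from
  arbitrarily chosen representatives and have this defect; \<open>S = {0}\<close> gives the exact
  version.\<close>

lemma tensor_rel_lift_mod:
  fixes \<phi> :: "'m \<times> 'n \<Rightarrow> 'p::ab_group_add"
  assumes XY: "tensor_rel R M N X Y"
    and S0: "0 \<in> S" and Sm: "\<And>p q. p \<in> S \<Longrightarrow> q \<in> S \<Longrightarrow> p - q \<in> S"
    and zero_left: "\<And>y. y \<in> carrier N \<Longrightarrow> \<phi> (\<zero>\<^bsub>M\<^esub>, y) \<in> S"
    and left: "\<And>x x' y. x \<in> carrier M \<Longrightarrow> x' \<in> carrier M \<Longrightarrow> y \<in> carrier N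
      \<Longrightarrow> \<phi> (x \<oplus>\<^bsub>M\<^esub> x', y) - (\<phi> (x, y) + \<phi> (x', y)) \<in> S"
    and right: "\<And>x y y'. x \<in> carrier M \<Longrightarrow> y \<in> carrier N \<Longrightarrow> y' \<in> carrier N
      \<Longrightarrow> \<phi> (x, y \<oplus>\<^bsub>N\<^esub> y') - (\<phi> (x, y) + \<phi> (x, y')) \<in> S"
    and balanced: "\<And>r x y. r \<in> carrier R \<Longrightarrow> x \<in> carrier M \<Longrightarrow> y \<in> carrier N
      \<Longrightarrow> \<phi> (r \<odot>\<^bsub>M\<^esub> x, y) - \<phi> (x, r \<odot>\<^bsub>N\<^esub> y) \<in> S"
  shows "(\<Sum>u\<in>#X. \<phi> u) - (\<Sum>u\<in>#Y. \<phi> u) \<in> S"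
proof -
  have neg: "- p \<in> S" if "p \<in> S" for p using Sm[OF S0 that] by simp
  have plus: "p + q \<in> S" if "p \<in> S" "q \<in> S" for p q using Sm[OF that(1) neg[OF that(2)]] by simp
  show ?thesis
  proof (rule tensor_rel_lift[OF XY, where E = "\<lambda>p q. p - q \<in> S"])
    fix p q r :: 'p assume "p - q \<in> S" "q - r \<in> S"
    then show "p - r \<in> S" using plus[of "p - q" "q - r"] by simp
  next
    fix p q p' q' :: 'p assume "p - p' \<in> S" "q - q' \<in> S"
    then show "p + q - (p' + q') \<in> S" using plus[of "p - p'" "q - q'"] by (simp add: algebra_simps)
  next
    fix p q :: 'p assume "p - q \<in> S"
    then show "q - p \<in> S" using neg[of "p - q"] by simp
  qed (use assms in auto)
qed

lemma image_map_prod_sum: "image_mset (map_prod f g) X = (\<Sum>u\<in>#X. {#map_prod f g u#})"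
  by (induction X) auto

lemma tensor_class_eqI: "tensor_rel R M N X Y \<Longrightarrow> tensor_class R M N X = tensor_class R M N Y"
  unfolding tensor_class_def
  by (intro Collect_cong iffI) (erule tensor_rel.trans[OF tensor_rel.sym], assumption, erule tensor_rel.trans)

text \<open>Balancing is assumed as a relation in the target, and not as compatibility of
  \<open>f\<close> and \<open>g\<close> with scalars, because the two tensor products may be formed
  over different rings, as over k and over the local ring.\<close>

lemma tensor_rel_map:
  assumes XY: "tensor_rel R M N X Y"
    and f: "\<And>x. x \<in> carrier M \<Longrightarrow> f x \<in> carrier M'" and f_zero: "f \<zero>\<^bsub>M\<^esub> = \<zero>\<^bsub>M'\<^esub>"
    and f_add: "\<And>x x'. x \<in> carrier M \<Longrightarrow> x' \<in> carrier M \<Longrightarrow> f (x \<oplus>\<^bsub>M\<^esub> x') = f x \<oplus>\<^bsub>M'\<^esub> f x'"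
    and g: "\<And>y. y \<in> carrier N \<Longrightarrow> g y \<in> carrier N'"
    and g_add: "\<And>y y'. y \<in> carrier N \<Longrightarrow> y' \<in> carrier N \<Longrightarrow> g (y \<oplus>\<^bsub>N\<^esub> y') = g y \<oplus>\<^bsub>N'\<^esub> g y'"
    and balanced: "\<And>r x y. r \<in> carrier R \<Longrightarrow> x \<in> carrier M \<Longrightarrow> y \<in> carrier N
      \<Longrightarrow> tensor_rel R' M' N' {#(f (r \<odot>\<^bsub>M\<^esub> x), g y)#} {#(f x, g (r \<odot>\<^bsub>N\<^esub> y))#}"
  shows "tensor_rel R' M' N' (image_mset (map_prod f g) X) (image_mset (map_prod f g) Y)"
  unfolding image_map_prod_sum
proof (rule tensor_rel_lift[OF XY, where E = "tensor_rel R' M' N'"], goal_cases)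
  case (1 x y) then show ?case using f g by (intro tensor_rel.refl) auto
next
  case 2 then show ?case by (intro tensor_rel.refl) auto
next
  case (3 p q) then show ?case by (rule tensor_rel.sym)
next
  case (4 p q r) then show ?case by (rule tensor_rel.trans)
next
  case (5 p q p' q') then show ?case by (rule tensor_rel.add)
next
  case (6 y) then show ?case using tensor_rel.zero[OF g] by (simp add: f_zero)
next
  case (7 x x' y)
  then show ?case using tensor_rel.distr_left[OF f[OF 7(1)] f[OF 7(2)] g[OF 7(3)], of R'] by (simp add: f_add add_mset_commute)
next
  case (8 x y y')
  then show ?case using tensor_rel.distr_right[OF f[OF 8(1)] g[OF 8(2)] g[OF 8(3)], of R'] by (simp add: g_add add_mset_commute)
next
  case (9 r x y) then show ?case using balanced by simp
qed

section \<open>Operations of a tensor product on representatives\<close>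

locale tensor_product =
  fixes R :: "('r, 'z) ring_scheme" and M :: "('r, 'm, 'y) module_scheme"
    and N :: "('r, 'n, 'x) module_scheme"
  assumes M_zero: "\<zero>\<^bsub>M\<^esub> \<in> carrier M"
    and M_add: "\<And>x y. x \<in> carrier M \<Longrightarrow> y \<in> carrier M \<Longrightarrow> x \<oplus>\<^bsub>M\<^esub> y \<in> carrier M"
    and M_smult: "\<And>r x. r \<in> carrier R \<Longrightarrow> x \<in> carrier M \<Longrightarrow> r \<odot>\<^bsub>M\<^esub> x \<in> carrier M"
    and N_add: "\<And>x y. x \<in> carrier N \<Longrightarrow> y \<in> carrier N \<Longrightarrow> x \<oplus>\<^bsub>N\<^esub> y \<in> carrier N"
    and N_smult: "\<And>r x. r \<in> carrier R \<Longrightarrow> x \<in> carrier N \<Longrightarrow> r \<odot>\<^bsub>N\<^esub> x \<in> carrier N"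
begin

abbreviation formal :: "('m \<times> 'n) multiset \<Rightarrow> bool"
  where "formal X \<equiv> set_mset X \<subseteq> carrier M \<times> carrier N"

abbreviation rel :: "('m \<times> 'n) multiset \<Rightarrow> ('m \<times> 'n) multiset \<Rightarrow> bool" (infix "\<doteq>" 50)
  where "X \<doteq> Y \<equiv> tensor_rel R M N X Y"

abbreviation cl :: "('m \<times> 'n) multiset \<Rightarrow> ('m \<times> 'n) multiset set"
  where "cl X \<equiv> tensor_class R M N X"

lemma rel_formal: "X \<doteq> Y \<Longrightarrow> formal X \<and> formal Y"
  by (induction rule: tensor_rel.induct) (auto simp: M_zero M_add M_smult N_add N_smult)

lemma cl_eq_iff: "formal X \<Longrightarrow> cl X = cl Y \<longleftrightarrow> X \<doteq> Y"
  using tensor_class_eqI tensor_rel.refl[of X M N R] tensor_rel.sym[of R M N Y X]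
  by (metis mem_Collect_eq tensor_class_def)

lemmas cl_eqI = tensor_class_eqI

lemma in_cl: "formal X \<Longrightarrow> X \<in> cl X"
  by (simp add: tensor_class_def tensor_rel.refl)

lemma in_cl_iff: "Y \<in> cl X \<longleftrightarrow> X \<doteq> Y"
  by (simp add: tensor_class_def)

lemma carrier_tensor: "carrier (tensor R M N) = cl ` {X. formal X}"
  by (simp add: tensor_def)

lemma cl_in_carrier: "formal X \<Longrightarrow> cl X \<in> carrier (tensor R M N)"
  by (auto simp: carrier_tensor)

lemma tensor_cases:
  assumes "t \<in> carrier (tensor R M N)"
  obtains X where "formal X" "t = cl X"
  using assms by (auto simp: carrier_tensor)

text \<open>Evaluates the unions over representatives by which the operations of
  \<open>tensor\<close> are defined: an invariant family has one value, and the union is nonempty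
  because \<open>X\<close> represents its own class.\<close>

lemma cl_UN:
  assumes "formal X" and "\<And>Y. X \<doteq> Y \<Longrightarrow> G Y = G X"
  shows "(\<Union>Y\<in>cl X. G Y) = G X"
proof -
  have "G Y = G X" if "Y \<in> cl X" for Y using assms(2) that in_cl_iff by blast
  then show ?thesis using in_cl[OF assms(1)] by blast
qed

lemma add_cl:
  assumes "formal X" "formal Y"
  shows "cl X \<oplus>\<^bsub>tensor R M N\<^esub> cl Y = cl (X + Y)"
proof -
  have "(\<Union>Y'\<in>cl Y. cl (X' + Y')) = cl (X' + Y)" if "formal X'" for X'
    by (rule cl_UN[OF assms(2)], rule cl_eqI, rule tensor_rel.add[OF tensor_rel.refl[OF that]],
      erule tensor_rel.sym)
  moreover have "(\<Union>X'\<in>cl X. cl (X' + Y)) = cl (X + Y)"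
    by (rule cl_UN[OF assms(1)], rule cl_eqI, rule tensor_rel.add[OF _ tensor_rel.refl[OF assms(2)]],
      erule tensor_rel.sym)
  moreover have "formal X'" if "X' \<in> cl X" for X' using that rel_formal by (auto simp: in_cl_iff)
  ultimately show ?thesis by (simp add: tensor_def)
qed

lemma zero_cl: "\<zero>\<^bsub>tensor R M N\<^esub> = cl {#}"
  by (simp add: tensor_def)

lemma rel_neg:
  assumes "x \<in> carrier M" "x' \<in> carrier M" "x \<oplus>\<^bsub>M\<^esub> x' = \<zero>\<^bsub>M\<^esub>" "y \<in> carrier N"
  shows "{#(x, y), (x', y)#} \<doteq> {#}"
  using tensor_rel.distr_left[OF assms(1,2,4)] tensor_rel.zero[OF assms(4)] assms(3)
  by (metis tensor_rel.sym tensor_rel.trans)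

lemma formal_map:
  assumes "set_mset X \<subseteq> A \<times> B" "\<And>x. x \<in> A \<Longrightarrow> f x \<in> carrier M" "\<And>y. y \<in> B \<Longrightarrow> g y \<in> carrier N"
  shows "formal (image_mset (map_prod f g) X)"
proof
  fix u assume "u \<in># image_mset (map_prod f g) X"
  then obtain v where v: "v \<in># X" "u = map_prod f g v" by auto
  then have "v \<in> A \<times> B" using assms(1) by blast
  then show "u \<in> carrier M \<times> carrier N" using assms(2,3) v(2) by auto
qed

lemma rel_neg_mset:
  assumes "formal X" and n: "\<And>x. x \<in> carrier M \<Longrightarrow> n x \<in> carrier M \<and> x \<oplus>\<^bsub>M\<^esub> n x = \<zero>\<^bsub>M\<^esub>"
  shows "X + image_mset (map_prod n id) X \<doteq> {#}"
  using assms(1)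
proof (induction X)
  case empty
  then show ?case by (auto intro: tensor_rel.refl)
next
  case (add u X)
  obtain x y where u: "u = (x, y)" by force
  have "{#(x, y), (n x, y)#} \<doteq> {#}" using add.prems u n by (intro rel_neg) auto
  then have "{#(x, y), (n x, y)#} + (X + image_mset (map_prod n id) X) \<doteq> {#} + {#}"
    using add by (intro tensor_rel.add) (simp_all add: id_def)
  then show ?case by (simp add: u add_mset_commute id_def)
qed

lemma tensor_abelian_group:
  assumes n: "\<And>x. x \<in> carrier M \<Longrightarrow> n x \<in> carrier M \<and> x \<oplus>\<^bsub>M\<^esub> n x = \<zero>\<^bsub>M\<^esub>"
  shows "abelian_group (tensor R M N)"
proof (rule abelian_groupI)
  fix t assume "t \<in> carrier (tensor R M N)"
  then obtain X where X: "formal X" "t = cl X" by (rule tensor_cases)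
  then have "formal (image_mset (map_prod n id) X)" using n by (intro formal_map) auto
  with X have "cl (image_mset (map_prod n id) X) \<oplus>\<^bsub>tensor R M N\<^esub> t = \<zero>\<^bsub>tensor R M N\<^esub>"
    using cl_eqI[OF rel_neg_mset[OF X(1) n]] by (simp add: add_cl zero_cl add.commute)
  then show "\<exists>y\<in>carrier (tensor R M N). y \<oplus>\<^bsub>tensor R M N\<^esub> t = \<zero>\<^bsub>tensor R M N\<^esub>"
    using cl_in_carrier[OF \<open>formal (image_mset (map_prod n id) X)\<close>] by (rule bexI)
next
  show "\<zero>\<^bsub>tensor R M N\<^esub> \<in> carrier (tensor R M N)" by (simp add: zero_cl cl_in_carrier)
next
  fix s t assume "s \<in> carrier (tensor R M N)" "t \<in> carrier (tensor R M N)"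
  then obtain X Y where "formal X" "formal Y" "s = cl X" "t = cl Y" by (metis tensor_cases)
  then show "s \<oplus>\<^bsub>tensor R M N\<^esub> t \<in> carrier (tensor R M N)"
    and "s \<oplus>\<^bsub>tensor R M N\<^esub> t = t \<oplus>\<^bsub>tensor R M N\<^esub> s"
    by (simp_all add: add_cl cl_in_carrier add.commute)
next
  fix s assume "s \<in> carrier (tensor R M N)"
  then obtain X where "formal X" "s = cl X" by (metis tensor_cases)
  then show "\<zero>\<^bsub>tensor R M N\<^esub> \<oplus>\<^bsub>tensor R M N\<^esub> s = s" by (simp add: add_cl zero_cl)
next
  fix r s t assume "r \<in> carrier (tensor R M N)" "s \<in> carrier (tensor R M N)" "t \<in> carrier (tensor R M N)"
  then obtain X Y Z where "formal X" "formal Y" "formal Z" "r = cl X" "s = cl Y" "t = cl Z"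
    by (metis tensor_cases)
  then show "r \<oplus>\<^bsub>tensor R M N\<^esub> s \<oplus>\<^bsub>tensor R M N\<^esub> t
    = r \<oplus>\<^bsub>tensor R M N\<^esub> (s \<oplus>\<^bsub>tensor R M N\<^esub> t)"
    by (simp add: add_cl add.assoc)
qed

lemma rel_sum:
  assumes "\<And>i. i \<in> F \<Longrightarrow> f i \<doteq> h i"
  shows "(\<Sum>i\<in>F. f i) \<doteq> (\<Sum>i\<in>F. h i)"
  using assms
proof (induction F rule: infinite_finite_induct)
  case (insert i F)
  then show ?case by (simp add: tensor_rel.add)
qed (auto intro: tensor_rel.refl)

lemma tensor_map_cl:
  assumes "formal X"
    and "\<And>Y. X \<doteq> Y \<Longrightarrow> tensor_rel R' M' N' (image_mset (map_prod f g) X) (image_mset (map_prod f g) Y)"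
  shows "tensor_map R' M' N' f g (cl X) = tensor_class R' M' N' (image_mset (map_prod f g) X)"
  unfolding tensor_map_def
proof (rule cl_UN[OF assms(1)])
  fix Y assume "X \<doteq> Y"
  from assms(2)[OF this]
  show "tensor_class R' M' N' (image_mset (map_prod f g) Y)
    = tensor_class R' M' N' (image_mset (map_prod f g) X)"
    by (rule tensor_class_eqI[symmetric])
qed

end

section \<open>Differential operators and the powers of the diagonal ideal\<close>

text \<open>\<open>mult_map\<close> sums over the support of a multiset with multiplicities, whereas
  lifting along the tensor congruence produces sums over multisets.\<close>

lemma sum_mset_image_count:
  fixes f :: "'a \<Rightarrow> 'b::comm_semiring_1"
  shows "(\<Sum>u\<in>#X. f u) = (\<Sum>u\<in>set_mset X. of_nat (count X u) * f u)"
proof -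
  have "(\<Sum>u\<in>#X. f u) = (\<Sum>u\<in>S. of_nat (count X u) * f u)" if "finite S" "set_mset X \<subseteq> S" for S
    using that(2)
  proof (induction X)
    case (add v X)
    have "(\<Sum>u\<in>S. of_nat (count (add_mset v X) u) * f u)
        = (\<Sum>u\<in>S. of_nat (count X u) * f u + (if u = v then f u else 0))"
      by (rule sum.cong) (auto simp: algebra_simps)
    with add that(1) show ?case by (simp add: sum.distrib add.commute)
  qed simp
  then show ?thesis by simp
qed

section \<open>The ring A \<otimes> A for a subalgebra A of a field\<close>

locale subalgebra =
  fixes cst :: "'k::field \<Rightarrow> 'f::field" and A :: "'f set"
  assumes cst_0: "cst 0 = 0" and cst_1: "cst 1 = 1"
    and cst_add: "cst (c + d) = cst c + cst d" and cst_mult: "cst (c * d) = cst c * cst d"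
    and cst_in: "cst c \<in> A"
    and A_add: "a \<in> A \<Longrightarrow> b \<in> A \<Longrightarrow> a + b \<in> A"
    and A_mult: "a \<in> A \<Longrightarrow> b \<in> A \<Longrightarrow> a * b \<in> A"
begin

lemma A_0: "0 \<in> A" using cst_in[of 0] by (simp add: cst_0)

lemma A_1: "1 \<in> A" using cst_in[of 1] by (simp add: cst_1)

lemma cst_uminus: "cst (- c) = - cst c"
proof -
  have "cst (- c) + cst c = 0" using cst_add[of "- c" c] by (simp add: cst_0)
  then show ?thesis by (simp add: eq_neg_iff_add_eq_0)
qed

lemma cst_diff: "cst (c - d) = cst c - cst d"
  using cst_add[of c "- d"] by (simp add: cst_uminus)

lemma cst_eq_0_iff: "cst c = 0 \<longleftrightarrow> c = 0"
proof
  assume c: "cst c = 0"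
  show "c = 0"
  proof (rule ccontr)
    assume "c \<noteq> 0"
    then have "cst c * cst (inverse c) = 1" by (simp flip: cst_mult add: cst_1)
    with c show False by simp
  qed
qed (simp add: cst_0)

lemma cst_of_nat: "cst (of_nat n) = of_nat n"
  by (induction n) (simp_all add: cst_0 cst_1 cst_add)

lemma A_uminus: "a \<in> A \<Longrightarrow> - a \<in> A"
  using A_mult[OF cst_in[of "- 1"]] by (simp add: cst_uminus cst_1)

lemma A_diff: "a \<in> A \<Longrightarrow> b \<in> A \<Longrightarrow> a - b \<in> A"
  using A_add[OF _ A_uminus] by fastforce

lemma A_of_nat: "of_nat n \<in> A"
  using cst_in[of "of_nat n"] by (simp add: cst_of_nat)

lemma A_power: "a \<in> A \<Longrightarrow> a ^ n \<in> A"
  by (induction n) (auto simp: A_1 A_mult)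

lemma A_sum: "(\<And>i. i \<in> S \<Longrightarrow> f i \<in> A) \<Longrightarrow> sum f S \<in> A"
  by (induction S rule: infinite_finite_induct) (auto simp: A_0 A_add)

lemma A_prod: "(\<And>i. i \<in> S \<Longrightarrow> f i \<in> A) \<Longrightarrow> prod f S \<in> A"
  by (induction S rule: infinite_finite_induct) (auto simp: A_1 A_mult)

lemma A_sum_mset: "(\<And>u. u \<in># X \<Longrightarrow> f u \<in> A) \<Longrightarrow> (\<Sum>u\<in>#X. f u) \<in> A"
  by (induction X) (auto simp: A_0 A_add)

abbreviation kk :: "'k ring" where "kk \<equiv> ring_on UNIV"

definition alg :: "('k, 'f) module"
  where "alg = \<lparr>carrier = A, mult = (*), one = 1, zero = 0, add = (+), smult = (\<lambda>c f. cst c * f)\<rparr>"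

lemma alg_simps [simp]:
  "carrier alg = A" "a \<otimes>\<^bsub>alg\<^esub> b = a * b" "\<one>\<^bsub>alg\<^esub> = 1" "\<zero>\<^bsub>alg\<^esub> = 0"
  "a \<oplus>\<^bsub>alg\<^esub> b = a + b" "c \<odot>\<^bsub>alg\<^esub> a = cst c * a"
  by (simp_all add: alg_def)

lemma kk_carrier [simp]: "carrier kk = UNIV"
  by (simp add: ring_on_def)

lemma alg_cring: "cring alg"
proof (rule cringI)
  show "abelian_group alg"
  proof (rule abelian_groupI)
    fix x assume "x \<in> carrier alg"
    then show "\<exists>y\<in>carrier alg. y \<oplus>\<^bsub>alg\<^esub> x = \<zero>\<^bsub>alg\<^esub>"
      by (intro bexI[of _ "- x"]) (auto simp: A_uminus)
  qed (auto simp: A_0 A_add)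
  show "comm_monoid alg" by (rule comm_monoidI) (auto simp: A_1 A_mult)
qed (auto simp: algebra_simps)

sublocale alg: cring alg by (rule alg_cring)

lemma alg_finsum: "finite S \<Longrightarrow> (\<And>i. i \<in> S \<Longrightarrow> f i \<in> A) \<Longrightarrow> finsum alg f S = sum f S"
  by (induction S rule: finite_induct) (auto simp: alg.finsum_insert)

lemma alg_add_pow: "a \<in> A \<Longrightarrow> add_pow alg n a = of_nat n * a" for n :: nat
  by (induction n) (auto simp: algebra_simps)

sublocale T: tensor_product kk alg alg
  by standard (auto simp: A_0 A_add A_mult cst_in)

abbreviation TT :: "('k, ('f \<times> 'f) multiset set) module" where "TT \<equiv> tensor kk alg alg"

abbreviation pt :: "'f \<Rightarrow> 'f \<Rightarrow> ('f \<times> 'f) multiset set" where "pt a b \<equiv> T.cl {#(a, b)#}"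

definition mulm :: "('f \<times> 'f) multiset \<Rightarrow> ('f \<times> 'f) multiset \<Rightarrow> ('f \<times> 'f) multiset"
  where "mulm X Y = (\<Sum>u\<in>#X. image_mset (\<lambda>v. (fst u * fst v, snd u * snd v)) Y)"

lemma mulm_empty [simp]: "mulm {#} Y = {#}" "mulm X {#} = {#}"
  by (simp_all add: mulm_def)

lemma mulm_add: "mulm (X + X') Y = mulm X Y + mulm X' Y" "mulm X (Y + Y') = mulm X Y + mulm X Y'"
  by (simp_all add: mulm_def sum_mset.distrib)

abbreviation pmul :: "'f \<times> 'f \<Rightarrow> 'f \<times> 'f \<Rightarrow> 'f \<times> 'f"
  where "pmul u v \<equiv> (fst u * fst v, snd u * snd v)"

lemma mulm_add_mset [simp]:
  "mulm (add_mset u X) Y = image_mset (pmul u) Y + mulm X Y"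
  "mulm X (add_mset v Y) = image_mset (\<lambda>u. pmul u v) X + mulm X Y"
  using mulm_add(2)[of X "{#v#}" Y] by (simp_all add: mulm_def)

lemma mulm_comm: "mulm X Y = mulm Y X"
  by (induction X) (simp_all add: mult.commute)

lemma mulm_assoc: "mulm (mulm X Y) Z = mulm X (mulm Y Z)"
proof (induction X)
  case (add u X)
  have "mulm (image_mset (pmul u) Y) Z = image_mset (pmul u) (mulm Y Z)"
    by (induction Y) (simp_all add: multiset.map_comp o_def mult.assoc)
  with add show ?case by (simp add: mulm_add)
qed simp

lemma mulm_one: "mulm {#(1, 1)#} X = X"
  by (simp add: mulm_def)

lemma mulm_formal: "set_mset X \<subseteq> A \<times> A \<Longrightarrow> set_mset Y \<subseteq> A \<times> A \<Longrightarrow> set_mset (mulm X Y) \<subseteq> A \<times> A"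
  by (fastforce simp: mulm_def A_mult)

text \<open>Multiplication by one pure tensor is bilinear in the other factor, and a general
  representative is a sum of such terms. The second argument follows by commutativity.\<close>

lemma mulm_rel_left:
  assumes "T.rel X X'" "T.formal Y"
  shows "T.rel (mulm X Y) (mulm X' Y)"
  using assms(2)
proof (induction Y)
  case empty
  then show ?case by (auto intro: tensor_rel.refl)
next
  case (add v Y)
  obtain a b where v: "v = (a, b)" by force
  have ab: "a \<in> A" "b \<in> A" using add.prems v by auto
  have *: "mulm X {#v#} = (\<Sum>u\<in>#X. {#(fst u * a, snd u * b)#})" for X
    by (simp add: mulm_def v)
  have "T.rel (mulm X {#v#}) (mulm X' {#v#})"
    unfolding *
  proof (rule tensor_rel_lift[OF assms(1), where E = T.rel], goal_cases)
    case (1 x y) then show ?case using ab by (intro tensor_rel.refl) (auto simp: A_mult)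
  next
    case 2 then show ?case by (intro tensor_rel.refl) auto
  next
    case (3 p q) then show ?case by (rule tensor_rel.sym)
  next
    case (4 p q r) then show ?case by (rule tensor_rel.trans)
  next
    case (5 p q p' q') then show ?case by (rule tensor_rel.add)
  next
    case (6 y) then show ?case using tensor_rel.zero[of "y * b" alg kk alg] ab by (simp add: A_mult)
  next
    case (7 x x' y)
    then show ?case using tensor_rel.distr_left[of "x * a" alg "x' * a" "y * b" alg kk] ab
      by (simp add: A_mult algebra_simps)
  next
    case (8 x y y')
    then show ?case using tensor_rel.distr_right[of "x * a" alg "y * b" alg "y' * b" kk] ab
      by (simp add: A_mult algebra_simps)
  next
    case (9 r x y)
    then show ?case using tensor_rel.balanced[of r kk "x * a" alg "y * b" alg] ab
      by (simp add: A_mult algebra_simps)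
  qed
  moreover have "T.rel (mulm X Y) (mulm X' Y)" using add by simp
  ultimately show ?case using mulm_add(2)[of _ "{#v#}" Y] tensor_rel.add by (metis add_mset_add_single add.commute)
qed

lemma mulm_rel:
  assumes "T.rel X X'" "T.rel Y Y'"
  shows "T.rel (mulm X Y) (mulm X' Y')"
proof (rule tensor_rel.trans)
  show "T.rel (mulm X Y) (mulm X' Y)" using assms T.rel_formal by (intro mulm_rel_left) auto
  show "T.rel (mulm X' Y) (mulm X' Y')"
    unfolding mulm_comm[of X'] using assms T.rel_formal by (intro mulm_rel_left) auto
qed

lemma mult_cl:
  assumes "T.formal X" "T.formal Y"
  shows "T.cl X \<otimes>\<^bsub>TT\<^esub> T.cl Y = T.cl (mulm X Y)"
proof -
  have "(\<Union>Y'\<in>T.cl Y. T.cl (mulm X' Y')) = T.cl (mulm X' Y)" if "T.formal X'" for X'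
    by (rule T.cl_UN[OF assms(2)], rule T.cl_eqI, rule mulm_rel[OF tensor_rel.refl[OF that]],
      erule tensor_rel.sym)
  moreover have "(\<Union>X'\<in>T.cl X. T.cl (mulm X' Y)) = T.cl (mulm X Y)"
    by (rule T.cl_UN[OF assms(1)], rule T.cl_eqI, rule mulm_rel[OF _ tensor_rel.refl[OF assms(2)]],
      erule tensor_rel.sym)
  moreover have "T.formal X'" if "X' \<in> T.cl X" for X' using that T.rel_formal by (auto simp: T.in_cl_iff)
  ultimately show ?thesis by (simp add: tensor_def mulm_def)
qed

lemma one_cl: "\<one>\<^bsub>TT\<^esub> = pt 1 1"
  by (simp add: tensor_def pure_tensor_def)

lemma TT_cring: "cring TT"
proof (rule cringI)
  show "abelian_group TT"
    by (rule T.tensor_abelian_group[of uminus]) (auto simp: A_uminus)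
  show "comm_monoid TT"
  proof (rule comm_monoidI)
    show "\<one>\<^bsub>TT\<^esub> \<in> carrier TT" unfolding one_cl by (intro T.cl_in_carrier) (auto simp: A_1)
  next
    fix s t assume "s \<in> carrier TT" "t \<in> carrier TT"
    then obtain X Y where "T.formal X" "T.formal Y" "s = T.cl X" "t = T.cl Y" by (metis T.tensor_cases)
    then show "s \<otimes>\<^bsub>TT\<^esub> t \<in> carrier TT" and "s \<otimes>\<^bsub>TT\<^esub> t = t \<otimes>\<^bsub>TT\<^esub> s"
      by (simp_all add: mult_cl T.cl_in_carrier mulm_formal mulm_comm)
  next
    fix s assume "s \<in> carrier TT"
    then obtain X where "T.formal X" "s = T.cl X" by (metis T.tensor_cases)
    then show "\<one>\<^bsub>TT\<^esub> \<otimes>\<^bsub>TT\<^esub> s = s" by (simp add: one_cl mult_cl A_1 mulm_one)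
  next
    fix r s t assume "r \<in> carrier TT" "s \<in> carrier TT" "t \<in> carrier TT"
    then obtain X Y Z where "T.formal X" "T.formal Y" "T.formal Z" "r = T.cl X" "s = T.cl Y" "t = T.cl Z"
      by (metis T.tensor_cases)
    then show "r \<otimes>\<^bsub>TT\<^esub> s \<otimes>\<^bsub>TT\<^esub> t = r \<otimes>\<^bsub>TT\<^esub> (s \<otimes>\<^bsub>TT\<^esub> t)"
      by (simp add: mult_cl mulm_formal mulm_assoc)
  qed
  fix r s t assume "r \<in> carrier TT" "s \<in> carrier TT" "t \<in> carrier TT"
  then obtain X Y Z where "T.formal X" "T.formal Y" "T.formal Z" "r = T.cl X" "s = T.cl Y" "t = T.cl Z"
    by (metis T.tensor_cases)
  then show "(r \<oplus>\<^bsub>TT\<^esub> s) \<otimes>\<^bsub>TT\<^esub> t = r \<otimes>\<^bsub>TT\<^esub> t \<oplus>\<^bsub>TT\<^esub> s \<otimes>\<^bsub>TT\<^esub> t"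
    by (simp add: mult_cl T.add_cl mulm_formal mulm_add)
qed

sublocale TT: cring TT by (rule TT_cring)

lemma pt_carrier: "a \<in> A \<Longrightarrow> b \<in> A \<Longrightarrow> pt a b \<in> carrier TT"
  by (intro T.cl_in_carrier) auto

lemma pt_mult: "a \<in> A \<Longrightarrow> b \<in> A \<Longrightarrow> c \<in> A \<Longrightarrow> d \<in> A \<Longrightarrow> pt a b \<otimes>\<^bsub>TT\<^esub> pt c d = pt (a * c) (b * d)"
  by (simp add: mult_cl)

lemma pt_add_left: "a \<in> A \<Longrightarrow> a' \<in> A \<Longrightarrow> b \<in> A \<Longrightarrow> pt (a + a') b = pt a b \<oplus>\<^bsub>TT\<^esub> pt a' b"
  using T.cl_eqI[OF tensor_rel.distr_left[of a alg a' b alg kk]] by (simp add: T.add_cl add_mset_commute)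

lemma pt_balanced: "a \<in> A \<Longrightarrow> b \<in> A \<Longrightarrow> pt (cst c * a) b = pt a (cst c * b)"
  using T.cl_eqI[OF tensor_rel.balanced[of c kk a alg b alg]] by simp

lemma pt_zero: "b \<in> A \<Longrightarrow> pt 0 b = \<zero>\<^bsub>TT\<^esub>"
  using T.cl_eqI[OF tensor_rel.zero[of b alg kk alg]] by (simp add: T.zero_cl)

abbreviation mu :: "('f \<times> 'f) multiset set \<Rightarrow> 'f" where "mu \<equiv> mult_map alg"

lemma mu_cl:
  assumes "T.formal X"
  shows "mu (T.cl X) = (\<Sum>u\<in>#X. fst u * snd u)"
proof -
  let ?F = "\<lambda>Y. finsum alg (\<lambda>u. add_pow alg (count Y u) (fst u \<otimes>\<^bsub>alg\<^esub> snd u)) (set_mset Y)"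
  have F: "?F Y = (\<Sum>u\<in>#X. fst u * snd u)" if XY: "T.rel X Y" for Y
  proof -
    have "T.formal Y" using T.rel_formal[OF XY] by blast
    then have "fst u * snd u \<in> A" if "u \<in># Y" for u
      using that by (auto dest!: subsetD simp: mem_Times_iff intro!: A_mult)
    then have "?F Y = (\<Sum>u\<in>set_mset Y. of_nat (count Y u) * (fst u * snd u))"
      by (subst alg_finsum) (auto simp: alg_add_pow A_of_nat A_mult intro!: sum.cong)
    also have "\<dots> = (\<Sum>u\<in>#Y. fst u * snd u)" by (simp add: sum_mset_image_count)
    also have "\<dots> = (\<Sum>u\<in>#X. fst u * snd u)"
      using tensor_rel_lift_mod[OF XY, of "{0}" "\<lambda>u. fst u * snd u"] by (simp add: algebra_simps)
    finally show ?thesis .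
  qed
  then have "?F ` T.cl X = (\<lambda>_. \<Sum>u\<in>#X. fst u * snd u) ` T.cl X"
    by (intro image_cong) (simp_all only: T.in_cl_iff)
  also have "\<dots> = {\<Sum>u\<in>#X. fst u * snd u}" using T.in_cl[OF assms] by blast
  finally show ?thesis unfolding mult_map_def by simp
qed

abbreviation I :: "('f \<times> 'f) multiset set set" where "I \<equiv> diagonal_ideal kk alg"

lemma I_iff: "t \<in> I \<longleftrightarrow> t \<in> carrier TT \<and> mu t = 0"
  by (simp add: diagonal_ideal_def a_kernel_def')

lemma I_ideal: "ideal I TT"
proof -
  have mul: "(\<Sum>u\<in>#mulm X Y. fst u * snd u) = (\<Sum>u\<in>#X. fst u * snd u) * (\<Sum>u\<in>#Y. fst u * snd u)" for X Y
  proof (induction X)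
    case (add u X)
    have "(\<Sum>u\<in>#image_mset (pmul u) Y. fst u * snd u) = (fst u * snd u) * (\<Sum>u\<in>#Y. fst u * snd u)"
      by (induction Y) (auto simp: algebra_simps)
    with add show ?case by (simp add: algebra_simps)
  qed simp
  have "mu \<in> ring_hom TT alg"
  proof (rule ring_hom_memI)
    fix s assume "s \<in> carrier TT"
    then obtain X where X: "T.formal X" "s = T.cl X" by (metis T.tensor_cases)
    then show "mu s \<in> carrier alg" by (auto simp: mu_cl intro!: A_sum_mset A_mult)
  next
    fix s t assume "s \<in> carrier TT" "t \<in> carrier TT"
    then obtain X Y where "T.formal X" "T.formal Y" "s = T.cl X" "t = T.cl Y" by (metis T.tensor_cases)
    then show "mu (s \<otimes>\<^bsub>TT\<^esub> t) = mu s \<otimes>\<^bsub>alg\<^esub> mu t" "mu (s \<oplus>\<^bsub>TT\<^esub> t) = mu s \<oplus>\<^bsub>alg\<^esub> mu t"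
      by (simp_all add: mult_cl T.add_cl mu_cl mulm_formal mul)
  qed (simp add: one_cl mu_cl A_1)
  then show ?thesis unfolding diagonal_ideal_def
    by (intro ring_hom_ring.kernel_is_ideal ring_hom_ringI2 TT.ring_axioms alg.ring_axioms)
qed

abbreviation J :: "nat \<Rightarrow> ('f \<times> 'f) multiset set set" where "J \<equiv> ideal_power TT I"

lemma J_ideal: "ideal (J l) TT"
  by (induction l) (auto intro: TT.oneideal TT.ideal_prod_is_ideal I_ideal)

lemma J_antimono: "l \<le> l' \<Longrightarrow> J l' \<subseteq> J l"
proof (induction rule: dec_induct)
  case (step l')
  then show ?case using TT.ideal_prod_inter[OF J_ideal I_ideal, of l'] by auto
qed simp

section \<open>Differential operators and their pairing with A \<otimes> A\<close>

definition lin :: "('f \<Rightarrow> 'f) \<Rightarrow> bool"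
  where "lin D \<longleftrightarrow> (\<forall>a\<in>A. \<forall>b\<in>A. D (a + b) = D a + D b) \<and> (\<forall>c. \<forall>a\<in>A. D (cst c * a) = cst c * D a)
    \<and> (\<forall>a\<in>A. D a \<in> A)"

text \<open>
  \<open>diff_op l\<close> consists of Grothendieck's differential operators of order less than \<open>l\<close> on \<open>A\<close>.
\<close>

primrec diff_op :: "nat \<Rightarrow> ('f \<Rightarrow> 'f) \<Rightarrow> bool"
  where
    "diff_op 0 D \<longleftrightarrow> (\<forall>a\<in>A. D a = 0)"
  | "diff_op (Suc l) D \<longleftrightarrow> lin D \<and> (\<forall>b\<in>A. diff_op l (\<lambda>a. D (b * a) - b * D a))"

lemma diff_op_lin: "diff_op l D \<Longrightarrow> lin D"
  by (cases l) (auto simp: lin_def A_0 A_add A_mult cst_in)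

lemma lin_add: "lin D \<Longrightarrow> lin E \<Longrightarrow> lin (\<lambda>a. D a + E a)"
  by (auto simp: lin_def A_add algebra_simps)

lemma lin_comp: "lin D \<Longrightarrow> lin E \<Longrightarrow> lin (\<lambda>a. D (E a))"
  by (auto simp: lin_def)

lemma lin_mult: "w \<in> A \<Longrightarrow> lin (\<lambda>a. w * a)"
  by (auto simp: lin_def A_mult algebra_simps)

text \<open>Operators are functions on the whole field, but only their values on \<open>A\<close>
  carry meaning.\<close>

lemma diff_op_cong: "(\<And>a. a \<in> A \<Longrightarrow> D a = E a) \<Longrightarrow> diff_op l D \<Longrightarrow> diff_op l E"
proof (induction l arbitrary: D E)
  case (Suc l)
  have "lin E" using Suc.prems by (auto simp: lin_def A_add A_mult cst_in)
  moreover have "diff_op l (\<lambda>a. E (b * a) - b * E a)" if "b \<in> A" for b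
    by (rule Suc.IH[of "\<lambda>a. D (b * a) - b * D a"]) (use that Suc.prems in \<open>auto simp: A_mult\<close>)
  ultimately show ?case by simp
qed simp

lemma diff_op_add: "diff_op l D \<Longrightarrow> diff_op l E \<Longrightarrow> diff_op l (\<lambda>a. D a + E a)"
proof (induction l arbitrary: D E)
  case (Suc l)
  have "diff_op l (\<lambda>a. D (b * a) + E (b * a) - b * (D a + E a))" if "b \<in> A" for b
    using Suc.IH[of "\<lambda>a. D (b * a) - b * D a" "\<lambda>a. E (b * a) - b * E a"] Suc.prems that
    by (simp add: distrib_left add_diff_add)
  with Suc.prems show ?case by (simp add: lin_add)
qed simp

lemma diff_op_mult: "diff_op l D \<Longrightarrow> w \<in> A \<Longrightarrow> diff_op l (\<lambda>a. D (w * a))"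
proof (induction l arbitrary: D)
  case (Suc l)
  have "diff_op l (\<lambda>a. D (w * (b * a)) - b * D (w * a))" if "b \<in> A" for b
    using Suc.IH[of "\<lambda>a. D (b * a) - b * D a"] Suc.prems that
    by (simp add: mult.left_commute)
  with Suc.prems lin_comp[OF _ lin_mult] show ?case by simp
qed (simp add: A_mult)

lemma diff_op_id: "diff_op (Suc 0) (\<lambda>a. a)"
  by (auto simp: lin_def)

text \<open>\<open>[D \<circ> \<delta>, b] = D \<circ> \<delta> b + [D, b] \<circ> \<delta>\<close>\<close>

lemma diff_op_derivation:
  assumes der: "lin \<delta>" "\<And>a b. a \<in> A \<Longrightarrow> b \<in> A \<Longrightarrow> \<delta> (a * b) = a * \<delta> b + \<delta> a * b"
  shows "diff_op l D \<Longrightarrow> diff_op (Suc l) (\<lambda>a. D (\<delta> a))"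
proof (induction l arbitrary: D)
  case 0
  have der_in: "\<delta> a \<in> A" if "a \<in> A" for a using that der(1) by (simp add: lin_def)
  have "lin (\<lambda>a. D (\<delta> a))" using der(1) diff_op_lin[OF 0] by (rule lin_comp[rotated])
  with 0 show ?case by (simp add: A_mult der_in)
next
  case (Suc l)
  have der_in: "\<delta> a \<in> A" if "a \<in> A" for a using that der(1) by (simp add: lin_def)
  have "diff_op (Suc l) (\<lambda>a. D (\<delta> (b * a)) - b * D (\<delta> a))" if b: "b \<in> A" for b
  proof (rule diff_op_cong)
    show "diff_op (Suc l) (\<lambda>a. D (\<delta> b * a) + (D (b * \<delta> a) - b * D (\<delta> a)))"
    proof (rule diff_op_add)
      show "diff_op (Suc l) (\<lambda>a. D (\<delta> b * a))" using Suc.prems der_in[OF b] by (rule diff_op_mult)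
      show "diff_op (Suc l) (\<lambda>a. D (b * \<delta> a) - b * D (\<delta> a))"
        using Suc.IH[of "\<lambda>a. D (b * a) - b * D a"] Suc.prems b by simp
    qed
    fix a assume "a \<in> A"
    then have "D (\<delta> (b * a)) = D (b * \<delta> a) + D (\<delta> b * a)"
      using diff_op_lin[OF Suc.prems] der(2)[OF b] der_in b by (simp add: lin_def A_mult)
    then show "D (\<delta> b * a) + (D (b * \<delta> a) - b * D (\<delta> a)) = D (\<delta> (b * a)) - b * D (\<delta> a)" by simp
  qed
  moreover have "lin (\<lambda>a. D (\<delta> a))" using der(1) diff_op_lin[OF Suc.prems] by (rule lin_comp[rotated])
  ultimately show ?case by simp
qed

declare diff_op.simps [simp del]

text \<open>The left A-linear extension of \<open>D\<close> to A \<otimes> A, on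
  representatives.\<close>

definition phi :: "('f \<Rightarrow> 'f) \<Rightarrow> ('f \<times> 'f) multiset \<Rightarrow> 'f"
  where "phi D X = (\<Sum>u\<in>#X. fst u * D (snd u))"

lemma phi_simps [simp]: "phi D {#} = 0" "phi D (X + Y) = phi D X + phi D Y"
  "phi D (add_mset u X) = fst u * D (snd u) + phi D X"
  by (simp_all add: phi_def)

lemma phi_rel:
  assumes "lin D" "T.rel X Y"
  shows "phi D X = phi D Y"
  using tensor_rel_lift_mod[OF assms(2), of "{0}" "\<lambda>u. fst u * D (snd u)"] assms(1)
  by (simp add: algebra_simps lin_def phi_def)

lemma phi_in: "lin D \<Longrightarrow> T.formal X \<Longrightarrow> phi D X \<in> A"
  unfolding phi_def by (rule A_sum_mset) (auto simp: lin_def intro!: A_mult)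

lemma phi_mulm_single: "phi D (mulm X {#(a, b)#}) = a * phi (\<lambda>z. D (b * z)) X"
  by (induction X) (auto simp: algebra_simps)

lemma phi_cong: "T.formal X \<Longrightarrow> (\<And>a. a \<in> A \<Longrightarrow> D a = E a) \<Longrightarrow> phi D X = phi E X"
  by (induction X) auto

lemma phi_op_add: "phi (\<lambda>a. D a + E a) X = phi D X + phi E X"
  by (induction X) (auto simp: algebra_simps)

lemma phi_op_mult: "phi (\<lambda>a. b * D a) X = b * phi D X"
  by (induction X) (auto simp: algebra_simps)

text \<open>Induction on the order: all commutators of \<open>D\<close> with multiplications have
  smaller order and already kill the smaller power of the diagonal ideal, so on that power
  \<open>phi D\<close> is linear for the right structure as well. A further factor from
  \<open>I\<close> then acts through its image under multiplication, which is 0.\<close>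

lemma phi_ideal_power: "diff_op l D \<Longrightarrow> T.formal X \<Longrightarrow> T.cl X \<in> J l \<Longrightarrow> phi D X = 0"
proof (induction l arbitrary: D X)
  case 0
  then show ?case using phi_cong[of X D "\<lambda>_. 0"] by (simp add: phi_def diff_op.simps)
next
  case (Suc l)
  have "phi D X = 0" if "t \<in> ideal_prod TT (J l) I" "T.formal X" "t = T.cl X" for t X
    using that
  proof (induction arbitrary: X rule: ideal_prod.induct)
    case (prod i j)
    have "i \<in> carrier TT" "j \<in> carrier TT"
      using prod ideal.Icarr[OF J_ideal] ideal.Icarr[OF I_ideal] by blast+
    then obtain Y Z where Y: "T.formal Y" "i = T.cl Y" and Z: "T.formal Z" "j = T.cl Z"
      by (metis T.tensor_cases)
    \<comment> \<open>The difference of the two sides is the commutator of \<open>D\<close> and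
      \<open>b\<close> evaluated on \<open>Y\<close>, and this vanishes by the outer
      induction.\<close>
    have "phi (\<lambda>z. D (b * z)) Y = b * phi D Y" if b: "b \<in> A" for b
    proof -
      have "phi (\<lambda>z. D (b * z) - b * D z) Y = 0"
        using Suc.prems(1) b prod(1) Y by (intro Suc.IH) (auto simp: diff_op.simps)
      moreover have "phi (\<lambda>z. D (b * z)) Y = phi (\<lambda>z. (D (b * z) - b * D z) + b * D z) Y" by simp
      ultimately show ?thesis unfolding phi_op_add phi_op_mult by simp
    qed
    note phi_Y = this
    \<comment> \<open>With right multiplications pulled out of \<open>D\<close>, a term a \<otimes>
      b of \<open>Z\<close> multiplies the value by a b; in total this is the image of
      \<open>Z\<close> under the multiplication map.\<close>
    from Z(1) have "phi D (mulm Y Z) = (\<Sum>u\<in>#Z. fst u * snd u) * phi D Y"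
    proof (induction Z)
      case (add u Z)
      obtain a b where u: "u = (a, b)" by force
      have "phi D (mulm Y (add_mset u Z)) = phi D (mulm Y {#(a, b)#}) + phi D (mulm Y Z)" by (simp add: u)
      then have "phi D (mulm Y (add_mset u Z)) = a * (b * phi D Y) + phi D (mulm Y Z)"
        using add.prems by (simp only: phi_mulm_single) (simp add: u phi_Y)
      with add u show ?case by (simp add: algebra_simps)
    qed simp
    also have "\<dots> = 0" using prod(2) Z by (simp add: I_iff mu_cl)
    finally have "phi D (mulm Y Z) = 0" .
    moreover have "T.rel X (mulm Y Z)"
      using prod Y Z T.cl_eq_iff[of X "mulm Y Z"] by (simp add: mult_cl)
    ultimately show ?case using phi_rel[OF diff_op_lin[OF Suc.prems(1)]] by metis
  next
    case (sum s t)
    have "s \<in> carrier TT" "t \<in> carrier TT"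
      using sum ideal.Icarr[OF TT.ideal_prod_is_ideal[OF J_ideal I_ideal]] by blast+
    then obtain Y Z where Y: "T.formal Y" "s = T.cl Y" and Z: "T.formal Z" "t = T.cl Z"
      by (metis T.tensor_cases)
    have "T.rel X (Y + Z)" using sum Y Z T.cl_eq_iff[of X "Y + Z"] by (simp add: T.add_cl)
    then have "phi D X = phi D (Y + Z)" by (rule phi_rel[OF diff_op_lin[OF Suc.prems(1)]])
    with sum Y Z show ?case by simp
  qed
  with Suc.prems show ?case by simp
qed

end

section \<open>Taylor maps on fibres\<close>

declare ideal_power.simps [simp del]

lemma (in subalgebra) Units_alg: "a \<in> Units alg \<longleftrightarrow> a \<in> A \<and> a \<noteq> 0 \<and> inverse a \<in> A"
proof
  assume "a \<in> Units alg"
  then obtain b where b: "a \<in> A" "b \<in> A" "a * b = 1" by (auto simp: Units_def)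
  then have "a \<noteq> 0" "inverse a = b" by (auto simp: inverse_unique)
  with b show "a \<in> A \<and> a \<noteq> 0 \<and> inverse a \<in> A" by simp
next
  assume "a \<in> A \<and> a \<noteq> 0 \<and> inverse a \<in> A"
  then show "a \<in> Units alg" by (auto simp: Units_def intro!: bexI[of _ "inverse a"])
qed

section \<open>Local subalgebras and their residue fields\<close>

locale local_subalgebra = subalgebra cst A
  for cst :: "'k::field \<Rightarrow> 'f::field" and A +
  assumes nonunit_add: "a \<in> max_ideal alg \<Longrightarrow> b \<in> max_ideal alg \<Longrightarrow> a + b \<in> max_ideal alg"
begin

definition mm :: "'f set" where "mm = max_ideal alg"

lemma mm_iff: "a \<in> mm \<longleftrightarrow> a \<in> A \<and> (a = 0 \<or> inverse a \<notin> A)"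
  by (auto simp: mm_def Units_alg)

lemma mm_A: "a \<in> mm \<Longrightarrow> a \<in> A" by (simp add: mm_iff)

lemma mm_0: "0 \<in> mm" by (simp add: mm_iff A_0)

lemma mm_mult:
  assumes r: "r \<in> A" and a: "a \<in> mm"
  shows "r * a \<in> mm"
proof (rule ccontr)
  assume "r * a \<notin> mm"
  with r a have *: "r \<noteq> 0" "a \<noteq> 0" "inverse (r * a) \<in> A" by (auto simp: mm_iff A_mult)
  then have "inverse a = r * inverse (r * a)" by (simp add: field_simps)
  with * r a show False by (simp add: mm_iff A_mult del: inverse_mult_distrib)
qed

lemma mm_mult_right: "r \<in> A \<Longrightarrow> a \<in> mm \<Longrightarrow> a * r \<in> mm"
  using mm_mult[of r a] by (simp add: mult.commute)

lemma mm_uminus: "a \<in> mm \<Longrightarrow> - a \<in> mm"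
  using mm_mult[of "- 1" a] A_uminus[OF A_1] by simp

lemma mm_add: "a \<in> mm \<Longrightarrow> b \<in> mm \<Longrightarrow> a + b \<in> mm"
  unfolding mm_def by (rule nonunit_add)

lemma mm_diff: "a \<in> mm \<Longrightarrow> b \<in> mm \<Longrightarrow> a - b \<in> mm"
  using mm_add[OF _ mm_uminus[of b]] by simp

lemma mm_sum: "(\<And>i. i \<in> S \<Longrightarrow> f i \<in> mm) \<Longrightarrow> sum f S \<in> mm"
  by (induction S rule: infinite_finite_induct) (simp_all add: mm_0 mm_add)

lemma mm_ideal: "ideal mm alg"
proof (rule idealI)
  have "mm \<subseteq> carrier alg" using mm_A by auto
  then show "subgroup mm (add_monoid alg)"
  proof (rule alg.add.subgroupI)
    fix a assume a: "a \<in> mm"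
    then have "\<ominus>\<^bsub>alg\<^esub> a = - a" using mm_A by (intro alg.minus_equality) (auto simp: A_uminus)
    then show "\<ominus>\<^bsub>alg\<^esub> a \<in> mm" using mm_uminus[OF a] by simp
  qed (use mm_0 mm_add in auto)
qed (simp_all add: mm_mult mm_mult_right alg.ring_axioms)

abbreviation KK :: "'f set ring" where "KK \<equiv> alg Quot mm"

abbreviation res :: "'f \<Rightarrow> 'f set" where "res a \<equiv> mm +>\<^bsub>alg\<^esub> a"

sublocale KK: cring KK by (rule ideal.quotient_is_cring[OF mm_ideal alg_cring])

lemma res_hom:
  "a \<in> A \<Longrightarrow> b \<in> A \<Longrightarrow> res a \<otimes>\<^bsub>KK\<^esub> res b = res (a * b)"
  "a \<in> A \<Longrightarrow> b \<in> A \<Longrightarrow> res a \<oplus>\<^bsub>KK\<^esub> res b = res (a + b)"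
  "a \<in> A \<Longrightarrow> res a \<in> carrier KK" "\<one>\<^bsub>KK\<^esub> = res 1"
  using ring_hom_mult[OF ideal.rcos_ring_hom[OF mm_ideal], of a b]
    ring_hom_add[OF ideal.rcos_ring_hom[OF mm_ideal], of a b]
    ring_hom_closed[OF ideal.rcos_ring_hom[OF mm_ideal], of a]
    ring_hom_one[OF ideal.rcos_ring_hom[OF mm_ideal]]
  by simp_all

lemma in_res_iff: "b \<in> res a \<longleftrightarrow> b - a \<in> mm"
proof -
  have "b \<in> res a \<longleftrightarrow> (\<exists>h\<in>mm. b = h + a)" by (auto simp: a_r_coset_def')
  also have "\<dots> \<longleftrightarrow> b - a \<in> mm" by (metis add_diff_cancel diff_add_cancel)
  finally show ?thesis .
qed

lemma res_eqI: "a \<in> A \<Longrightarrow> b \<in> A \<Longrightarrow> a - b \<in> mm \<Longrightarrow> res a = res b"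
proof -
  have sub: "res a \<subseteq> res b" if "a - b \<in> mm" for a b
  proof
    fix x assume "x \<in> res a"
    then have "x - a \<in> mm" by (simp only: in_res_iff)
    from mm_add[OF this that] show "x \<in> res b" by (simp only: in_res_iff) simp
  qed
  assume "a - b \<in> mm"
  with sub[of a b] sub[of b a] mm_uminus[of "a - b"] show ?thesis
    by (simp only: minus_diff_eq) blast
qed

lemma res_zero: "a \<in> mm \<Longrightarrow> res a = \<zero>\<^bsub>KK\<^esub>"
  using abelian_subgroup.a_rcos_const[OF abelian_subgroupI3[OF ideal.axioms(1)[OF mm_ideal] alg.is_abelian_group], of a]
  by (simp add: FactRing_def)

lemma KK_cases:
  assumes "c \<in> carrier KK"
  obtains a where "a \<in> A" "c = res a"
  using assms by (auto simp: FactRing_def A_RCOSETS_def')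

text \<open>An arbitrary choice in the residue class. It respects sums and products only modulo
  \<open>mm\<close>, so functionals on fibres built from it take values modulo
  \<open>mm\<close>.\<close>

definition rep :: "'f set \<Rightarrow> 'f" where "rep c = (SOME a. a \<in> c)"

lemma rep_res: "rep (res a) - a \<in> mm"
proof -
  have "a \<in> res a" using in_res_iff[of a a] mm_0 by simp
  then have "rep (res a) \<in> res a" unfolding rep_def by (rule someI)
  then show ?thesis by (simp only: in_res_iff)
qed

abbreviation kap :: "('f, 'f set) module" where "kap \<equiv> residue_field alg"

lemma kap_simps:
  "carrier kap = carrier KK" "c \<oplus>\<^bsub>kap\<^esub> d = c \<oplus>\<^bsub>KK\<^esub> d" "\<zero>\<^bsub>kap\<^esub> = \<zero>\<^bsub>KK\<^esub>"
  "r \<odot>\<^bsub>kap\<^esub> c = res r \<otimes>\<^bsub>KK\<^esub> c"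
  by (simp_all add: residue_field_def restrict_scalars_def regular_module_def mm_def)

end

section \<open>Principal parts of a free module \<open>A * g\<close> of rank one inside the
  field\<close>

locale taylor_map = local_subalgebra cst A
  for cst :: "'k::field \<Rightarrow> 'f::field" and A +
  fixes g :: 'f and l :: nat
  assumes g0: "g \<noteq> 0"
begin

abbreviation L :: "'f set" where "L \<equiv> (\<lambda>f. f * g) ` A"

abbreviation Lm :: "('f, 'f) module" where "Lm \<equiv> regular_module (ring_on L)"

lemma Lm_simps [simp]: "carrier Lm = L" "v \<oplus>\<^bsub>Lm\<^esub> w = v + w" "\<zero>\<^bsub>Lm\<^esub> = 0" "r \<odot>\<^bsub>Lm\<^esub> v = r * v"
  by (simp_all add: regular_module_def ring_on_def)

lemma L_iff: "v \<in> L \<longleftrightarrow> v / g \<in> A"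
  using g0 by (force simp: image_iff field_simps)

lemma L_add: "v \<in> L \<Longrightarrow> w \<in> L \<Longrightarrow> v + w \<in> L"
  by (simp only: L_iff) (simp add: add_divide_distrib A_add)

lemma L_mult: "r \<in> A \<Longrightarrow> v \<in> L \<Longrightarrow> r * v \<in> L"
  using A_mult[of r "v / g"] by (simp only: L_iff) simp

lemma g_L: "g \<in> L" using A_1 g0 by (simp only: L_iff) simp

abbreviation PQ :: "('f \<times> 'f) multiset set set ring" where "PQ \<equiv> pp_ring kk alg l"

abbreviation co :: "('f \<times> 'f) multiset set \<Rightarrow> ('f \<times> 'f) multiset set set"
  where "co s \<equiv> J (Suc l) +>\<^bsub>TT\<^esub> s"

sublocale PQ: cring PQ
  unfolding pp_ring_def by (rule ideal.quotient_is_cring[OF J_ideal TT_cring])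

lemma co_hom:
  "s \<in> carrier TT \<Longrightarrow> t \<in> carrier TT \<Longrightarrow> co s \<otimes>\<^bsub>PQ\<^esub> co t = co (s \<otimes>\<^bsub>TT\<^esub> t)"
  "s \<in> carrier TT \<Longrightarrow> t \<in> carrier TT \<Longrightarrow> co s \<oplus>\<^bsub>PQ\<^esub> co t = co (s \<oplus>\<^bsub>TT\<^esub> t)"
  "s \<in> carrier TT \<Longrightarrow> co s \<in> carrier PQ" "\<one>\<^bsub>PQ\<^esub> = co \<one>\<^bsub>TT\<^esub>"
  using ring_hom_mult[OF ideal.rcos_ring_hom[OF J_ideal], of s t]
    ring_hom_add[OF ideal.rcos_ring_hom[OF J_ideal], of s t]
    ring_hom_closed[OF ideal.rcos_ring_hom[OF J_ideal], of s]
    ring_hom_one[OF ideal.rcos_ring_hom[OF J_ideal]]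
  by (simp_all add: pp_ring_def)

lemma co_zero: "s \<in> J (Suc l) \<Longrightarrow> co s = \<zero>\<^bsub>PQ\<^esub>"
  using abelian_subgroup.a_rcos_const[OF abelian_subgroupI3[OF ideal.axioms(1)[OF J_ideal] TT.is_abelian_group]]
  by (simp add: pp_ring_def FactRing_def)

lemma PQ_cases:
  assumes "p \<in> carrier PQ"
  obtains X where "T.formal X" "p = co (T.cl X)"
  using assms by (auto simp: pp_ring_def FactRing_def A_RCOSETS_def' T.carrier_tensor)

abbreviation lf :: "'f \<Rightarrow> ('f \<times> 'f) multiset set set" where "lf \<equiv> pp_left kk alg l"
abbreviation rg :: "'f \<Rightarrow> ('f \<times> 'f) multiset set set" where "rg \<equiv> pp_right kk alg l"

lemma lf_def: "lf a = co (pt a 1)" and rg_def: "rg a = co (pt 1 a)"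
  by (simp_all add: pp_left_def pp_right_def pure_tensor_def)

lemma lf_carrier: "a \<in> A \<Longrightarrow> lf a \<in> carrier PQ" and rg_carrier: "a \<in> A \<Longrightarrow> rg a \<in> carrier PQ"
  by (simp_all add: lf_def rg_def co_hom(3) pt_carrier A_1)

abbreviation PR :: "('f, ('f \<times> 'f) multiset set set) module" where "PR \<equiv> pp_right_module kk alg l"

lemma PR_simps [simp]: "carrier PR = carrier PQ" "p \<oplus>\<^bsub>PR\<^esub> q = p \<oplus>\<^bsub>PQ\<^esub> q" "\<zero>\<^bsub>PR\<^esub> = \<zero>\<^bsub>PQ\<^esub>"
  "r \<odot>\<^bsub>PR\<^esub> p = rg r \<otimes>\<^bsub>PQ\<^esub> p"
  by (simp_all add: restrict_scalars_def regular_module_def)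

sublocale P: tensor_product alg PR Lm
proof
  show "v \<oplus>\<^bsub>Lm\<^esub> w \<in> carrier Lm" if "v \<in> carrier Lm" "w \<in> carrier Lm" for v w
    using that L_add by (simp del: image_iff)
  show "r \<odot>\<^bsub>Lm\<^esub> w \<in> carrier Lm" if "r \<in> carrier alg" "w \<in> carrier Lm" for r w
    using that L_mult by (simp del: image_iff)
qed (auto simp: rg_carrier)

abbreviation PP :: "('f, (('f \<times> 'f) multiset set set \<times> 'f) multiset set) module"
  where "PP \<equiv> principal_parts kk alg Lm l"

lemma PP_simps: "carrier PP = carrier (tensor alg PR Lm)" "s \<oplus>\<^bsub>PP\<^esub> t = s \<oplus>\<^bsub>tensor alg PR Lm\<^esub> t"
  "\<zero>\<^bsub>PP\<^esub> = P.cl {#}"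
  by (simp_all add: principal_parts_def P.zero_cl)

text \<open>Left multiplication commutes with the right structure over which the tensor product is
  formed, hence is balanced and acts on representatives term by term.\<close>

lemma PP_smult:
  assumes r: "r \<in> A" and Z: "P.formal Z"
  shows "r \<odot>\<^bsub>PP\<^esub> P.cl Z = P.cl (image_mset (map_prod (\<lambda>p. lf r \<otimes>\<^bsub>PQ\<^esub> p) id) Z)"
proof -
  have "P.rel (image_mset (map_prod (\<lambda>p. lf r \<otimes>\<^bsub>PQ\<^esub> p) id) Z) (image_mset (map_prod (\<lambda>p. lf r \<otimes>\<^bsub>PQ\<^esub> p) id) Z')"
    if "P.rel Z Z'" for Z'
  proof (rule tensor_rel_map[OF that], goal_cases)
    case (6 s p v)
    then show ?case using tensor_rel.balanced[of s alg "lf r \<otimes>\<^bsub>PQ\<^esub> p" PR v Lm]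
      by (simp add: r lf_carrier rg_carrier PQ.m_lcomm del: image_iff)
  qed (use r in \<open>simp_all add: lf_carrier PQ.r_distr\<close>)
  from P.tensor_map_cl[OF Z this] show ?thesis by (simp add: principal_parts_def)
qed

lemma PP_smult_closed: "r \<in> A \<Longrightarrow> t \<in> carrier PP \<Longrightarrow> r \<odot>\<^bsub>PP\<^esub> t \<in> carrier PP"
  unfolding PP_simps
proof (elim P.tensor_cases)
  fix Z assume r: "r \<in> A" and Z: "P.formal Z" and t: "t = P.cl Z"
  show "r \<odot>\<^bsub>PP\<^esub> t \<in> carrier (tensor alg PR Lm)"
    unfolding t PP_smult[OF r Z]
    using Z r by (intro P.cl_in_carrier P.formal_map[of Z "carrier PQ" L]) (auto simp: lf_carrier)
qed

lemma PP_add_closed: "s \<in> carrier PP \<Longrightarrow> t \<in> carrier PP \<Longrightarrow> s \<oplus>\<^bsub>PP\<^esub> t \<in> carrier PP"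
  unfolding PP_simps by (elim P.tensor_cases) (simp add: P.add_cl P.cl_in_carrier)

sublocale W: tensor_product alg kap PP
  by standard (auto simp: kap_simps res_hom PP_smult_closed PP_add_closed)

abbreviation tay :: "'f \<Rightarrow> (('f \<times> 'f) multiset set set \<times> 'f) multiset set"
  where "tay \<equiv> taylor kk alg Lm l"

lemma tay_def: "tay v = P.cl {#(\<one>\<^bsub>PQ\<^esub>, v)#}"
  by (simp add: taylor_def pure_tensor_def)

lemma tay_in: "v \<in> L \<Longrightarrow> tay v \<in> carrier PP"
  unfolding tay_def PP_simps by (rule P.cl_in_carrier) simp

lemma tay_add: "v \<in> L \<Longrightarrow> w \<in> L \<Longrightarrow> tay (v + w) = tay v \<oplus>\<^bsub>PP\<^esub> tay w"
  using P.cl_eqI[OF tensor_rel.distr_right[of "\<one>\<^bsub>PQ\<^esub>" PR v Lm w alg]]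
  unfolding tay_def PP_simps by (subst P.add_cl) (simp_all add: add_mset_commute)

section \<open>Differential operators as functionals on principal parts and on their fibres\<close>

definition phiP :: "('f \<Rightarrow> 'f) \<Rightarrow> ('f \<times> 'f) multiset set set \<Rightarrow> 'f"
  where "phiP D p = phi D (SOME X. T.formal X \<and> T.cl X \<in> p)"

text \<open>Two representatives of the coset differ by an element of \<open>J (Suc l)\<close>, which
  \<open>phi D\<close> kills because \<open>diff_op (Suc l)\<close> means order at most
  \<open>l\<close>. The arbitrary choice in \<open>phiP\<close> is therefore harmless for such
  operators.\<close>

lemma phiP_co:
  assumes D: "diff_op (Suc l) D" and X: "T.formal X"
  shows "phiP D (co (T.cl X)) = phi D X"
proof -
  define Y where "Y = (SOME Y. T.formal Y \<and> T.cl Y \<in> co (T.cl X))"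
  have "T.formal X \<and> T.cl X \<in> co (T.cl X)"
    using X abelian_subgroup.a_rcos_self[OF abelian_subgroupI3[OF ideal.axioms(1)[OF J_ideal] TT.is_abelian_group]] T.cl_in_carrier by blast
  then have Y: "T.formal Y" "T.cl Y \<in> co (T.cl X)" unfolding Y_def by (metis (mono_tags, lifting) someI)+
  then obtain j where j: "j \<in> J (Suc l)" "T.cl Y = j \<oplus>\<^bsub>TT\<^esub> T.cl X"
    by (auto simp: a_r_coset_def')
  then obtain Z where Z: "T.formal Z" "j = T.cl Z" using ideal.Icarr[OF J_ideal] T.tensor_cases by metis
  have "T.rel Y (Z + X)" using j Z X Y(1) T.cl_eq_iff[of Y "Z + X"] by (simp add: T.add_cl)
  then have "phi D Y = phi D (Z + X)" by (rule phi_rel[OF diff_op_lin[OF D]])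
  also have "\<dots> = phi D X" using phi_ideal_power[OF D Z(1)] j(1) Z(2) by simp
  finally show ?thesis by (simp add: phiP_def Y_def)
qed

lemma phiP_simps:
  assumes D: "diff_op (Suc l) D"
  shows "p \<in> carrier PQ \<Longrightarrow> q \<in> carrier PQ \<Longrightarrow> phiP D (p \<oplus>\<^bsub>PQ\<^esub> q) = phiP D p + phiP D q"
    and "p \<in> carrier PQ \<Longrightarrow> r \<in> A \<Longrightarrow> phiP D (rg r \<otimes>\<^bsub>PQ\<^esub> p) = phiP (\<lambda>z. D (r * z)) p"
    and "p \<in> carrier PQ \<Longrightarrow> r \<in> A \<Longrightarrow> phiP D (lf r \<otimes>\<^bsub>PQ\<^esub> p) = r * phiP D p"
    and "p \<in> carrier PQ \<Longrightarrow> phiP D p \<in> A"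
    and "phiP D \<one>\<^bsub>PQ\<^esub> = D 1"
    and "phiP D \<zero>\<^bsub>PQ\<^esub> = 0"
proof -
  assume "p \<in> carrier PQ" "q \<in> carrier PQ"
  then obtain X Y where "T.formal X" "p = co (T.cl X)" "T.formal Y" "q = co (T.cl Y)" by (metis PQ_cases)
  then show "phiP D (p \<oplus>\<^bsub>PQ\<^esub> q) = phiP D p + phiP D q"
    by (simp add: co_hom T.add_cl phiP_co D T.cl_in_carrier)
next
  assume "p \<in> carrier PQ" and r: "r \<in> A"
  then obtain X where "T.formal X" "p = co (T.cl X)" by (metis PQ_cases)
  then show "phiP D (rg r \<otimes>\<^bsub>PQ\<^esub> p) = phiP (\<lambda>z. D (r * z)) p"
    and "phiP D (lf r \<otimes>\<^bsub>PQ\<^esub> p) = r * phiP D p"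
    using r diff_op_mult[OF D r] phi_mulm_single[of D X r 1] phi_mulm_single[of D X 1 r]
      mulm_formal[of "{#(1, r)#}" X] mulm_formal[of "{#(r, 1)#}" X]
    by (simp_all add: lf_def rg_def co_hom mult_cl pt_carrier A_1 phiP_co D T.cl_in_carrier
      mulm_comm[of _ X] del: mulm_add_mset)
next
  assume "p \<in> carrier PQ"
  then obtain X where "T.formal X" "p = co (T.cl X)" by (metis PQ_cases)
  then show "phiP D p \<in> A" using phi_in[OF diff_op_lin[OF D]] by (simp add: phiP_co D)
next
  show "phiP D \<one>\<^bsub>PQ\<^esub> = D 1"
    using phiP_co[OF D, of "{#(1, 1)#}"] by (simp add: co_hom one_cl A_1)
  have "T.cl {#} \<in> J (Suc l)" using additive_subgroup.zero_closed[OF ideal.axioms(1)[OF J_ideal, of "Suc l"]]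
    by (simp add: T.zero_cl)
  from co_zero[OF this] show "phiP D \<zero>\<^bsub>PQ\<^esub> = 0"
    using phiP_co[OF D, of "{#}"] by (simp add: co_hom)
qed

lemma phiP_op_add:
  assumes "diff_op (Suc l) D" "diff_op (Suc l) E" "p \<in> carrier PQ"
  shows "phiP (\<lambda>z. D z + E z) p = phiP D p + phiP E p"
proof -
  obtain X where "T.formal X" "p = co (T.cl X)" using assms(3) by (metis PQ_cases)
  then show ?thesis using assms diff_op_add[OF assms(1,2)]
    by (simp add: phiP_co phi_op_add)
qed

lemma phiP_cong:
  assumes "diff_op (Suc l) D" "p \<in> carrier PQ" "\<And>a. a \<in> A \<Longrightarrow> D a = E a"
  shows "phiP D p = phiP E p"
proof -
  obtain X where "T.formal X" "p = co (T.cl X)" using assms(2) by (metis PQ_cases)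
  then show ?thesis using assms diff_op_cong[of D E, OF assms(3) assms(1)] phi_cong[of X D E]
    by (simp add: phiP_co)
qed

text \<open>The generator \<open>g\<close> trivialises the module: v is (v / g) g, and the factor v
  / g passes to the right structure of principal parts, that is, into the argument of
  \<open>D\<close>.\<close>

definition delta :: "('f \<Rightarrow> 'f) \<Rightarrow> (('f \<times> 'f) multiset set set \<times> 'f) multiset \<Rightarrow> 'f"
  where "delta D Z = (\<Sum>u\<in>#Z. phiP (\<lambda>z. D (snd u / g * z)) (fst u))"

lemma delta_rel:
  assumes D: "diff_op (Suc l) D" and "P.rel Z Z'"
  shows "delta D Z = delta D Z'"
proof -
  have Dm: "diff_op (Suc l) (\<lambda>z. D (v / g * z))" if "v \<in> L" for v
    using diff_op_mult[OF D] that by (simp only: L_iff)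
  have "delta D Z - delta D Z' \<in> {0}"
    unfolding delta_def
  proof (rule tensor_rel_lift_mod[OF assms(2)], goal_cases)
    case (3 v) then show ?case using phiP_simps(6)[OF Dm] by (simp del: image_iff)
  next
    case (4 p q v) then show ?case using phiP_simps(1)[OF Dm] by (simp del: image_iff)
  next
    case (5 p v w)
    then have v: "v \<in> L" "w \<in> L" "p \<in> carrier PQ" by simp_all
    have "phiP (\<lambda>z. D ((v + w) / g * z)) p = phiP (\<lambda>z. D (v / g * z) + D (w / g * z)) p"
    proof (rule phiP_cong[OF Dm[OF L_add[OF v(1,2)]] v(3)])
      fix a assume "a \<in> A"
      then have "v / g * a \<in> A" "w / g * a \<in> A" using v(1,2) by (simp_all only: L_iff A_mult)
      then show "D ((v + w) / g * a) = D (v / g * a) + D (w / g * a)"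
        using diff_op_lin[OF D] by (simp add: lin_def add_divide_distrib distrib_right)
    qed
    then show ?case using phiP_op_add[OF Dm Dm] v by (simp del: image_iff)
  next
    case (6 r p v)
    then show ?case using phiP_simps(2)[OF Dm, of v p r] by (simp add: mult.assoc mult.left_commute del: image_iff)
  qed auto
  then show ?thesis by simp
qed

definition deltaC :: "('f \<Rightarrow> 'f) \<Rightarrow> (('f \<times> 'f) multiset set set \<times> 'f) multiset set \<Rightarrow> 'f"
  where "deltaC D t = delta D (SOME Z. Z \<in> t)"

lemma deltaC_cl:
  assumes "diff_op (Suc l) D" "P.formal Z"
  shows "deltaC D (P.cl Z) = delta D Z"
proof -
  have "(SOME Y. Y \<in> P.cl Z) \<in> P.cl Z" using P.in_cl[OF assms(2)] by (rule someI)
  then show ?thesis using delta_rel[OF assms(1)] by (simp add: deltaC_def P.in_cl_iff)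
qed

lemma deltaC_simps:
  assumes D: "diff_op (Suc l) D"
  shows "s \<in> carrier PP \<Longrightarrow> t \<in> carrier PP \<Longrightarrow> deltaC D (s \<oplus>\<^bsub>PP\<^esub> t) = deltaC D s + deltaC D t"
    and "r \<in> A \<Longrightarrow> t \<in> carrier PP \<Longrightarrow> deltaC D (r \<odot>\<^bsub>PP\<^esub> t) = r * deltaC D t"
    and "t \<in> carrier PP \<Longrightarrow> deltaC D t \<in> A"
    and "v \<in> L \<Longrightarrow> deltaC D (tay v) = D (v / g)"
proof -
  have Dm: "diff_op (Suc l) (\<lambda>z. D (v / g * z))" if "v \<in> L" for v
    using diff_op_mult[OF D] that by (simp only: L_iff)
  show "s \<in> carrier PP \<Longrightarrow> t \<in> carrier PP \<Longrightarrow> deltaC D (s \<oplus>\<^bsub>PP\<^esub> t) = deltaC D s + deltaC D t"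
    unfolding PP_simps
  proof (elim P.tensor_cases)
    fix X Y assume "P.formal X" "P.formal Y" "s = P.cl X" "t = P.cl Y"
    then show "deltaC D (s \<oplus>\<^bsub>tensor alg PR Lm\<^esub> t) = deltaC D s + deltaC D t"
      using deltaC_cl[OF D] by (simp add: P.add_cl delta_def)
  qed
  show "r \<in> A \<Longrightarrow> t \<in> carrier PP \<Longrightarrow> deltaC D (r \<odot>\<^bsub>PP\<^esub> t) = r * deltaC D t"
    unfolding PP_simps
  proof (elim P.tensor_cases)
    fix X assume r: "r \<in> A" and X: "P.formal X" "t = P.cl X"
    have f: "P.formal (image_mset (map_prod (\<lambda>p. lf r \<otimes>\<^bsub>PQ\<^esub> p) id) X)"
      using X r by (intro P.formal_map[of X "carrier PQ" L]) (auto simp: lf_carrier)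
    have "delta D (image_mset (map_prod (\<lambda>p. lf r \<otimes>\<^bsub>PQ\<^esub> p) id) X) = r * delta D X"
      using X(1)
    proof (induction X)
      case (add u X)
      obtain p v where u: "u = (p, v)" by force
      with add.prems have "phiP (\<lambda>z. D (v / g * z)) (lf r \<otimes>\<^bsub>PQ\<^esub> p) = r * phiP (\<lambda>z. D (v / g * z)) p"
        using phiP_simps(3)[OF Dm] r by (simp del: image_iff)
      with add show ?case by (simp add: delta_def u algebra_simps)
    qed (simp add: delta_def)
    then show "deltaC D (r \<odot>\<^bsub>PP\<^esub> t) = r * deltaC D t"
      unfolding X(2) PP_smult[OF r X(1)] deltaC_cl[OF D f] deltaC_cl[OF D X(1)] .
  qed
  show "t \<in> carrier PP \<Longrightarrow> deltaC D t \<in> A"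
    unfolding PP_simps
  proof (elim P.tensor_cases)
    fix X assume X: "P.formal X" "t = P.cl X"
    have "delta D X \<in> A" unfolding delta_def
    proof (rule A_sum_mset)
      fix u assume "u \<in># X"
      with X(1) have "fst u \<in> carrier PQ" "snd u \<in> L" by (auto dest!: subsetD simp: mem_Times_iff)
      then show "phiP (\<lambda>z. D (snd u / g * z)) (fst u) \<in> A" using phiP_simps(4)[OF Dm] by blast
    qed
    then show "deltaC D t \<in> A" using deltaC_cl[OF D] X by simp
  qed
  assume v: "v \<in> L"
  then have "P.formal {#(\<one>\<^bsub>PQ\<^esub>, v)#}" by (simp del: image_iff)
  then show "deltaC D (tay v) = D (v / g)"
    using phiP_simps(5)[OF Dm[OF v]] unfolding tay_def by (subst deltaC_cl[OF D]) (simp_all add: delta_def)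
qed

text \<open>The pairing of an operator with the fibre over the residue field; it is well defined
  only modulo \<open>mm\<close> (\<open>Psi_rel\<close>).\<close>

definition Psi :: "('f \<Rightarrow> 'f) \<Rightarrow> ('f set \<times> (('f \<times> 'f) multiset set set \<times> 'f) multiset set) multiset \<Rightarrow> 'f"
  where "Psi D X = (\<Sum>u\<in>#X. rep (fst u) * deltaC D (snd u))"

lemma rep_mod:
  assumes "a \<in> A" "d \<in> A"
  shows "rep (res a) * d - a * d \<in> mm"
  using mm_mult_right[OF assms(2) rep_res[of a]] by (simp only: left_diff_distrib)

lemma Psi_rel:
  assumes D: "diff_op (Suc l) D" and "W.rel X Y"
  shows "Psi D X - Psi D Y \<in> mm"
  unfolding Psi_def
proof (rule tensor_rel_lift_mod[OF assms(2)], goal_cases)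
  case 1 show ?case by (rule mm_0)
next
  case (2 p q) then show ?case by (rule mm_diff)
next
  case (3 t)
  then have "deltaC D t \<in> A" by (rule deltaC_simps(3)[OF D])
  then show ?case using rep_mod[OF A_0] unfolding res_zero[OF mm_0] by (simp add: kap_simps)
next
  case (4 c c' t)
  then obtain a a' where a: "a \<in> A" "c = res a" "a' \<in> A" "c' = res a'" by (metis KK_cases kap_simps(1))
  have d: "deltaC D t \<in> A" using 4 by (intro deltaC_simps(3)[OF D])
  have "(rep (res (a + a')) * deltaC D t - (a + a') * deltaC D t)
    - ((rep (res a) * deltaC D t - a * deltaC D t) + (rep (res a') * deltaC D t - a' * deltaC D t)) \<in> mm"
    using a d A_add by (intro mm_diff mm_add rep_mod)
  then show ?case using a by (simp add: kap_simps res_hom algebra_simps)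
next
  case (5 c t t')
  then show ?case using deltaC_simps(1)[OF D] mm_0 by (simp add: distrib_left)
next
  case (6 r c t)
  then obtain a where a: "a \<in> A" "c = res a" by (metis KK_cases kap_simps(1))
  have r: "r \<in> A" using 6 by simp
  have d: "deltaC D t \<in> A" using 6 by (intro deltaC_simps(3)[OF D])
  have "(rep (res (r * a)) * deltaC D t - (r * a) * deltaC D t)
    - r * (rep (res a) * deltaC D t - a * deltaC D t) \<in> mm"
    using a r d A_mult by (intro mm_diff mm_mult rep_mod)
  then show ?case using a r 6 deltaC_simps(2)[OF D r]
    by (simp add: kap_simps res_hom algebra_simps)
qed

end

section \<open>The fibre map on a space of sections with a finite basis\<close>

locale taylor_map_basis = taylor_map cst A g l
  for cst :: "'k::field \<Rightarrow> 'f::field" and A :: "'f set" and g :: 'f and l :: nat +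
  fixes Q :: "'i set" and v :: "'i \<Rightarrow> 'f" and V :: "'f set"
  assumes Q_finite: "finite Q" and v_L: "\<And>i. i \<in> Q \<Longrightarrow> v i \<in> L"
    and V_eq: "V = range (\<lambda>c. \<Sum>i\<in>Q. cst (c i) * v i)"
    and independent: "\<And>c i. (\<Sum>j\<in>Q. cst (c j) * v j) = 0 \<Longrightarrow> i \<in> Q \<Longrightarrow> c i = 0"
begin

lemma V_comb: "(\<Sum>i\<in>Q. cst (c i) * v i) \<in> V" by (simp add: V_eq)

lemma V_cases:
  assumes "w \<in> V" obtains c where "w = (\<Sum>i\<in>Q. cst (c i) * v i)"
  using assms by (auto simp: V_eq)

lemma V_add: "w \<in> V \<Longrightarrow> w' \<in> V \<Longrightarrow> w + w' \<in> V"
proof (elim V_cases)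
  fix c d assume "w = (\<Sum>i\<in>Q. cst (c i) * v i)" "w' = (\<Sum>i\<in>Q. cst (d i) * v i)"
  then have "w + w' = (\<Sum>i\<in>Q. cst (c i + d i) * v i)"
    by (simp add: cst_add distrib_right sum.distrib)
  then show ?thesis using V_comb by simp
qed

lemma V_cst: "w \<in> V \<Longrightarrow> cst b * w \<in> V"
proof (elim V_cases)
  fix c assume "w = (\<Sum>i\<in>Q. cst (c i) * v i)"
  then have "cst b * w = (\<Sum>i\<in>Q. cst (b * c i) * v i)"
    by (simp add: cst_mult sum_distrib_left mult.assoc)
  then show ?thesis using V_comb by simp
qed

lemma V_v: "i \<in> Q \<Longrightarrow> v i \<in> V"
proof -
  assume i: "i \<in> Q"
  have "(\<Sum>j\<in>Q. cst (if j = i then 1 else 0) * v j) = (\<Sum>j\<in>Q. if j = i then v j else 0)"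
    by (rule sum.cong) (auto simp: cst_0 cst_1)
  then show ?thesis using V_comb[of "\<lambda>j. if j = i then 1 else 0"] i Q_finite by simp
qed

lemma V_0: "0 \<in> V" using V_comb[of "\<lambda>_. 0"] by (simp add: cst_0)

lemma V_sum: "(\<And>i. i \<in> F \<Longrightarrow> w i \<in> V) \<Longrightarrow> sum w F \<in> V"
  by (induction F rule: infinite_finite_induct) (auto simp: V_0 V_add)

lemma V_L: "w \<in> V \<Longrightarrow> w \<in> L"
proof (elim V_cases)
  fix c assume w: "w = (\<Sum>i\<in>Q. cst (c i) * v i)"
  have "(\<Sum>i\<in>Q. cst (c i) * (v i / g)) \<in> A" using v_L unfolding L_iff by (intro A_sum A_mult cst_in) auto
  then show ?thesis unfolding L_iff by (simp add: w sum_divide_distrib)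
qed

abbreviation kapk :: "('k, 'f set) module" where "kapk \<equiv> restrict_scalars (structure_map alg) kap"

abbreviation Vm :: "('k, 'f) module"
  where "Vm \<equiv> (restrict_scalars (structure_map alg) Lm) \<lparr>carrier := V\<rparr>"

lemma source_simps [simp]:
  "carrier kapk = carrier KK" "c \<oplus>\<^bsub>kapk\<^esub> d = c \<oplus>\<^bsub>KK\<^esub> d" "\<zero>\<^bsub>kapk\<^esub> = \<zero>\<^bsub>KK\<^esub>"
  "b \<odot>\<^bsub>kapk\<^esub> c = res (cst b) \<otimes>\<^bsub>KK\<^esub> c"
  "carrier Vm = V" "w \<oplus>\<^bsub>Vm\<^esub> w' = w + w'" "b \<odot>\<^bsub>Vm\<^esub> w = cst b * w"
  by (simp_all add: restrict_scalars_def structure_map_def regular_module_def ring_on_def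
      residue_field_def mm_def)

lemma restrict_Lm_simps [simp]:
  "u \<oplus>\<^bsub>restrict_scalars (structure_map alg) Lm\<^esub> w = u + w"
  "b \<odot>\<^bsub>restrict_scalars (structure_map alg) Lm\<^esub> w = cst b * w"
  by (simp_all add: restrict_scalars_def structure_map_def)

sublocale S: tensor_product kk kapk Vm
  by standard (auto simp: V_add V_cst res_hom cst_in)

lemma fibre_source_eq: "fibre_source kk alg Lm V = tensor kk kapk Vm"
  by (simp add: fibre_source_def)

abbreviation img :: "('f set \<times> 'f) multiset \<Rightarrow> ('f set \<times> (('f \<times> 'f) multiset set set \<times> 'f) multiset set) multiset"
  where "img X \<equiv> image_mset (map_prod id tay) X"

text \<open>Constants pass through a tensor product over k. That the left and right structures agree
  on them makes the Taylor map k-linear.\<close>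

lemma lf_cst: "lf (cst b) = rg (cst b)"
  using pt_balanced[OF A_1 A_1, of b] by (simp add: lf_def rg_def)

lemma tay_smult: "r \<in> A \<Longrightarrow> w \<in> L \<Longrightarrow> P.cl {#(rg r, w)#} = tay (r * w)"
  using P.cl_eqI[OF tensor_rel.balanced[of r alg "\<one>\<^bsub>PQ\<^esub>" PR w Lm]] by (simp add: tay_def rg_carrier del: image_iff)

lemma smult_tay: "r \<in> A \<Longrightarrow> w \<in> L \<Longrightarrow> r \<odot>\<^bsub>PP\<^esub> tay w = P.cl {#(lf r, w)#}"
  using PP_smult[of r "{#(\<one>\<^bsub>PQ\<^esub>, w)#}"] by (simp add: tay_def lf_carrier del: image_iff)

lemma img_rel:
  assumes "S.rel X Y"
  shows "W.rel (img X) (img Y)"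
proof (rule tensor_rel_map[OF assms], goal_cases)
  case (5 w w')
  then show ?case using tay_add V_L by simp
next
  case (6 b c w)
  then have w: "w \<in> L" using V_L by simp
  have "cst b \<odot>\<^bsub>PP\<^esub> tay w = tay (cst b * w)"
    using smult_tay[OF cst_in w] tay_smult[OF cst_in w] by (simp add: lf_cst)
  then show ?case using tensor_rel.balanced[of "cst b" alg c kap "tay w" PP] 6 tay_in[OF w]
    by (simp add: kap_simps cst_in)
qed (use tay_in V_L in \<open>auto simp: kap_simps simp del: image_iff\<close>)

lemma img_formal: "S.formal X \<Longrightarrow> W.formal (img X)"
  using tay_in V_L by (intro W.formal_map[of X "carrier KK" V]) (auto simp: kap_simps simp del: image_iff)

lemma taylor_fibre_cl: "S.formal X \<Longrightarrow> taylor_fibre kk alg Lm l (S.cl X) = W.cl (img X)"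
  unfolding taylor_fibre_def by (rule S.tensor_map_cl[OF _ img_rel])

text \<open>Normal form of an element of the source: one residue class per basis section, recorded
  by a representative in \<open>A\<close>.\<close>

definition nf :: "('i \<Rightarrow> 'f) \<Rightarrow> ('f set \<times> 'f) multiset"
  where "nf a = (\<Sum>i\<in>Q. {#(res (a i), v i)#})"

lemma set_mset_sum': "set_mset (\<Sum>i\<in>F. {#f i#}) \<subseteq> f ` F"
  by (induction F rule: infinite_finite_induct) auto

lemma nf_formal: "(\<And>i. a i \<in> A) \<Longrightarrow> S.formal (nf a)"
  unfolding nf_def using set_mset_sum'[of "\<lambda>i. (res (a i), v i)" Q] V_v res_hom(3) by fastforce

lemma nf_add:
  assumes "\<And>i. a i \<in> A" "\<And>i. b i \<in> A"
  shows "S.rel (nf a + nf b) (nf (\<lambda>i. a i + b i))"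
  unfolding nf_def sum.distrib[symmetric]
proof (rule S.rel_sum)
  fix i assume "i \<in> Q"
  then show "S.rel ({#(res (a i), v i)#} + {#(res (b i), v i)#}) {#(res (a i + b i), v i)#}"
    using tensor_rel.distr_left[of "res (a i)" kapk "res (b i)" "v i" Vm kk] assms
    by - (rule tensor_rel.sym, simp add: res_hom V_v add_mset_commute)
qed

lemma nf_zero: "S.rel {#} (nf (\<lambda>_. 0))"
proof -
  have "S.rel (\<Sum>i\<in>Q. {#}) (nf (\<lambda>_. 0))"
    unfolding nf_def
  proof (rule S.rel_sum)
    fix i assume "i \<in> Q"
    then show "S.rel {#} {#(res 0, v i)#}"
      using tensor_rel.zero[of "v i" Vm kk kapk] by - (rule tensor_rel.sym, simp add: res_zero mm_0 V_v)
  qed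
  then show ?thesis by simp
qed

text \<open>The congruence has a rule for a zero on the left only; a zero on the right is obtained
  by balancing the scalar 0.\<close>

lemma rel_zero_right:
  assumes "c \<in> carrier KK"
  shows "S.rel {#(c, 0)#} {#}"
proof -
  obtain a where a: "a \<in> A" "c = res a" using assms KK_cases by metis
  have zero: "res (cst 0) \<otimes>\<^bsub>KK\<^esub> c = \<zero>\<^bsub>KK\<^esub>"
    using a by (simp add: cst_0 res_hom A_0 res_zero mm_0)
  have 1: "S.rel {#(\<zero>\<^bsub>KK\<^esub>, 0)#} {#(c, 0)#}"
    using tensor_rel.balanced[of 0 kk c kapk 0 Vm] assms V_0 by (simp add: zero)
  have 2: "S.rel {#(\<zero>\<^bsub>KK\<^esub>, 0)#} {#}" using tensor_rel.zero[of 0 Vm kk kapk] V_0 by simp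
  show ?thesis by (rule tensor_rel.trans[OF tensor_rel.sym[OF 1] 2])
qed

lemma rel_sum_right:
  assumes "c \<in> carrier KK" and "\<And>i. i \<in> F \<Longrightarrow> w i \<in> V"
  shows "S.rel {#(c, sum w F)#} (\<Sum>i\<in>F. {#(c, w i)#})"
  using assms(2)
proof (induction F rule: infinite_finite_induct)
  case (insert i F)
  have "S.rel {#(c, w i + sum w F)#} ({#(c, w i)#} + {#(c, sum w F)#})"
    using tensor_rel.distr_right[of c kapk "w i" Vm "sum w F" kk] assms(1) insert V_sum[of F w]
    by (simp add: add_mset_commute)
  moreover have "S.rel ({#(c, w i)#} + {#(c, sum w F)#}) ({#(c, w i)#} + (\<Sum>i\<in>F. {#(c, w i)#}))"
    using insert assms(1) by (intro tensor_rel.add tensor_rel.refl) auto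
  ultimately have "S.rel {#(c, w i + sum w F)#} ({#(c, w i)#} + (\<Sum>i\<in>F. {#(c, w i)#}))"
    by (rule tensor_rel.trans)
  then show ?case using insert(1,2) by simp
qed (use rel_zero_right[OF assms(1)] in simp_all)

lemma normal_form:
  assumes "S.formal X"
  shows "\<exists>a. (\<forall>i. a i \<in> A) \<and> S.rel X (nf a)"
  using assms
proof (induction X)
  case empty
  then show ?case using nf_zero A_0 by (intro exI[of _ "\<lambda>_. 0"]) simp
next
  case (add u X)
  obtain c w where u: "u = (c, w)" by force
  obtain a where a: "\<And>i. a i \<in> A" "S.rel X (nf a)" using add by auto
  have c: "c \<in> carrier KK" "w \<in> V" using add.prems u by auto
  obtain b where b: "b \<in> A" "c = res b" using KK_cases[OF c(1)] .
  obtain d where d: "w = (\<Sum>i\<in>Q. cst (d i) * v i)" using V_cases[OF c(2)] .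
  have "S.rel {#(c, w)#} (\<Sum>i\<in>Q. {#(c, cst (d i) * v i)#})"
    unfolding d using V_v V_cst by (intro rel_sum_right[OF c(1)]) auto
  moreover have "S.rel (\<Sum>i\<in>Q. {#(c, cst (d i) * v i)#}) (nf (\<lambda>i. cst (d i) * b))"
    unfolding nf_def
  proof (rule S.rel_sum)
    fix i assume "i \<in> Q"
    then show "S.rel {#(c, cst (d i) * v i)#} {#(res (cst (d i) * b), v i)#}"
      using tensor_rel.balanced[of "d i" kk c kapk "v i" Vm] c(1) b V_v
      by - (rule tensor_rel.sym, simp add: res_hom cst_in)
  qed
  ultimately have "S.rel {#(c, w)#} (nf (\<lambda>i. cst (d i) * b))" by (rule tensor_rel.trans)
  from tensor_rel.add[OF this a(2)]
  have "S.rel (add_mset u X) (nf (\<lambda>i. cst (d i) * b) + nf a)" by (simp add: u)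
  from tensor_rel.trans[OF this nf_add]
  have "S.rel (add_mset u X) (nf (\<lambda>i. cst (d i) * b + a i))" using a b by (simp add: A_mult cst_in)
  with a b show ?case by (intro exI[of _ "\<lambda>i. cst (d i) * b + a i"]) (simp add: A_mult A_add cst_in)
qed

lemma image_mset_sum: "image_mset h (\<Sum>i\<in>F. f i) = (\<Sum>i\<in>F. image_mset h (f i))"
  by (induction F rule: infinite_finite_induct) auto

text \<open>Makes the pairing computable: the Taylor image of a basis section pairs with
  \<open>D\<close> to \<open>D (v i / g)\<close>.\<close>

lemma Psi_nf:
  assumes D: "diff_op (Suc l) D" and a: "\<And>i. a i \<in> A"
  shows "Psi D (img (nf a)) - (\<Sum>i\<in>Q. a i * D (v i / g)) \<in> mm"
proof -
  have sum: "Psi D (\<Sum>i\<in>F. {#f i#}) = (\<Sum>i\<in>F. rep (fst (f i)) * deltaC D (snd (f i)))" for F and f :: "'i \<Rightarrow> _"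
    by (induction F rule: infinite_finite_induct) (auto simp: Psi_def)
  have "Psi D (img (nf a)) = (\<Sum>i\<in>Q. rep (res (a i)) * D (v i / g))"
    unfolding nf_def image_mset_sum image_mset_single map_prod_simp id_apply sum fst_conv snd_conv
    using deltaC_simps(4)[OF D v_L] by (intro sum.cong) auto
  moreover have "D (v i / g) \<in> A" if "i \<in> Q" for i
    using diff_op_lin[OF D] v_L[OF that] by (simp only: L_iff lin_def)
  ultimately show ?thesis
    unfolding sum_subtractf[symmetric] by (auto simp flip: sum_subtractf intro!: mm_sum rep_mod a)
qed

text \<open>If two normal forms have the same image, then every functional coming from an operator
  of order at most \<open>l\<close> annihilates their difference modulo \<open>mm\<close>. The
  hypothesis says that these functionals detect all coefficients.\<close>

theorem taylor_fibre_injI: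
  assumes crit: "\<And>a. (\<And>i. a i \<in> A) \<Longrightarrow> (\<And>D. diff_op (Suc l) D \<Longrightarrow> (\<Sum>i\<in>Q. a i * D (v i / g)) \<in> mm)
    \<Longrightarrow> (\<And>i. i \<in> Q \<Longrightarrow> a i \<in> mm)"
  shows "inj_on (taylor_fibre kk alg Lm l) (carrier (fibre_source kk alg Lm V))"
proof (rule inj_onI)
  fix s t assume "s \<in> carrier (fibre_source kk alg Lm V)" "t \<in> carrier (fibre_source kk alg Lm V)"
    and eq: "taylor_fibre kk alg Lm l s = taylor_fibre kk alg Lm l t"
  then obtain X Y where X: "S.formal X" "s = S.cl X" and Y: "S.formal Y" "t = S.cl Y"
    unfolding fibre_source_eq by (metis S.tensor_cases)
  obtain a where a: "\<And>i. a i \<in> A" "S.rel X (nf a)" using normal_form[OF X(1)] by blast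
  obtain b where b: "\<And>i. b i \<in> A" "S.rel Y (nf b)" using normal_form[OF Y(1)] by blast
  have "W.rel (img X) (img Y)"
    using eq X Y by (simp add: taylor_fibre_cl W.cl_eq_iff[OF img_formal])
  then have rel: "W.rel (img (nf a)) (img (nf b))"
    using tensor_rel.trans[OF tensor_rel.sym[OF img_rel[OF a(2)]]] tensor_rel.trans[OF _ img_rel[OF b(2)]] by blast
  have ab: "a i - b i \<in> mm" if "i \<in> Q" for i
  proof (rule crit[of "\<lambda>i. a i - b i", OF _ _ that])
    show "a i - b i \<in> A" for i using a b by (simp add: A_diff)
    fix D assume D: "diff_op (Suc l) D"
    have "(Psi D (img (nf a)) - Psi D (img (nf b))) - (Psi D (img (nf a)) - (\<Sum>i\<in>Q. a i * D (v i / g)))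
        + (Psi D (img (nf b)) - (\<Sum>i\<in>Q. b i * D (v i / g))) \<in> mm"
      by (rule mm_add[OF mm_diff[OF Psi_rel[OF D rel] Psi_nf[OF D a(1)]] Psi_nf[OF D b(1)]])
    then show "(\<Sum>i\<in>Q. (a i - b i) * D (v i / g)) \<in> mm"
      by (simp add: left_diff_distrib sum_subtractf)
  qed
  have "nf a = nf b"
    unfolding nf_def using res_eqI[OF a(1) b(1) ab] by (intro sum.cong) auto
  then have "S.rel X Y" using tensor_rel.trans[OF a(2)] tensor_rel.sym[OF b(2)] by simp
  then show "s = t" using X Y S.cl_eqI by simp
qed

text \<open>Elements of A \<otimes> A that become 0 in the fibre for an evident reason: they are
  sums of elements of the (l+1)-st power of the diagonal ideal and of left multiples by nonunits.
  They serve to exhibit kernel vectors.\<close>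

inductive_set fibre_null :: "('f \<times> 'f) multiset set set"
  where
    order: "s \<in> J (Suc l) \<Longrightarrow> s \<in> fibre_null"
  | max: "m \<in> mm \<Longrightarrow> t \<in> carrier TT \<Longrightarrow> pt m 1 \<otimes>\<^bsub>TT\<^esub> t \<in> fibre_null"
  | add: "s \<in> fibre_null \<Longrightarrow> t \<in> fibre_null \<Longrightarrow> s \<oplus>\<^bsub>TT\<^esub> t \<in> fibre_null"

lemma fibre_null_carrier: "s \<in> fibre_null \<Longrightarrow> s \<in> carrier TT"
  by (induction rule: fibre_null.induct) (auto simp: pt_carrier mm_A A_1 intro: ideal.Icarr[OF J_ideal])

abbreviation tensor_g :: "('f \<times> 'f) multiset set \<Rightarrow> (('f \<times> 'f) multiset set set \<times> 'f) multiset set"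
  where "tensor_g s \<equiv> P.cl {#(co s, g)#}"

lemma tensor_g_in: "s \<in> carrier TT \<Longrightarrow> tensor_g s \<in> carrier PP"
  unfolding PP_simps using g_L by (intro P.cl_in_carrier) (simp add: co_hom)

lemma tensor_g_add:
  "s \<in> carrier TT \<Longrightarrow> t \<in> carrier TT \<Longrightarrow> tensor_g (s \<oplus>\<^bsub>TT\<^esub> t) = tensor_g s \<oplus>\<^bsub>PP\<^esub> tensor_g t"
  using P.cl_eqI[OF tensor_rel.distr_left[of "co s" PR "co t" g Lm alg]] g_L
  unfolding PP_simps by (subst P.add_cl) (simp_all add: co_hom add_mset_commute)

lemma tensor_g_lf:
  "r \<in> A \<Longrightarrow> s \<in> carrier TT \<Longrightarrow> tensor_g (pt r 1 \<otimes>\<^bsub>TT\<^esub> s) = r \<odot>\<^bsub>PP\<^esub> tensor_g s"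
  using g_L by (subst PP_smult) (simp_all add: co_hom lf_def pt_carrier A_1)

lemma one_smult: "r \<in> A \<Longrightarrow> r \<odot>\<^bsub>kap\<^esub> res 1 = res r"
  by (simp add: kap_simps res_hom A_1)

lemma W_balanced_one: "r \<in> A \<Longrightarrow> t \<in> carrier PP \<Longrightarrow> W.rel {#(res r, t)#} {#(res 1, r \<odot>\<^bsub>PP\<^esub> t)#}"
  using tensor_rel.balanced[of r alg "res 1" kap t PP] by (simp add: one_smult) (simp add: kap_simps res_hom A_1)

lemma W_mm: "m \<in> mm \<Longrightarrow> t \<in> carrier PP \<Longrightarrow> W.rel {#(res 1, m \<odot>\<^bsub>PP\<^esub> t)#} {#}"
  using tensor_rel.trans[OF tensor_rel.sym[OF W_balanced_one[OF mm_A]], of m t "{#}"]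
    tensor_rel.zero[of t PP alg kap] by (simp add: res_zero kap_simps)

lemma W_add: "s \<in> carrier PP \<Longrightarrow> t \<in> carrier PP
    \<Longrightarrow> W.rel {#(res 1, s \<oplus>\<^bsub>PP\<^esub> t)#} ({#(res 1, s)#} + {#(res 1, t)#})"
  using tensor_rel.distr_right[of "res 1" kap s PP t alg] by (simp add: kap_simps res_hom A_1 add_mset_commute)

lemma fibre_null_rel: "s \<in> fibre_null \<Longrightarrow> W.rel {#(res 1, tensor_g s)#} {#}"
proof (induction rule: fibre_null.induct)
  case (order s)
  have "P.rel {#(co s, g)#} {#}"
    using tensor_rel.zero[of g Lm alg PR] g_L by (simp add: co_zero[OF order])
  then have "tensor_g s = P.cl {#}" by (rule P.cl_eqI)
  \<comment> \<open>A zero in the right factor is written as the scalar 0 times itself; the scalar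
    lies in \<open>mm\<close> and is absorbed by the residue field.\<close>
  also have "\<dots> = 0 \<odot>\<^bsub>PP\<^esub> P.cl {#}" by (subst PP_smult) (simp_all add: A_0)
  finally show ?case using W_mm[OF mm_0, of "P.cl {#}"] by (simp add: PP_simps P.cl_in_carrier)
next
  case (max m t)
  then show ?case by (simp add: tensor_g_lf mm_A W_mm tensor_g_in)
next
  case (add s t)
  note c = fibre_null_carrier[OF add.hyps(1)] fibre_null_carrier[OF add.hyps(2)]
  have "W.rel ({#(res 1, tensor_g s)#} + {#(res 1, tensor_g t)#}) ({#} + {#})"
    by (intro tensor_rel.add add.IH)
  from tensor_rel.trans[OF W_add[OF tensor_g_in[OF c(1)] tensor_g_in[OF c(2)]] this] show ?case
    by (simp add: tensor_g_add[OF c])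
qed

lemma tensor_g_pt:
  assumes "a \<in> A" "b \<in> A"
  shows "W.rel {#(res a, tay (b * g))#} {#(res 1, tensor_g (pt a b))#}"
proof -
  have "pt a b = pt a 1 \<otimes>\<^bsub>TT\<^esub> pt 1 b" using assms by (simp add: pt_mult A_1)
  then have "tensor_g (pt a b) = a \<odot>\<^bsub>PP\<^esub> tensor_g (pt 1 b)"
    using assms tensor_g_lf[OF assms(1), of "pt 1 b"] by (simp add: pt_carrier A_1)
  also have "tensor_g (pt 1 b) = tay (b * g)"
    using tay_smult[OF assms(2) g_L] by (simp add: rg_def)
  finally show ?thesis using W_balanced_one[OF assms(1) tay_in] g_L L_mult assms(2) by simp
qed

definition coordinate :: "'i \<Rightarrow> 'f \<Rightarrow> 'k"
  where "coordinate i w = (SOME c. w = (\<Sum>j\<in>Q. cst (c j) * v j)) i"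

lemma coordinate_eq:
  assumes "i \<in> Q"
  shows "coordinate i (\<Sum>j\<in>Q. cst (c j) * v j) = c i"
proof -
  define d where "d = (SOME d. (\<Sum>j\<in>Q. cst (c j) * v j) = (\<Sum>j\<in>Q. cst (d j) * v j))"
  have "(\<Sum>j\<in>Q. cst (c j) * v j) = (\<Sum>j\<in>Q. cst (d j) * v j)"
    unfolding d_def by (rule someI[of _ c]) simp
  then have "(\<Sum>j\<in>Q. cst (c j - d j) * v j) = 0"
    by (simp add: cst_diff left_diff_distrib sum_subtractf)
  from independent[OF this assms] show ?thesis by (simp add: coordinate_def d_def)
qed

lemma coordinate_simps:
  assumes "i \<in> Q"
  shows "w \<in> V \<Longrightarrow> w' \<in> V \<Longrightarrow> coordinate i (w + w') = coordinate i w + coordinate i w'"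
    and "w \<in> V \<Longrightarrow> coordinate i (cst b * w) = b * coordinate i w"
    and "j \<in> Q \<Longrightarrow> coordinate i (v j) = (if j = i then 1 else 0)"
proof -
  assume "w \<in> V" "w' \<in> V"
  then obtain c d where w: "w = (\<Sum>j\<in>Q. cst (c j) * v j)" "w' = (\<Sum>j\<in>Q. cst (d j) * v j)"
    by (metis V_cases)
  then have "w + w' = (\<Sum>j\<in>Q. cst (c j + d j) * v j)" by (simp add: cst_add distrib_right sum.distrib)
  then show "coordinate i (w + w') = coordinate i w + coordinate i w'"
    using coordinate_eq[OF assms, of "\<lambda>j. c j + d j"] coordinate_eq[OF assms] w by simp
next
  assume "w \<in> V"
  then obtain c where w: "w = (\<Sum>j\<in>Q. cst (c j) * v j)" by (metis V_cases)
  then have "cst b * w = (\<Sum>j\<in>Q. cst (b * c j) * v j)" by (simp add: cst_mult sum_distrib_left mult.assoc)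
  then show "coordinate i (cst b * w) = b * coordinate i w"
    using coordinate_eq[OF assms, of "\<lambda>j. b * c j"] coordinate_eq[OF assms] w by simp
next
  assume j: "j \<in> Q"
  have "(\<Sum>n\<in>Q. cst (if j = n then 1 else 0) * v n) = (\<Sum>n\<in>Q. if j = n then v n else 0)"
    by (rule sum.cong) (auto simp: cst_0 cst_1)
  then have "v j = (\<Sum>n\<in>Q. cst (if j = n then 1 else 0) * v n)" using j Q_finite by simp
  then show "coordinate i (v j) = (if j = i then 1 else 0)"
    using coordinate_eq[OF assms, of "\<lambda>n. if j = n then 1 else 0"] by simp
qed

text \<open>The dual coordinate of \<open>v i\<close>, extended to the residue field through
  representatives, recovers the i-th coefficient modulo \<open>mm\<close>. So the basis sections
  remain independent after extension of scalars.\<close>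

lemma nf_not_zero:
  assumes rel: "S.rel (nf a) {#}" and a: "\<And>i. a i \<in> A" and i: "i \<in> Q"
  shows "a i \<in> mm"
proof -
  let ?f = "\<lambda>u. rep (fst u) * cst (coordinate i (snd u))"
  have "(\<Sum>u\<in>#nf a. ?f u) - (\<Sum>u\<in>#{#}. ?f u) \<in> mm"
  proof (rule tensor_rel_lift_mod[OF rel], goal_cases)
    case 1 show ?case by (rule mm_0)
  next
    case (2 p q) then show ?case by (rule mm_diff)
  next
    case (3 w)
    then show ?case using rep_mod[OF A_0 cst_in] unfolding res_zero[OF mm_0] by simp
  next
    case (4 c c' w)
    then obtain b b' where b: "b \<in> A" "c = res b" "b' \<in> A" "c' = res b'" by (metis KK_cases source_simps(1))
    let ?d = "cst (coordinate i w)"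
    have "(rep (res (b + b')) * ?d - (b + b') * ?d)
      - ((rep (res b) * ?d - b * ?d) + (rep (res b') * ?d - b' * ?d)) \<in> mm"
      using b A_add cst_in by (intro mm_diff mm_add rep_mod)
    then show ?case using b by (simp add: res_hom algebra_simps)
  next
    case (5 c w w')
    then show ?case using coordinate_simps(1)[OF i] mm_0 by (simp add: distrib_left cst_add)
  next
    case (6 r c w)
    then obtain b where b: "b \<in> A" "c = res b" by (metis KK_cases source_simps(1))
    let ?d = "cst (coordinate i w)"
    have "(rep (res (cst r * b)) * ?d - (cst r * b) * ?d) - cst r * (rep (res b) * ?d - b * ?d) \<in> mm"
      by (rule mm_diff[OF rep_mod[OF A_mult[OF cst_in b(1)] cst_in] mm_mult[OF cst_in rep_mod[OF b(1) cst_in]]])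
    then show ?case using b 6 coordinate_simps(2)[OF i]
      by (simp add: res_hom cst_in cst_mult algebra_simps)
  qed
  moreover have "(\<Sum>u\<in>#(\<Sum>j\<in>F. {#(res (a j), v j)#}). ?f u) = (\<Sum>j\<in>F. ?f (res (a j), v j))" for F
    by (induction F rule: infinite_finite_induct) auto
  then have "(\<Sum>u\<in>#nf a. ?f u) = (\<Sum>j\<in>Q. if j = i then rep (res (a j)) else 0)"
    unfolding nf_def using coordinate_simps(3)[OF i] by (auto simp: cst_0 cst_1 intro!: sum.cong)
  ultimately have "rep (res (a i)) \<in> mm" using i Q_finite by simp
  with mm_diff[OF this rep_res[of "a i"]] show ?thesis by simp
qed

text \<open>The normal form with coefficients \<open>a\<close> is nonzero by
  \<open>nf_not_zero\<close>, and its image is 1 \<otimes> (s \<otimes> g) for the class s of the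
  formal sum, which vanishes by hypothesis.\<close>

theorem taylor_fibre_not_inj:
  assumes a: "\<And>i. a i \<in> A" and i: "i \<in> Q" "a i \<notin> mm"
    and null: "T.cl (\<Sum>i\<in>Q. {#(a i, v i / g)#}) \<in> fibre_null"
  shows "\<not> inj_on (taylor_fibre kk alg Lm l) (carrier (fibre_source kk alg Lm V))"
proof
  assume inj: "inj_on (taylor_fibre kk alg Lm l) (carrier (fibre_source kk alg Lm V))"
  \<comment> \<open>Term by term, the coefficients move from the residue field to the left factor of
    A \<otimes> A, so that the whole image is gathered into a single tensor.\<close>
  have "W.rel (\<Sum>i\<in>F. {#(res (a i), tay (v i))#}) {#(res 1, tensor_g (T.cl (\<Sum>i\<in>F. {#(a i, v i / g)#})))#}
    \<and> T.formal (\<Sum>i\<in>F. {#(a i, v i / g)#})"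
    if "finite F" "F \<subseteq> Q" for F
    using that
  proof (induction F rule: finite_induct)
    case empty
    have "T.cl {#} \<in> J (Suc l)" using additive_subgroup.zero_closed[OF ideal.axioms(1)[OF J_ideal, of "Suc l"]]
      by (simp add: T.zero_cl)
    from tensor_rel.sym[OF fibre_null_rel[OF fibre_null.order[OF this]]] show ?case by simp
  next
    case (insert i F)
    then have i: "i \<in> Q" by simp
    then have vi: "v i / g \<in> A" "v i = v i / g * g" using v_L[OF i] g0 by (simp_all only: L_iff) simp
    let ?X = "\<Sum>i\<in>F. {#(a i, v i / g)#}"
    have IH: "W.rel (\<Sum>i\<in>F. {#(res (a i), tay (v i))#}) {#(res 1, tensor_g (T.cl ?X))#}" "T.formal ?X"
      using insert by auto
    have c: "pt (a i) (v i / g) \<in> carrier TT" "T.cl ?X \<in> carrier TT"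
      using a vi IH(2) by (auto intro!: pt_carrier T.cl_in_carrier)
    have "T.cl ({#(a i, v i / g)#} + ?X) = pt (a i) (v i / g) \<oplus>\<^bsub>TT\<^esub> T.cl ?X"
      using a vi IH(2) by (subst T.add_cl) auto
    then have eq: "tensor_g (T.cl ({#(a i, v i / g)#} + ?X))
        = tensor_g (pt (a i) (v i / g)) \<oplus>\<^bsub>PP\<^esub> tensor_g (T.cl ?X)"
      using tensor_g_add[OF c] by simp
    have "W.rel ({#(res (a i), tay (v i))#} + (\<Sum>i\<in>F. {#(res (a i), tay (v i))#}))
      ({#(res 1, tensor_g (pt (a i) (v i / g)))#} + {#(res 1, tensor_g (T.cl ?X))#})"
      using tensor_g_pt[OF a vi(1)] vi(2) IH(1) by (intro tensor_rel.add) auto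
    from tensor_rel.trans[OF this tensor_rel.sym[OF W_add[OF tensor_g_in[OF c(1)] tensor_g_in[OF c(2)]]]]
    show ?case using insert(1,2) IH(2) a vi(1) by (simp add: eq[simplified])
  qed
  from this[OF Q_finite order.refl]
  have "W.rel (\<Sum>i\<in>Q. {#(res (a i), tay (v i))#}) {#}"
    using fibre_null_rel[OF null] tensor_rel.trans by blast
  then have "W.rel (img (nf a)) (img {#})"
    unfolding nf_def image_mset_sum by simp
  then have "taylor_fibre kk alg Lm l (S.cl (nf a)) = taylor_fibre kk alg Lm l (S.cl {#})"
    using nf_formal[OF a] by (simp add: taylor_fibre_cl W.cl_eqI)
  then have "S.cl (nf a) = S.cl {#}"
    using inj_onD[OF inj] S.cl_in_carrier[OF nf_formal[OF a]] S.cl_in_carrier[of "{#}"]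
    unfolding fibre_source_eq by simp
  then have "S.rel (nf a) {#}" using S.cl_eq_iff[OF nf_formal[OF a]] by simp
  from nf_not_zero[OF this a i(1)] i(2) show False by simp
qed

end

section \<open>Taylor expansion in coordinates\<close>

text \<open>Generalised distributivity, used to multiply out the expansions of all coordinates at
  once. In the inductive step the choice functions are split by their value at the new
  index.\<close>

lemma (in cring) finprod_finsum:
  assumes "finite E" "\<And>e. e \<in> E \<Longrightarrow> finite (S e)"
    and "\<And>e j. e \<in> E \<Longrightarrow> j \<in> S e \<Longrightarrow> f e j \<in> carrier R"
  shows "(\<Otimes>e\<in>E. \<Oplus>j\<in>S e. f e j) = (\<Oplus>\<alpha>\<in>PiE E S. \<Otimes>e\<in>E. f e (\<alpha> e))"
  using assms
proof (induction E rule: finite_induct)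
  case empty
  then show ?case by (simp add: finsum_insert)
next
  case (insert e E)
  have fin: "finite (PiE E S)" using insert by (intro finite_PiE) auto
  have c: "(\<Otimes>e\<in>E. f e (\<alpha> e)) \<in> carrier R" if "\<alpha> \<in> PiE E S" for \<alpha>
    using that insert by (intro finprod_closed) (auto simp: PiE_def Pi_def)
  have upd: "(\<Otimes>e'\<in>insert e E. f e' ((\<alpha>(e := j)) e')) = f e j \<otimes> (\<Otimes>e\<in>E. f e (\<alpha> e))"
    if "\<alpha> \<in> PiE E S" "j \<in> S e" for \<alpha> j
  proof -
    have "(\<Otimes>e'\<in>E. f e' ((\<alpha>(e := j)) e')) = (\<Otimes>e\<in>E. f e (\<alpha> e))"
      using that insert by (intro finprod_cong') (auto simp: PiE_def Pi_def)
    moreover have "(\<lambda>e'. f e' ((\<alpha>(e := j)) e')) \<in> E \<rightarrow> carrier R"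
      using that insert by (auto simp: PiE_def Pi_def)
    ultimately show ?thesis using that insert by (subst finprod_insert) auto
  qed
  have PiE: "PiE (insert e E) S = (\<Union>j\<in>S e. (\<lambda>\<alpha>. \<alpha>(e := j)) ` PiE E S)"
    by (auto simp: PiE_insert_eq)
  have inj: "inj_on (\<lambda>\<alpha>. \<alpha>(e := j)) (PiE E S)" for j
    using insert(2) by (auto intro!: inj_onI simp: fun_eq_iff PiE_def extensional_def) metis
  have disj: "(\<lambda>\<alpha>. \<alpha>(e := j)) ` PiE E S \<inter> (\<lambda>\<alpha>. \<alpha>(e := j')) ` PiE E S = {}" if "j \<noteq> j'" for j j'
    using that by (auto dest: fun_cong[of _ _ e])
  have cl: "(\<Otimes>e'\<in>insert e E. f e' (\<beta> e')) \<in> carrier R"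
    if "\<beta> \<in> (\<lambda>\<alpha>. \<alpha>(e := j)) ` PiE E S" "j \<in> S e" for \<beta> j
    using that upd c insert by auto
  have "(\<Oplus>\<alpha>\<in>PiE (insert e E) S. \<Otimes>e\<in>insert e E. f e (\<alpha> e))
      = (\<Oplus>j\<in>S e. \<Oplus>\<alpha>\<in>(\<lambda>\<alpha>. \<alpha>(e := j)) ` PiE E S. \<Otimes>e\<in>insert e E. f e (\<alpha> e))"
    unfolding PiE
  proof (rule add.finprod_UN_disjoint)
    show "pairwise (\<lambda>i j. disjnt ((\<lambda>\<alpha>. \<alpha>(e := i)) ` PiE E S) ((\<lambda>\<alpha>. \<alpha>(e := j)) ` PiE E S)) (S e)"
      using disj by (auto simp: pairwise_def disjnt_def)
  qed (use fin insert cl in auto)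
  also have "\<dots> = (\<Oplus>j\<in>S e. f e j \<otimes> (\<Oplus>\<alpha>\<in>PiE E S. \<Otimes>e\<in>E. f e (\<alpha> e)))"
  proof (rule finsum_cong')
    fix j assume j: "j \<in> S e"
    have "(\<Oplus>\<alpha>\<in>(\<lambda>\<alpha>. \<alpha>(e := j)) ` PiE E S. \<Otimes>e\<in>insert e E. f e (\<alpha> e))
        = (\<Oplus>\<alpha>\<in>PiE E S. \<Otimes>e'\<in>insert e E. f e' ((\<alpha>(e := j)) e'))"
      using cl j by (intro finsum_reindex inj) auto
    also have "\<dots> = (\<Oplus>\<alpha>\<in>PiE E S. f e j \<otimes> (\<Otimes>e\<in>E. f e (\<alpha> e)))"
      using upd[OF _ j] c j insert by (intro finsum_cong') auto
    also have "\<dots> = f e j \<otimes> (\<Oplus>\<alpha>\<in>PiE E S. \<Otimes>e\<in>E. f e (\<alpha> e))"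
      using c j insert fin by (intro finsum_rdistr[symmetric]) auto
    finally show "(\<Oplus>\<alpha>\<in>(\<lambda>\<alpha>. \<alpha>(e := j)) ` PiE E S. \<Otimes>e\<in>insert e E. f e (\<alpha> e))
        = f e j \<otimes> (\<Oplus>\<alpha>\<in>PiE E S. \<Otimes>e\<in>E. f e (\<alpha> e))" .
  qed (use insert c in auto)
  also have "\<dots> = (\<Oplus>j\<in>S e. f e j) \<otimes> (\<Oplus>\<alpha>\<in>PiE E S. \<Otimes>e\<in>E. f e (\<alpha> e))"
    using insert c by (intro finsum_ldistr[symmetric]) auto
  also have "\<dots> = (\<Otimes>e\<in>insert e E. \<Oplus>j\<in>S e. f e j)"
    using insert by (subst finprod_insert) auto
  finally show ?case by simp
qed

section \<open>Local algebras with coordinates and dual derivations\<close>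

locale coordinate_algebra = local_subalgebra cst A
  for cst :: "'k::field_char_0 \<Rightarrow> 'f::field" and A :: "'f set" +
  fixes B :: "'e set" and x :: "'e \<Rightarrow> 'f" and der :: "'e \<Rightarrow> 'f \<Rightarrow> 'f"
  assumes B_finite: "finite B" and x_in: "\<And>e. e \<in> B \<Longrightarrow> x e \<in> A"
    and der_lin: "\<And>e. e \<in> B \<Longrightarrow> lin (der e)"
    and der_mult: "\<And>e a b. e \<in> B \<Longrightarrow> a \<in> A \<Longrightarrow> b \<in> A \<Longrightarrow> der e (a * b) = a * der e b + der e a * b"
    and der_x: "\<And>e e'. e \<in> B \<Longrightarrow> e' \<in> B \<Longrightarrow> der e (x e') = (if e = e' then 1 else 0)"
begin

definition mon :: "('e \<Rightarrow> nat) \<Rightarrow> 'f" where "mon p = (\<Prod>e\<in>B. x e ^ p e)"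

text \<open>The coefficient of y^\<alpha> in the expansion of \<open>mon p\<close> at x + y. If some
  \<alpha> e exceeds \<open>p e\<close>, the binomial coefficient is 0 and the truncated difference
  in the exponent does no harm.\<close>

definition tc :: "('e \<Rightarrow> nat) \<Rightarrow> ('e \<Rightarrow> nat) \<Rightarrow> 'f"
  where "tc p \<alpha> = (\<Prod>e\<in>B. of_nat (p e choose \<alpha> e) * x e ^ (p e - \<alpha> e))"

definition deg :: "('e \<Rightarrow> nat) \<Rightarrow> nat" where "deg \<alpha> = (\<Sum>e\<in>B. \<alpha> e)"

lemma mon_in: "mon p \<in> A" unfolding mon_def by (intro A_prod A_power x_in)

lemma tc_in: "tc p \<alpha> \<in> A" unfolding tc_def by (intro A_prod A_mult A_of_nat A_power x_in)

lemma der_cst_mult: "e \<in> B \<Longrightarrow> a \<in> A \<Longrightarrow> der e (cst c * a) = cst c * der e a"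
  using der_lin by (simp add: lin_def)

lemma der_of_nat_mult: "e \<in> B \<Longrightarrow> a \<in> A \<Longrightarrow> der e (of_nat n * a) = of_nat n * der e a"
  using der_cst_mult[of e a "of_nat n"] by (simp add: cst_of_nat)

lemma der_one: "e \<in> B \<Longrightarrow> der e 1 = 0"
  using der_mult[of e 1 1] A_1 by (metis add_cancel_left_left mult_1 mult_1_right)

lemma der_power: "e \<in> B \<Longrightarrow> e' \<in> B \<Longrightarrow> der e (x e' ^ n) = (if e = e' then of_nat n * x e ^ (n - 1) else 0)"
proof (induction n)
  case (Suc n)
  then have "der e (x e' * x e' ^ n) = x e' * der e (x e' ^ n) + der e (x e') * x e' ^ n"
    by (intro der_mult) (auto intro: x_in A_power)
  with Suc show ?case by (cases n) (auto simp: der_x algebra_simps)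
qed (simp add: der_one)

lemma der_prod_zero: "e \<in> B \<Longrightarrow> (\<And>i. i \<in> F \<Longrightarrow> f i \<in> A \<and> der e (f i) = 0) \<Longrightarrow> der e (prod f F) = 0"
  by (induction F rule: infinite_finite_induct) (auto simp: der_one der_mult A_prod)

text \<open>\<open>f\<close> collects factors that are constant for \<open>der e\<close>. The scalar
  is a falling factorial, written as k! times a binomial coefficient so that k! can be divided out
  later.\<close>

lemma der_iterate:
  assumes e: "e \<in> B" and f: "f \<in> A" "der e f = 0"
  shows "(der e ^^ k) (x e ^ n * f) = of_nat (fact k * (n choose k)) * x e ^ (n - k) * f"
proof (induction k)
  case (Suc k)
  have "(der e ^^ Suc k) (x e ^ n * f) = der e (of_nat (fact k * (n choose k)) * (x e ^ (n - k) * f))"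
    using Suc by (simp add: mult.assoc)
  also have "\<dots> = of_nat (fact k * (n choose k)) * der e (x e ^ (n - k) * f)"
    using e f x_in by (intro der_of_nat_mult) (auto intro: A_mult A_power)
  also have "der e (x e ^ (n - k) * f) = of_nat (n - k) * x e ^ (n - Suc k) * f"
    using e f x_in by (subst der_mult) (auto simp: der_power intro: A_power)
  also have "of_nat (fact k * (n choose k)) * (of_nat (n - k) * x e ^ (n - Suc k) * f)
      = of_nat (fact k * ((n - k) * (n choose k))) * x e ^ (n - Suc k) * f"
    by (simp only: of_nat_mult mult_ac)
  also have "fact k * ((n - k) * (n choose k)) = fact (Suc k) * (n choose Suc k)"
  proof (cases "k \<le> n")
    case True
    have "(n - k) * (n choose k) = Suc k * (n choose Suc k)"
      using binomial_absorption[of k n] binomial_absorb_comp[of n k] by metis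
    then show ?thesis by (simp only: fact_Suc of_nat_id mult_ac)
  qed simp
  finally show ?case .
qed simp

text \<open>Iterated derivations composed along an enumeration of the coordinates, so that nothing
  has to be known about how they commute.\<close>

primrec Dop :: "'e list \<Rightarrow> ('e \<Rightarrow> nat) \<Rightarrow> 'f \<Rightarrow> 'f"
  where
    "Dop [] \<alpha> a = a"
  | "Dop (e # es) \<alpha> a = Dop es \<alpha> ((der e ^^ \<alpha> e) a)"

lemma diff_op_iterate:
  assumes "e \<in> B" "diff_op l D"
  shows "diff_op (k + l) (\<lambda>a. D ((der e ^^ k) a))"
proof (induction k)
  case (Suc k)
  have "diff_op (Suc (k + l)) (\<lambda>a. D ((der e ^^ k) (der e a)))"
    using der_lin der_mult assms by (intro diff_op_derivation[OF _ _ Suc]) auto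
  then show ?case by (simp add: funpow_swap1)
qed (use assms in simp)

lemma diff_op_Dop: "set es \<subseteq> B \<Longrightarrow> diff_op (Suc (\<Sum>e\<leftarrow>es. \<alpha> e)) (Dop es \<alpha>)"
proof (induction es)
  case Nil
  have "Dop [] \<alpha> = (\<lambda>a. a)" by (simp add: fun_eq_iff)
  then show ?case using diff_op_id by simp
next
  case (Cons e es)
  then show ?case using diff_op_iterate[of e "Suc (\<Sum>e\<leftarrow>es. \<alpha> e)" "Dop es \<alpha>" "\<alpha> e"] by simp
qed

text \<open>The factor \<open>w\<close> accumulates the coordinates already differentiated, which
  are constants for all remaining derivations.\<close>

lemma Dop_mon:
  assumes "distinct es" "set es \<subseteq> B" "w \<in> A" "\<And>e. e \<in> set es \<Longrightarrow> der e w = 0"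
  shows "Dop es \<alpha> (w * (\<Prod>e\<in>set es. x e ^ p e))
    = w * (\<Prod>e\<in>set es. of_nat (fact (\<alpha> e)) * (of_nat (p e choose \<alpha> e) * x e ^ (p e - \<alpha> e)))"
  using assms
proof (induction es arbitrary: w)
  case (Cons e es)
  define c where "c = (of_nat (fact (\<alpha> e) * (p e choose \<alpha> e)) :: 'f)"
  have e: "e \<in> B" "e \<notin> set es" using Cons.prems by auto
  have "der e (\<Prod>e\<in>set es. x e ^ p e) = 0"
    using Cons.prems by (intro der_prod_zero) (auto simp: der_power intro: A_power x_in)
  moreover have P: "(\<Prod>e\<in>set es. x e ^ p e) \<in> A" using Cons.prems by (intro A_prod A_power x_in) auto
  ultimately have *: "(der e ^^ \<alpha> e) (x e ^ p e * (w * (\<Prod>e\<in>set es. x e ^ p e)))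
      = c * x e ^ (p e - \<alpha> e) * (w * (\<Prod>e\<in>set es. x e ^ p e))"
    unfolding c_def using Cons.prems e by (intro der_iterate) (auto simp: der_mult A_mult)
  have "Dop es \<alpha> ((c * (x e ^ (p e - \<alpha> e) * w)) * (\<Prod>e\<in>set es. x e ^ p e))
    = c * (x e ^ (p e - \<alpha> e) * w) * (\<Prod>e\<in>set es. of_nat (fact (\<alpha> e)) * (of_nat (p e choose \<alpha> e) * x e ^ (p e - \<alpha> e)))"
  proof (rule Cons.IH)
    have xw: "x e ^ (p e - \<alpha> e) * w \<in> A" using Cons.prems e x_in by (intro A_mult A_power) auto
    then show "c * (x e ^ (p e - \<alpha> e) * w) \<in> A" unfolding c_def by (rule A_mult[OF A_of_nat])
    fix e' assume e': "e' \<in> set es"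
    then have "e' \<in> B" "e' \<noteq> e" using Cons.prems by auto
    then have "der e' (x e ^ (p e - \<alpha> e) * w) = 0"
      using Cons.prems e e' x_in by (subst der_mult) (auto simp: der_power intro: A_power)
    then show "der e' (c * (x e ^ (p e - \<alpha> e) * w)) = 0"
      unfolding c_def using xw \<open>e' \<in> B\<close> by (subst der_of_nat_mult) auto
  qed (use Cons.prems in auto)
  with * e show ?case by (simp add: c_def mult_ac)
qed simp

lemma diff_op_Suc: "diff_op l D \<Longrightarrow> diff_op (Suc l) D"
proof (induction l arbitrary: D)
  case 0
  then have "lin D" by (rule diff_op_lin)
  with 0 show ?case by (simp add: diff_op.simps A_mult)
next
  case (Suc l)
  then have "lin D" "\<forall>b\<in>A. diff_op l (\<lambda>a. D (b * a) - b * D a)" by (auto simp: diff_op.simps)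
  with Suc.IH have "\<forall>b\<in>A. diff_op (Suc l) (\<lambda>a. D (b * a) - b * D a)" by blast
  then show ?case using \<open>lin D\<close> by (subst diff_op.simps(2)) blast
qed

lemma diff_op_mono: "l \<le> l' \<Longrightarrow> diff_op l D \<Longrightarrow> diff_op l' D"
  by (induction rule: dec_induct) (auto intro: diff_op_Suc)

lemma ex_diff_op:
  assumes "deg \<alpha> \<le> l"
  obtains D c where "diff_op (Suc l) D" "c \<noteq> 0" "\<And>p. D (mon p) = cst c * tc p \<alpha>"
proof -
  obtain es where es: "set es = B" "distinct es" using finite_distinct_list[OF B_finite] by blast
  have "(\<Sum>e\<leftarrow>es. \<alpha> e) = deg \<alpha>" unfolding deg_def using es by (simp add: sum_list_distinct_conv_sum_set)
  then have 1: "diff_op (Suc l) (Dop es \<alpha>)"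
    using diff_op_Dop[of es \<alpha>] es assms diff_op_mono[of "Suc (deg \<alpha>)" "Suc l"] by simp
  \<comment> \<open>In characteristic 0 this product of factorials is invertible, so the divided
    derivative is a k-multiple of the iterated one.\<close>
  define c where "c = (of_nat (\<Prod>e\<in>B. fact (\<alpha> e)) :: 'k)"
  have 2: "c \<noteq> 0" unfolding c_def of_nat_eq_0_iff using B_finite by (simp add: prod_zero_iff)
  have "Dop es \<alpha> (mon p) = cst c * tc p \<alpha>" for p
    using Dop_mon[OF es(2), of 1 \<alpha> p] es(1) der_one A_1
    unfolding c_def cst_of_nat mon_def tc_def by (simp add: prod.distrib)
  with 1 2 show thesis by (rule that)
qed

section \<open>Expansion of monomials in powers of y = 1 \<otimes> x - x \<otimes> 1\<close>

abbreviation yy :: "'e \<Rightarrow> ('f \<times> 'f) multiset set"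
  where "yy e \<equiv> pt 1 (x e) \<ominus>\<^bsub>TT\<^esub> pt (x e) 1"

lemma yy_I: "e \<in> B \<Longrightarrow> yy e \<in> I"
proof -
  assume e: "e \<in> B"
  have c: "pt 1 (x e) \<in> carrier TT" "pt (x e) 1 \<in> carrier TT" "pt (- x e) 1 \<in> carrier TT"
    using e by (auto intro!: pt_carrier x_in A_1 A_uminus)
  have "pt (x e) 1 \<oplus>\<^bsub>TT\<^esub> pt (- x e) 1 = \<zero>\<^bsub>TT\<^esub>"
    using pt_add_left[of "x e" "- x e" 1] x_in[OF e] by (simp add: A_uminus A_1 pt_zero)
  then have "\<ominus>\<^bsub>TT\<^esub> pt (x e) 1 = pt (- x e) 1" using c by (metis TT.minus_equality TT.a_comm)
  then have "yy e = T.cl ({#(1, x e)#} + {#(- x e, 1)#})"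
    using x_in[OF e] by (simp add: TT.minus_eq T.add_cl A_1 A_uminus)
  moreover have f: "T.formal ({#(1, x e)#} + {#(- x e, 1)#})" using x_in[OF e] by (simp add: A_1 A_uminus)
  ultimately show ?thesis using T.cl_in_carrier[OF f] mu_cl[OF f] by (simp add: I_iff)
qed

lemma yy_carrier: "e \<in> B \<Longrightarrow> yy e \<in> carrier TT"
  using yy_I I_iff by blast

lemma J_mult: "s \<in> J i \<Longrightarrow> t \<in> J j \<Longrightarrow> s \<otimes>\<^bsub>TT\<^esub> t \<in> J (i + j)"
proof (induction j arbitrary: s t)
  case 0
  then show ?case using ideal.I_r_closed[OF J_ideal] by (simp add: ideal_power.simps)
next
  case (Suc j)
  from Suc.prems(2) have "t \<in> ideal_prod TT (J j) I" by (simp add: ideal_power.simps)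
  then show ?case
  proof induction
    case (prod u w)
    have c: "s \<in> carrier TT" "u \<in> carrier TT" "w \<in> carrier TT"
      using Suc.prems(1) prod ideal.Icarr[OF J_ideal] ideal.Icarr[OF I_ideal] by blast+
    have "(s \<otimes>\<^bsub>TT\<^esub> u) \<otimes>\<^bsub>TT\<^esub> w \<in> ideal_prod TT (J (i + j)) I"
      by (intro ideal_prod.prod Suc.IH prod Suc.prems)
    then show ?case using c by (simp add: ideal_power.simps TT.m_assoc)
  next
    case (sum u w)
    have c: "s \<in> carrier TT" "u \<in> carrier TT" "w \<in> carrier TT"
      using Suc.prems(1) sum ideal.Icarr[OF J_ideal] ideal.Icarr[OF TT.ideal_prod_is_ideal[OF J_ideal I_ideal]]
      by blast+
    then show ?case using additive_subgroup.a_closed[OF ideal.axioms(1)[OF J_ideal]] sum by (simp add: TT.r_distr)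
  qed
qed

lemma J_power: "s \<in> I \<Longrightarrow> s [^]\<^bsub>TT\<^esub> n \<in> J n" for n :: nat
proof (induction n)
  case (Suc n)
  then show ?case by (simp add: ideal_power.simps ideal_prod.prod)
qed (simp add: ideal_power.simps)

lemma J_monomial: "F \<subseteq> B \<Longrightarrow> (\<Otimes>\<^bsub>TT\<^esub>e\<in>F. yy e [^]\<^bsub>TT\<^esub> \<alpha> e) \<in> J (\<Sum>e\<in>F. \<alpha> e)"
proof -
  assume F: "F \<subseteq> B"
  then have "finite F" using B_finite finite_subset by blast
  then show ?thesis using F
  proof (induction F rule: finite_induct)
    case (insert e F)
    then show ?case using J_mult[OF J_power[OF yy_I[of e]]]
      by (subst TT.finprod_insert) (auto simp: yy_carrier)
  qed (simp add: ideal_power.simps)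
qed

text \<open>The binomial theorem for 1 \<otimes> x = x \<otimes> 1 + y. Any bound
  \<open>N >= n\<close> is allowed, the extra terms being 0, so that sections with different
  exponents can be summed over one common box.\<close>

lemma binomial_expansion:
  assumes e: "e \<in> B"
  shows "n \<le> N \<Longrightarrow> pt 1 (x e) [^]\<^bsub>TT\<^esub> n
    = (\<Oplus>\<^bsub>TT\<^esub>j\<in>{..N}. pt (of_nat (n choose j) * x e ^ (n - j)) 1 \<otimes>\<^bsub>TT\<^esub> yy e [^]\<^bsub>TT\<^esub> j)"
proof (induction n arbitrary: N)
  have xA: "x e \<in> A" by (rule x_in[OF e])
  define t where "t n j = pt (of_nat (n choose j) * x e ^ (n - j)) 1 \<otimes>\<^bsub>TT\<^esub> yy e [^]\<^bsub>TT\<^esub> j" for n j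
  have coef: "of_nat (n choose j) * x e ^ m \<in> A" for n j m by (intro A_mult A_of_nat A_power xA)
  have tc: "t n j \<in> carrier TT" for n j unfolding t_def
    by (intro TT.m_closed TT.nat_pow_closed pt_carrier yy_carrier e coef A_1)
  have c: "pt 1 (x e) \<in> carrier TT" "pt (x e) 1 \<in> carrier TT" "yy e \<in> carrier TT"
    using xA by (auto intro!: pt_carrier A_1 yy_carrier e)
  have sumx: "pt 1 (x e) = pt (x e) 1 \<oplus>\<^bsub>TT\<^esub> yy e"
    using c(1,2) by (simp add: TT.minus_eq TT.a_ac TT.r_neg TT.r_neg1)
  have mult_step: "(s \<otimes>\<^bsub>TT\<^esub> a \<oplus>\<^bsub>TT\<^esub> b) \<otimes>\<^bsub>TT\<^esub> y [^]\<^bsub>TT\<^esub> Suc j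
      = s \<otimes>\<^bsub>TT\<^esub> (a \<otimes>\<^bsub>TT\<^esub> y [^]\<^bsub>TT\<^esub> Suc j) \<oplus>\<^bsub>TT\<^esub> y \<otimes>\<^bsub>TT\<^esub> (b \<otimes>\<^bsub>TT\<^esub> y [^]\<^bsub>TT\<^esub> j)"
    if "s \<in> carrier TT" "a \<in> carrier TT" "b \<in> carrier TT" "y \<in> carrier TT" for s a b y and j :: nat
    using that by (simp add: TT.l_distr TT.r_distr TT.m_ac)
  {
    case 0
    have t0: "t 0 j = (if j = 0 then \<one>\<^bsub>TT\<^esub> else \<zero>\<^bsub>TT\<^esub>)" for j
    proof (cases j)
      case 0
      then have "t 0 j = pt 1 1 \<otimes>\<^bsub>TT\<^esub> \<one>\<^bsub>TT\<^esub>" by (simp add: t_def)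
      with 0 show ?thesis by (simp only: one_cl[symmetric]) simp
    next
      case (Suc i)
      then have "t 0 j = \<zero>\<^bsub>TT\<^esub> \<otimes>\<^bsub>TT\<^esub> yy e [^]\<^bsub>TT\<^esub> j" by (simp add: t_def pt_zero A_1)
      with Suc c(3) show ?thesis by simp
    qed
    have "(\<Oplus>\<^bsub>TT\<^esub>j\<in>{..N}. t 0 j) = (\<Oplus>\<^bsub>TT\<^esub>j\<in>{..N}. if j = 0 then \<one>\<^bsub>TT\<^esub> else \<zero>\<^bsub>TT\<^esub>)"
      by (intro TT.finsum_cong') (auto simp: t0)
    also have "\<dots> = \<one>\<^bsub>TT\<^esub>" using TT.finsum_singleton[of 0 "{..N}" "\<lambda>_. \<one>\<^bsub>TT\<^esub>"] by (simp add: eq_commute)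
    finally show ?case by (simp add: t_def)
  next
    case (Suc n)
    then obtain M where N: "N = Suc M" "n \<le> M" by (metis Suc_le_D Suc_le_mono)
    \<comment> \<open>Pascal's rule; it holds for all \<open>j\<close>, also beyond
      \<open>n\<close>, where the binomial coefficients vanish.\<close>
    have step: "t (Suc n) (Suc j) = pt (x e) 1 \<otimes>\<^bsub>TT\<^esub> t n (Suc j) \<oplus>\<^bsub>TT\<^esub> yy e \<otimes>\<^bsub>TT\<^esub> t n j" for j
    proof -
      have "of_nat (Suc n choose Suc j) * x e ^ (Suc n - Suc j)
          = x e * (of_nat (n choose Suc j) * x e ^ (n - Suc j)) + of_nat (n choose j) * x e ^ (n - j)"
      proof (cases "Suc j \<le> n")
        case True
        then have "n - j = Suc (n - Suc j)" by simp
        then show ?thesis by (simp add: algebra_simps)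
      next
        case False
        then have "n < Suc j" by simp
        then show ?thesis by (simp add: binomial_eq_0)
      qed
      then have "t (Suc n) (Suc j) = (pt (x e * (of_nat (n choose Suc j) * x e ^ (n - Suc j))) 1
          \<oplus>\<^bsub>TT\<^esub> pt (of_nat (n choose j) * x e ^ (n - j)) 1) \<otimes>\<^bsub>TT\<^esub> yy e [^]\<^bsub>TT\<^esub> Suc j"
        using coef xA by (simp add: t_def pt_add_left A_mult A_1)
      also have "pt (x e * (of_nat (n choose Suc j) * x e ^ (n - Suc j))) 1
          = pt (x e) 1 \<otimes>\<^bsub>TT\<^esub> pt (of_nat (n choose Suc j) * x e ^ (n - Suc j)) 1"
        using coef xA by (simp add: pt_mult A_1)
      finally show ?thesis
        unfolding t_def using xA c(3) by (subst (asm) mult_step) (auto intro!: pt_carrier coef A_1)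
    qed
    have first: "t (Suc n) 0 = pt (x e) 1 \<otimes>\<^bsub>TT\<^esub> t n 0"
      using xA by (simp add: t_def pt_mult pt_carrier A_1 A_power A_mult)
    have "(\<Oplus>\<^bsub>TT\<^esub>j\<in>{..N}. t (Suc n) j) = (\<Oplus>\<^bsub>TT\<^esub>j\<in>{..M}. t (Suc n) (Suc j)) \<oplus>\<^bsub>TT\<^esub> t (Suc n) 0"
      unfolding N using tc by (intro TT.finsum_Suc2) auto
    also have "(\<Oplus>\<^bsub>TT\<^esub>j\<in>{..M}. t (Suc n) (Suc j))
        = (\<Oplus>\<^bsub>TT\<^esub>j\<in>{..M}. pt (x e) 1 \<otimes>\<^bsub>TT\<^esub> t n (Suc j)) \<oplus>\<^bsub>TT\<^esub> (\<Oplus>\<^bsub>TT\<^esub>j\<in>{..M}. yy e \<otimes>\<^bsub>TT\<^esub> t n j)"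
      unfolding step using tc c by (intro TT.finsum_addf) auto
    also have "(\<Oplus>\<^bsub>TT\<^esub>j\<in>{..M}. pt (x e) 1 \<otimes>\<^bsub>TT\<^esub> t n (Suc j)) = pt (x e) 1 \<otimes>\<^bsub>TT\<^esub> (\<Oplus>\<^bsub>TT\<^esub>j\<in>{..M}. t n (Suc j))"
      using tc c by (intro TT.finsum_rdistr[symmetric]) auto
    also have "(\<Oplus>\<^bsub>TT\<^esub>j\<in>{..M}. yy e \<otimes>\<^bsub>TT\<^esub> t n j) = yy e \<otimes>\<^bsub>TT\<^esub> (\<Oplus>\<^bsub>TT\<^esub>j\<in>{..M}. t n j)"
      using tc c by (intro TT.finsum_rdistr[symmetric]) auto
    also have "(\<Oplus>\<^bsub>TT\<^esub>j\<in>{..M}. t n j) = pt 1 (x e) [^]\<^bsub>TT\<^esub> n" using Suc.IH[OF N(2)] by (simp add: t_def)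
    finally have "(\<Oplus>\<^bsub>TT\<^esub>j\<in>{..N}. t (Suc n) j)
        = pt (x e) 1 \<otimes>\<^bsub>TT\<^esub> ((\<Oplus>\<^bsub>TT\<^esub>j\<in>{..M}. t n (Suc j)) \<oplus>\<^bsub>TT\<^esub> t n 0) \<oplus>\<^bsub>TT\<^esub> yy e \<otimes>\<^bsub>TT\<^esub> pt 1 (x e) [^]\<^bsub>TT\<^esub> n"
      using tc c TT.finsum_closed[of "\<lambda>j. t n (Suc j)" "{..M}"] unfolding first
      by (simp add: TT.r_distr TT.a_ac)
    also have "(\<Oplus>\<^bsub>TT\<^esub>j\<in>{..M}. t n (Suc j)) \<oplus>\<^bsub>TT\<^esub> t n 0 = (\<Oplus>\<^bsub>TT\<^esub>j\<in>{..N}. t n j)"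
      unfolding N using tc by (intro TT.finsum_Suc2[symmetric]) auto
    also have "\<dots> = pt 1 (x e) [^]\<^bsub>TT\<^esub> n" using Suc.IH[of N] N by (simp add: t_def)
    also have "pt (x e) 1 \<otimes>\<^bsub>TT\<^esub> pt 1 (x e) [^]\<^bsub>TT\<^esub> n \<oplus>\<^bsub>TT\<^esub> yy e \<otimes>\<^bsub>TT\<^esub> pt 1 (x e) [^]\<^bsub>TT\<^esub> n
        = (pt (x e) 1 \<oplus>\<^bsub>TT\<^esub> yy e) \<otimes>\<^bsub>TT\<^esub> pt 1 (x e) [^]\<^bsub>TT\<^esub> n"
      using c by (simp add: TT.l_distr)
    also have "\<dots> = pt 1 (x e) [^]\<^bsub>TT\<^esub> Suc n"
      unfolding sumx[symmetric] using c by (simp add: TT.m_comm)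
    finally show ?case by (simp add: t_def)
  }
qed

lemma pt_power: "a \<in> A \<Longrightarrow> pt 1 (a ^ n) = pt 1 a [^]\<^bsub>TT\<^esub> n"
proof (induction n)
  case (Suc n)
  have "pt 1 (a ^ Suc n) = pt 1 (a ^ n) \<otimes>\<^bsub>TT\<^esub> pt 1 a"
    using Suc.prems by (simp add: pt_mult A_1 A_power mult.commute)
  also have "\<dots> = pt 1 a [^]\<^bsub>TT\<^esub> Suc n" using Suc by simp
  finally show ?case .
qed (simp add: one_cl)

lemma monomial_expansion:
  assumes N: "\<And>e. e \<in> B \<Longrightarrow> p e \<le> N"
  shows "pt 1 (mon p) = (\<Oplus>\<^bsub>TT\<^esub>\<alpha>\<in>PiE B (\<lambda>_. {..N}). pt (tc p \<alpha>) 1 \<otimes>\<^bsub>TT\<^esub> (\<Otimes>\<^bsub>TT\<^esub>e\<in>B. yy e [^]\<^bsub>TT\<^esub> \<alpha> e))"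
proof -
  have coef: "of_nat (n choose j) * x e ^ m \<in> A" if "e \<in> B" for n j m e
    using that by (intro A_mult A_of_nat A_power x_in)
  define t where "t e j = pt (of_nat (p e choose j) * x e ^ (p e - j)) 1 \<otimes>\<^bsub>TT\<^esub> yy e [^]\<^bsub>TT\<^esub> j" for e j
  have t: "t e j \<in> carrier TT" if "e \<in> B" for e j unfolding t_def
    using that by (intro TT.m_closed TT.nat_pow_closed pt_carrier yy_carrier coef A_1)
  have prod1: "pt 1 (\<Prod>e\<in>F. x e ^ p e) = (\<Otimes>\<^bsub>TT\<^esub>e\<in>F. pt 1 (x e) [^]\<^bsub>TT\<^esub> p e)"
    if "finite F" "F \<subseteq> B" for F
    using that
  proof (induction F rule: finite_induct)
    case (insert e F)
    have "pt 1 (x e ^ p e * (\<Prod>e\<in>F. x e ^ p e)) = pt 1 (x e ^ p e) \<otimes>\<^bsub>TT\<^esub> pt 1 (\<Prod>e\<in>F. x e ^ p e)"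
      using insert x_in by (subst pt_mult) (auto intro!: A_1 A_power A_prod)
    also have "pt 1 (x e ^ p e) = pt 1 (x e) [^]\<^bsub>TT\<^esub> p e" using insert x_in by (simp add: pt_power)
    also have "pt 1 (\<Prod>e\<in>F. x e ^ p e) = (\<Otimes>\<^bsub>TT\<^esub>e\<in>F. pt 1 (x e) [^]\<^bsub>TT\<^esub> p e)" using insert by simp
    also have "pt 1 (x e) [^]\<^bsub>TT\<^esub> p e \<otimes>\<^bsub>TT\<^esub> \<dots> = (\<Otimes>\<^bsub>TT\<^esub>e\<in>insert e F. pt 1 (x e) [^]\<^bsub>TT\<^esub> p e)"
      using insert x_in by (intro TT.finprod_insert[symmetric]) (auto intro!: TT.nat_pow_closed pt_carrier A_1)
    finally show ?case using insert(1,2) by simp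
  qed (simp add: one_cl)
  have prod2: "(\<Otimes>\<^bsub>TT\<^esub>e\<in>F. t e (\<alpha> e)) = pt (\<Prod>e\<in>F. of_nat (p e choose \<alpha> e) * x e ^ (p e - \<alpha> e)) 1
      \<otimes>\<^bsub>TT\<^esub> (\<Otimes>\<^bsub>TT\<^esub>e\<in>F. yy e [^]\<^bsub>TT\<^esub> \<alpha> e)" if "finite F" "F \<subseteq> B" for F \<alpha>
    using that
  proof (induction F rule: finite_induct)
    case (insert e F)
    let ?c = "\<lambda>e. of_nat (p e choose \<alpha> e) * x e ^ (p e - \<alpha> e)"
    have c: "?c e \<in> A" "prod ?c F \<in> A" using insert coef by (auto intro!: A_prod)
    have y: "yy e [^]\<^bsub>TT\<^esub> \<alpha> e \<in> carrier TT" "(\<Otimes>\<^bsub>TT\<^esub>e\<in>F. yy e [^]\<^bsub>TT\<^esub> \<alpha> e) \<in> carrier TT"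
      using insert yy_carrier by (auto intro!: TT.finprod_closed)
    have 1: "(\<Otimes>\<^bsub>TT\<^esub>e\<in>insert e F. t e (\<alpha> e)) = t e (\<alpha> e) \<otimes>\<^bsub>TT\<^esub> (\<Otimes>\<^bsub>TT\<^esub>e\<in>F. t e (\<alpha> e))"
      using insert t by (intro TT.finprod_insert) auto
    have 2: "(\<Otimes>\<^bsub>TT\<^esub>e\<in>insert e F. yy e [^]\<^bsub>TT\<^esub> \<alpha> e)
        = yy e [^]\<^bsub>TT\<^esub> \<alpha> e \<otimes>\<^bsub>TT\<^esub> (\<Otimes>\<^bsub>TT\<^esub>e\<in>F. yy e [^]\<^bsub>TT\<^esub> \<alpha> e)"
      using insert yy_carrier by (intro TT.finprod_insert) auto
    have 3: "pt (prod ?c (insert e F)) 1 = pt (?c e) 1 \<otimes>\<^bsub>TT\<^esub> pt (prod ?c F) 1"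
      using c insert(1,2) by (simp add: pt_mult A_1)
    have IH: "(\<Otimes>\<^bsub>TT\<^esub>e\<in>F. t e (\<alpha> e)) = pt (prod ?c F) 1 \<otimes>\<^bsub>TT\<^esub> (\<Otimes>\<^bsub>TT\<^esub>e\<in>F. yy e [^]\<^bsub>TT\<^esub> \<alpha> e)"
      using insert by simp
    have ac: "(a \<otimes>\<^bsub>TT\<^esub> b) \<otimes>\<^bsub>TT\<^esub> (a' \<otimes>\<^bsub>TT\<^esub> b') = (a \<otimes>\<^bsub>TT\<^esub> a') \<otimes>\<^bsub>TT\<^esub> (b \<otimes>\<^bsub>TT\<^esub> b')"
      if "a \<in> carrier TT" "b \<in> carrier TT" "a' \<in> carrier TT" "b' \<in> carrier TT" for a b a' b'
      using that by (simp add: TT.m_ac)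
    show ?case unfolding 1 2 3 IH unfolding t_def by (rule ac) (intro pt_carrier c A_1 y)+
  qed (simp add: one_cl[symmetric])
  have "pt 1 (mon p) = (\<Otimes>\<^bsub>TT\<^esub>e\<in>B. pt 1 (x e) [^]\<^bsub>TT\<^esub> p e)"
    unfolding mon_def by (rule prod1[OF B_finite order.refl])
  also have "\<dots> = (\<Otimes>\<^bsub>TT\<^esub>e\<in>B. \<Oplus>\<^bsub>TT\<^esub>j\<in>{..N}. t e j)"
    using binomial_expansion[OF _ N] t by (intro TT.finprod_cong') (auto simp: t_def intro!: TT.finsum_closed)
  also have "\<dots> = (\<Oplus>\<^bsub>TT\<^esub>\<alpha>\<in>PiE B (\<lambda>_. {..N}). \<Otimes>\<^bsub>TT\<^esub>e\<in>B. t e (\<alpha> e))"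
    using t B_finite by (intro TT.finprod_finsum) auto
  also have "\<dots> = (\<Oplus>\<^bsub>TT\<^esub>\<alpha>\<in>PiE B (\<lambda>_. {..N}). pt (tc p \<alpha>) 1 \<otimes>\<^bsub>TT\<^esub> (\<Otimes>\<^bsub>TT\<^esub>e\<in>B. yy e [^]\<^bsub>TT\<^esub> \<alpha> e))"
    unfolding prod2[OF B_finite order.refl] tc_def[symmetric]
    using yy_carrier by (intro TT.finsum_cong') (auto intro!: pt_carrier tc_in A_1 TT.finprod_closed)
  finally show ?thesis .
qed

text \<open>The matrix of Taylor coefficients of order at most \<open>l\<close> has trivial kernel
  over the residue field, phrased through representatives in \<open>A\<close>.\<close>

definition crit :: "'i set \<Rightarrow> ('i \<Rightarrow> 'e \<Rightarrow> nat) \<Rightarrow> nat \<Rightarrow> bool"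
  where "crit Q ex l \<longleftrightarrow> (\<forall>a. (\<forall>i. a i \<in> A) \<longrightarrow> (\<forall>\<alpha>. deg \<alpha> \<le> l \<longrightarrow> (\<Sum>i\<in>Q. a i * tc (ex i) \<alpha>) \<in> mm)
    \<longrightarrow> (\<forall>i\<in>Q. a i \<in> mm))"

lemma expansion_sum:
  assumes "finite Q" and a: "\<And>i. a i \<in> A" and N: "\<And>i e. i \<in> Q \<Longrightarrow> e \<in> B \<Longrightarrow> ex i e \<le> N"
  shows "T.cl (\<Sum>i\<in>Q. {#(a i, mon (ex i))#}) = (\<Oplus>\<^bsub>TT\<^esub>\<alpha>\<in>PiE B (\<lambda>_. {..N}).
      pt (\<Sum>i\<in>Q. a i * tc (ex i) \<alpha>) 1 \<otimes>\<^bsub>TT\<^esub> (\<Otimes>\<^bsub>TT\<^esub>e\<in>B. yy e [^]\<^bsub>TT\<^esub> \<alpha> e))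
    \<and> T.formal (\<Sum>i\<in>Q. {#(a i, mon (ex i))#})"
  using assms(1) N
proof (induction Q rule: finite_induct)
  case empty
  have "(\<Oplus>\<^bsub>TT\<^esub>\<alpha>\<in>PiE B (\<lambda>_. {..N}). pt 0 1 \<otimes>\<^bsub>TT\<^esub> (\<Otimes>\<^bsub>TT\<^esub>e\<in>B. yy e [^]\<^bsub>TT\<^esub> \<alpha> e))
    = (\<Oplus>\<^bsub>TT\<^esub>\<alpha>\<in>PiE B (\<lambda>_. {..N}). \<zero>\<^bsub>TT\<^esub>)"
    using yy_carrier by (intro TT.finsum_cong') (auto simp: pt_zero A_1 intro!: TT.l_null TT.finprod_closed)
  also have "\<dots> = \<zero>\<^bsub>TT\<^esub>" by simp
  finally show ?case by (simp add: T.zero_cl[symmetric])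
next
  case (insert i Q)
  define Y where "Y \<alpha> = (\<Otimes>\<^bsub>TT\<^esub>e\<in>B. yy e [^]\<^bsub>TT\<^esub> \<alpha> e)" for \<alpha> :: "'e \<Rightarrow> nat"
  have Y: "Y \<alpha> \<in> carrier TT" for \<alpha> unfolding Y_def using yy_carrier by (intro TT.finprod_closed) auto
  let ?X = "\<Sum>i\<in>Q. {#(a i, mon (ex i))#}"
  let ?s = "\<lambda>\<alpha>. \<Sum>i\<in>Q. a i * tc (ex i) \<alpha>"
  let ?E = "PiE B (\<lambda>_. {..N})"
  have s: "?s \<alpha> \<in> A" for \<alpha> by (intro A_sum A_mult a tc_in)
  have IH: "T.cl ?X = (\<Oplus>\<^bsub>TT\<^esub>\<alpha>\<in>?E. pt (?s \<alpha>) 1 \<otimes>\<^bsub>TT\<^esub> Y \<alpha>)" "T.formal ?X"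
    using insert unfolding Y_def by auto
  have "T.cl ({#(a i, mon (ex i))#} + ?X) = pt (a i) (mon (ex i)) \<oplus>\<^bsub>TT\<^esub> T.cl ?X"
    using IH(2) a mon_in by (subst T.add_cl) auto
  also have "pt (a i) (mon (ex i)) = pt (a i) 1 \<otimes>\<^bsub>TT\<^esub> pt 1 (mon (ex i))"
    using a mon_in by (simp add: pt_mult A_1)
  also have "pt 1 (mon (ex i)) = (\<Oplus>\<^bsub>TT\<^esub>\<alpha>\<in>?E. pt (tc (ex i) \<alpha>) 1 \<otimes>\<^bsub>TT\<^esub> Y \<alpha>)"
    unfolding Y_def using insert.prems by (intro monomial_expansion) auto
  also have "pt (a i) 1 \<otimes>\<^bsub>TT\<^esub> \<dots> = (\<Oplus>\<^bsub>TT\<^esub>\<alpha>\<in>?E. pt (a i) 1 \<otimes>\<^bsub>TT\<^esub> (pt (tc (ex i) \<alpha>) 1 \<otimes>\<^bsub>TT\<^esub> Y \<alpha>))"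
    using Y B_finite by (intro TT.finsum_rdistr) (auto intro!: finite_PiE pt_carrier a tc_in A_1)
  also have "\<dots> \<oplus>\<^bsub>TT\<^esub> T.cl ?X = (\<Oplus>\<^bsub>TT\<^esub>\<alpha>\<in>?E. pt (a i) 1 \<otimes>\<^bsub>TT\<^esub> (pt (tc (ex i) \<alpha>) 1 \<otimes>\<^bsub>TT\<^esub> Y \<alpha>) \<oplus>\<^bsub>TT\<^esub> pt (?s \<alpha>) 1 \<otimes>\<^bsub>TT\<^esub> Y \<alpha>)"
    unfolding IH(1) using Y by (intro TT.finsum_addf[symmetric]) (auto intro!: pt_carrier a tc_in A_1 s)
  also have "\<dots> = (\<Oplus>\<^bsub>TT\<^esub>\<alpha>\<in>?E. pt (a i * tc (ex i) \<alpha> + ?s \<alpha>) 1 \<otimes>\<^bsub>TT\<^esub> Y \<alpha>)"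
  proof (rule TT.finsum_cong')
    fix \<alpha> assume "\<alpha> \<in> ?E"
    have "pt (a i * tc (ex i) \<alpha> + ?s \<alpha>) 1 = pt (a i) 1 \<otimes>\<^bsub>TT\<^esub> pt (tc (ex i) \<alpha>) 1 \<oplus>\<^bsub>TT\<^esub> pt (?s \<alpha>) 1"
      using a tc_in s by (simp add: pt_add_left pt_mult A_1 A_mult)
    then show "pt (a i) 1 \<otimes>\<^bsub>TT\<^esub> (pt (tc (ex i) \<alpha>) 1 \<otimes>\<^bsub>TT\<^esub> Y \<alpha>) \<oplus>\<^bsub>TT\<^esub> pt (?s \<alpha>) 1 \<otimes>\<^bsub>TT\<^esub> Y \<alpha>
        = pt (a i * tc (ex i) \<alpha> + ?s \<alpha>) 1 \<otimes>\<^bsub>TT\<^esub> Y \<alpha>"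
      using Y a tc_in s by (simp add: pt_carrier A_1 TT.l_distr TT.m_assoc)
  qed (use Y in \<open>auto intro!: pt_carrier a tc_in A_1 s A_add A_mult\<close>)
  finally show ?case using insert(1,2) IH(2) a mon_in unfolding Y_def by simp
qed

text \<open>Divided derivatives read off the Taylor coefficients, so \<open>crit\<close> yields
  injectivity. Conversely, a violation of \<open>crit\<close> gives a formal sum whose expansion in
  y has all its terms in \<open>fibre_null\<close>.\<close>

theorem taylor_inj_iff:
  assumes "g \<noteq> 0" "finite Q" and V: "V = range (\<lambda>c. \<Sum>i\<in>Q. cst (c i) * (mon (ex i) * g))"
    and ind: "\<And>c i. (\<Sum>j\<in>Q. cst (c j) * (mon (ex j) * g)) = 0 \<Longrightarrow> i \<in> Q \<Longrightarrow> c i = 0"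
  shows "inj_on (taylor_fibre kk alg (regular_module (ring_on ((\<lambda>f. f * g) ` A))) l)
      (carrier (fibre_source kk alg (regular_module (ring_on ((\<lambda>f. f * g) ` A))) V)) \<longleftrightarrow> crit Q ex l"
proof -
  interpret Y: taylor_map_basis cst A g l Q "\<lambda>i. mon (ex i) * g" V
    by unfold_locales (use assms mon_in in auto)
  have vg: "mon (ex i) * g / g = mon (ex i)" for i using \<open>g \<noteq> 0\<close> by simp
  show ?thesis
  proof
    assume "crit Q ex l"
    show "inj_on (taylor_fibre kk alg Y.Lm l) (carrier (fibre_source kk alg Y.Lm V))"
    proof (rule Y.taylor_fibre_injI)
      fix a i assume a: "\<And>i. a i \<in> A" and i: "i \<in> Q"
        and D: "\<And>D. diff_op (Suc l) D \<Longrightarrow> (\<Sum>i\<in>Q. a i * D (mon (ex i) * g / g)) \<in> mm"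
      have "(\<Sum>i\<in>Q. a i * tc (ex i) \<alpha>) \<in> mm" if deg: "deg \<alpha> \<le> l" for \<alpha>
      proof -
        obtain E c where E: "diff_op (Suc l) E" "c \<noteq> 0" "\<And>p. E (mon p) = cst c * tc p \<alpha>"
          using ex_diff_op[OF deg] by metis
        \<comment> \<open>The operator realises the coefficient only up to the scalar
          \<open>c\<close>, which is now divided out.\<close>
        have "cst (inverse c) * (\<Sum>i\<in>Q. a i * E (mon (ex i))) \<in> mm"
          using D[OF E(1)] unfolding vg by (intro mm_mult cst_in)
        also have "cst (inverse c) * (\<Sum>i\<in>Q. a i * E (mon (ex i)))
            = cst (inverse c * c) * (\<Sum>i\<in>Q. a i * tc (ex i) \<alpha>)"
          unfolding cst_mult by (simp add: E(3) sum_distrib_left mult_ac)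
        finally show ?thesis using E(2) by (simp add: cst_1)
      qed
      then show "a i \<in> mm" using \<open>crit Q ex l\<close> a i unfolding crit_def by blast
    qed
  next
    assume inj: "inj_on (taylor_fibre kk alg Y.Lm l) (carrier (fibre_source kk alg Y.Lm V))"
    show "crit Q ex l"
    proof (rule ccontr)
      assume "\<not> crit Q ex l"
      then obtain a i where a: "\<And>i. a i \<in> A" and i: "i \<in> Q" "a i \<notin> mm"
        and m: "\<And>\<alpha>. deg \<alpha> \<le> l \<Longrightarrow> (\<Sum>i\<in>Q. a i * tc (ex i) \<alpha>) \<in> mm"
        unfolding crit_def by blast
      \<comment> \<open>A common bound for all exponents that occur; the element 0 keeps the maximum
        defined when there are none.\<close>
      define N where "N = Max (insert 0 ((\<lambda>(i, e). ex i e) ` (Q \<times> B)))"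
      have N: "ex i e \<le> N" if "i \<in> Q" "e \<in> B" for i e
        unfolding N_def using assms(2) B_finite that by (intro Max_ge) auto
      \<comment> \<open>Terms of degree at most \<open>l\<close> have their coefficient in
        \<open>mm\<close>; those of higher degree lie in the (l+1)-st power of the diagonal
        ideal.\<close>
      have null: "pt (\<Sum>i\<in>Q. a i * tc (ex i) \<alpha>) 1 \<otimes>\<^bsub>TT\<^esub> (\<Otimes>\<^bsub>TT\<^esub>e\<in>B. yy e [^]\<^bsub>TT\<^esub> \<alpha> e) \<in> Y.fibre_null" for \<alpha>
      proof (cases "deg \<alpha> \<le> l")
        case True
        then show ?thesis using yy_carrier by (intro Y.fibre_null.max m TT.finprod_closed) auto
      next
        case False
        then have "(\<Otimes>\<^bsub>TT\<^esub>e\<in>B. yy e [^]\<^bsub>TT\<^esub> \<alpha> e) \<in> J (Suc l)"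
          using J_monomial[OF order.refl, of \<alpha>] J_antimono[of "Suc l" "deg \<alpha>"] by (auto simp: deg_def)
        then show ?thesis
          by (intro Y.fibre_null.order ideal.I_l_closed[OF J_ideal])
            (auto intro!: pt_carrier A_sum A_mult a tc_in A_1)
      qed
      have sum_null: "(\<Oplus>\<^bsub>TT\<^esub>\<alpha>\<in>F. f \<alpha>) \<in> Y.fibre_null" if "finite F" "\<And>\<alpha>. f \<alpha> \<in> Y.fibre_null"
        for F :: "('e \<Rightarrow> nat) set" and f
        using that(1)
      proof (induction F rule: finite_induct)
        case empty
        then show ?case using additive_subgroup.zero_closed[OF ideal.axioms(1)[OF J_ideal]]
          by (auto intro: Y.fibre_null.order)
      next
        case (insert \<alpha> F)
        then show ?case using Y.fibre_null_carrier[OF that(2)] Y.fibre_null.add[OF that(2)]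
          by (subst TT.finsum_insert) auto
      qed
      have eq: "T.cl (\<Sum>i\<in>Q. {#(a i, mon (ex i))#}) = (\<Oplus>\<^bsub>TT\<^esub>\<alpha>\<in>PiE B (\<lambda>_. {..N}).
          pt (\<Sum>i\<in>Q. a i * tc (ex i) \<alpha>) 1 \<otimes>\<^bsub>TT\<^esub> (\<Otimes>\<^bsub>TT\<^esub>e\<in>B. yy e [^]\<^bsub>TT\<^esub> \<alpha> e))"
        using expansion_sum[where a = a and ex = ex and N = N, OF assms(2) a N] by blast
      have "T.cl (\<Sum>i\<in>Q. {#(a i, mon (ex i) * g / g)#}) \<in> Y.fibre_null"
        unfolding vg eq
        using B_finite null by (intro sum_null finite_PiE) auto
      from Y.taylor_fibre_not_inj[OF a i this] inj show False by blast
    qed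
  qed
qed

end

section \<open>Reduction to interpolation on slices\<close>

text \<open>An infimum of natural numbers over a nonempty set is attained, and over the empty set it
  is infinite.\<close>

lemma INF_enat_le_iff: "(INF l\<in>S. enat l) \<le> enat n \<longleftrightarrow> (\<exists>l\<in>S. l \<le> n)"
proof
  assume le: "(INF l\<in>S. enat l) \<le> enat n"
  then have "S \<noteq> {}" by (auto simp: top_enat_def)
  then have "(INF l\<in>S. enat l) \<in> enat ` S" by (auto simp: Inf_enat_def intro: LeastI)
  with le show "\<exists>l\<in>S. l \<le> n" by auto
next
  assume "\<exists>l\<in>S. l \<le> n"
  then obtain l where "l \<in> S" "l \<le> n" by blast
  then show "(INF l\<in>S. enat l) \<le> enat n" by (meson INF_lower2 enat_ord_simps(1))
qed

text \<open>
  The polynomials of degree at most \<open>l\<close> in the coordinates from \<open>J\<close>, spanned by products of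
  binomial coefficients, separate the points \<open>ex i\<close>, \<open>i \<in> Q\<close>, linearly.
\<close>

definition separated :: "'k::field_char_0 itself \<Rightarrow> 'i set \<Rightarrow> 'e set \<Rightarrow> ('i \<Rightarrow> 'e \<Rightarrow> nat) \<Rightarrow> nat \<Rightarrow> bool"
  where "separated _ Q J ex l \<longleftrightarrow> (\<forall>c :: 'i \<Rightarrow> 'k.
    (\<forall>\<alpha>. (\<Sum>e\<in>J. \<alpha> e) \<le> l \<longrightarrow> (\<Sum>i\<in>Q. c i * of_nat (\<Prod>e\<in>J. ex i e choose \<alpha> e)) = 0)
    \<longrightarrow> (\<forall>i\<in>Q. c i = 0))"

text \<open>Directions that are constant on \<open>Q\<close> contribute one common factor to every
  equation; conversely, exponents on \<open>J\<close> are extended by 0. This identifies the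
  condition on a slice with the one that defines N_inj, which uses all directions.\<close>

lemma separated_constant:
  assumes "finite B" "J \<subseteq> B" and const: "\<And>i j e. i \<in> Q \<Longrightarrow> j \<in> Q \<Longrightarrow> e \<in> B - J \<Longrightarrow> ex i e = ex j e"
  shows "separated TYPE('k::field_char_0) Q B ex l \<longleftrightarrow> separated TYPE('k) Q J ex l"
proof -
  have sumB: "(\<Sum>e\<in>B. \<alpha> e) = (\<Sum>e\<in>J. \<alpha> e) + (\<Sum>e\<in>B - J. \<alpha> e)" for \<alpha> :: "_ \<Rightarrow> nat"
    using sum.subset_diff[OF assms(2,1), of \<alpha>] by simp
  have prodB: "(\<Prod>e\<in>B. ex i e choose \<alpha> e) = (\<Prod>e\<in>J. ex i e choose \<alpha> e) * (\<Prod>e\<in>B - J. ex i e choose \<alpha> e)" for i \<alpha>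
    using prod.subset_diff[OF assms(2,1), of "\<lambda>e. ex i e choose \<alpha> e"] by simp
  have "(\<forall>\<alpha>. (\<Sum>e\<in>B. \<alpha> e) \<le> l \<longrightarrow> (\<Sum>i\<in>Q. c i * of_nat (\<Prod>e\<in>B. ex i e choose \<alpha> e)) = 0) \<longleftrightarrow>
    (\<forall>\<alpha>. (\<Sum>e\<in>J. \<alpha> e) \<le> l \<longrightarrow> (\<Sum>i\<in>Q. c i * of_nat (\<Prod>e\<in>J. ex i e choose \<alpha> e)) = 0)"
    for c :: "_ \<Rightarrow> 'k"
  proof (intro iffI allI impI)
    fix \<alpha> assume B: "\<forall>\<alpha>. (\<Sum>e\<in>B. \<alpha> e) \<le> l \<longrightarrow> (\<Sum>i\<in>Q. c i * of_nat (\<Prod>e\<in>B. ex i e choose \<alpha> e)) = 0"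
      and l: "(\<Sum>e\<in>J. \<alpha> e) \<le> l"
    define \<beta> where "\<beta> e = (if e \<in> J then \<alpha> e else 0)" for e
    have "(\<Sum>e\<in>J. \<beta> e) = (\<Sum>e\<in>J. \<alpha> e)" "(\<Sum>e\<in>B - J. \<beta> e) = 0"
      and p: "(\<Prod>e\<in>J. ex i e choose \<beta> e) = (\<Prod>e\<in>J. ex i e choose \<alpha> e)" "(\<Prod>e\<in>B - J. ex i e choose \<beta> e) = 1" for i
      by (auto simp: \<beta>_def)
    then have "(\<Sum>e\<in>B. \<beta> e) \<le> l" using l by (simp add: sumB)
    with B have "(\<Sum>i\<in>Q. c i * of_nat (\<Prod>e\<in>B. ex i e choose \<beta> e)) = 0" by blast
    then show "(\<Sum>i\<in>Q. c i * of_nat (\<Prod>e\<in>J. ex i e choose \<alpha> e)) = 0" by (simp add: prodB p)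
  next
    fix \<alpha> assume J: "\<forall>\<alpha>. (\<Sum>e\<in>J. \<alpha> e) \<le> l \<longrightarrow> (\<Sum>i\<in>Q. c i * of_nat (\<Prod>e\<in>J. ex i e choose \<alpha> e)) = 0"
      and l: "(\<Sum>e\<in>B. \<alpha> e) \<le> l"
    show "(\<Sum>i\<in>Q. c i * of_nat (\<Prod>e\<in>B. ex i e choose \<alpha> e)) = 0"
    proof (cases "Q = {}")
      case False
      then obtain i0 where i0: "i0 \<in> Q" by blast
      have eq: "(\<Prod>e\<in>B - J. ex i e choose \<alpha> e) = (\<Prod>e\<in>B - J. ex i0 e choose \<alpha> e)" if "i \<in> Q" for i
        using const[OF that i0] by (intro prod.cong) auto
      have "(\<Sum>i\<in>Q. c i * of_nat (\<Prod>e\<in>B. ex i e choose \<alpha> e))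
          = (\<Sum>i\<in>Q. c i * of_nat (\<Prod>e\<in>J. ex i e choose \<alpha> e)) * of_nat (\<Prod>e\<in>B - J. ex i0 e choose \<alpha> e)"
        unfolding sum_distrib_right by (intro sum.cong) (auto simp: prodB eq mult.assoc simp del: of_nat_prod)
      also have "\<dots> = 0" using J l by (simp add: sumB)
      finally show ?thesis .
    qed simp
  qed
  then show ?thesis unfolding separated_def by simp
qed

section \<open>Calculus modulo the maximal ideal\<close>

context local_subalgebra begin

lemma mm_cancel: "a * b \<in> mm \<Longrightarrow> b \<in> A \<Longrightarrow> a \<in> A \<Longrightarrow> b \<notin> mm \<Longrightarrow> a \<in> mm"
proof -
  assume *: "a * b \<in> mm" "b \<in> A" "a \<in> A" "b \<notin> mm"
  then have "inverse b \<in> A" "b \<noteq> 0" by (auto simp: mm_iff)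
  then have "inverse b * (a * b) \<in> mm" using mm_mult[OF _ *(1)] by blast
  with \<open>b \<noteq> 0\<close> show ?thesis by (simp add: field_simps)
qed

lemma mm_prod_not: "(\<And>i. i \<in> F \<Longrightarrow> f i \<in> A \<and> f i \<notin> mm) \<Longrightarrow> prod f F \<notin> mm"
proof (induction F rule: infinite_finite_induct)
  case (insert i F)
  then show ?case using mm_cancel[of "prod f F" "f i"] A_prod[of F f] by (auto simp: mult.commute)
qed (auto simp: mm_iff A_1)

lemma mm_power_not: "a \<in> A \<Longrightarrow> a \<notin> mm \<Longrightarrow> a ^ n \<notin> mm"
  using mm_prod_not[of "{..<n}" "\<lambda>_. a"] by simp

lemma mm_prod: "finite F \<Longrightarrow> i \<in> F \<Longrightarrow> f i \<in> mm \<Longrightarrow> (\<And>i. i \<in> F \<Longrightarrow> f i \<in> A) \<Longrightarrow> prod f F \<in> mm"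
  by (subst prod.remove[of F i]) (auto intro!: mm_mult_right A_prod)

lemma cst_not_mm: "c \<noteq> 0 \<Longrightarrow> cst c \<notin> mm"
proof -
  assume c: "c \<noteq> 0"
  then have "cst c * cst (inverse c) = 1" by (simp flip: cst_mult add: cst_1)
  then have "inverse (cst c) = cst (inverse c)" by (rule inverse_unique)
  then show ?thesis using c cst_in by (simp add: mm_iff cst_eq_0_iff)
qed

text \<open>A linear functional on the function field reduces the question from the residue field to \<open>k\<close>.\<close>

lemma ex_functional:
  assumes "b \<notin> mm"
  obtains f :: "'f \<Rightarrow> 'k" where "\<And>y z. f (y + z) = f y + f z" "\<And>c y. f (cst c * y) = c * f y"
    "\<And>y. y \<in> mm \<Longrightarrow> f y = 0" "f b = 1"
proof -
  interpret vector_space_pair "\<lambda>c y. cst c * y" "(*) :: 'k \<Rightarrow> 'k \<Rightarrow> 'k"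
    by unfold_locales (simp_all add: algebra_simps cst_add cst_mult cst_1)
  \<comment> \<open>A k-basis of \<open>mm\<close> remains independent after adjoining
    \<open>b\<close>, because \<open>mm\<close> is a subspace that does not contain
    \<open>b\<close>. The functional is prescribed on the enlarged set.\<close>
  obtain S where S: "S \<subseteq> mm" "vs1.independent S" "mm \<subseteq> vs1.span S" using vs1.basis_exists by metis
  have "vs1.subspace mm" unfolding vs1.subspace_def using mm_0 mm_add mm_mult cst_in by blast
  then have "vs1.span S \<subseteq> mm" using S(1) vs1.span_minimal by blast
  then have "vs1.independent (insert b S)" using assms S(2) by (intro vs1.independent_insertI) auto
  then obtain f where f: "Vector_Spaces.linear (\<lambda>c y. cst c * y) (*) f" "\<forall>y\<in>insert b S. f y = (if y = b then 1 else 0)"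
    using linear_independent_extend[of "insert b S" "\<lambda>y. if y = b then 1 else 0"] by blast
  have "f y = 0" if "y \<in> mm" for y
  proof -
    have "f z = 0" if "z \<in> S" for z using that f(2) S(1) assms by auto
    from linear_eq_0_on_span[OF f(1) this] S(3) that show ?thesis by blast
  qed
  moreover have "f b = 1" using f(2) by simp
  ultimately show thesis by (rule that[OF linear_add[OF f(1)] linear_scale[OF f(1)]])
qed

end

section \<open>The criterion where some coordinates vanish and the others are units\<close>

context coordinate_algebra begin

text \<open>The equations have integer coefficients. A k-linear functional that kills
  \<open>mm\<close> and maps \<open>b i\<close> to 1 therefore turns a solution over the residue
  field into a solution over k, which must be 0.\<close>

lemma separated_residue:
  assumes sep: "separated TYPE('k) Q E ex l"
    and sum: "\<And>\<alpha>. (\<Sum>e\<in>E. \<alpha> e) \<le> l \<Longrightarrow> (\<Sum>i\<in>Q. b i * of_nat (\<Prod>e\<in>E. ex i e choose \<alpha> e)) \<in> mm"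
    and "i \<in> Q"
  shows "b i \<in> mm"
proof (rule ccontr)
  assume "b i \<notin> mm"
  then obtain f where f: "\<And>y z. f (y + z) = f y + f z" "\<And>c y. f (cst c * y) = c * f y"
    "\<And>y. y \<in> mm \<Longrightarrow> f y = 0" "f (b i) = 1"
    using ex_functional by blast
  have f_sum: "f (sum h F) = (\<Sum>i\<in>F. f (h i))" for h and F :: "'a set"
    using f(3)[OF mm_0] by (induction F rule: infinite_finite_induct) (auto simp: f(1))
  have f_nat: "f (y * of_nat n) = f y * of_nat n" for y n
    using f(2)[of "of_nat n" y] by (simp add: cst_of_nat mult.commute)
  have "(\<Sum>i\<in>Q. f (b i) * of_nat (\<Prod>e\<in>E. ex i e choose \<alpha> e)) = 0" if "(\<Sum>e\<in>E. \<alpha> e) \<le> l" for \<alpha>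
    using f(3)[OF sum[OF that]] by (simp add: f_sum f_nat del: of_nat_prod)
  then have "f (b i) = 0"
    using sep[unfolded separated_def, THEN spec, of "\<lambda>i. f (b i)"] \<open>i \<in> Q\<close> by simp
  with f(4) show False by simp
qed

lemma critD:
  assumes "crit Q ex l" "\<And>i. a i \<in> A" "\<And>\<alpha>. deg \<alpha> \<le> l \<Longrightarrow> (\<Sum>i\<in>Q. a i * tc (ex i) \<alpha>) \<in> mm" "i \<in> Q"
  shows "a i \<in> mm"
  using assms(1)[unfolded crit_def, THEN spec, of a] assms(2-4) by simp

lemma crit_mono: "crit Q ex l \<Longrightarrow> l \<le> l' \<Longrightarrow> crit Q ex l'"
  unfolding crit_def by (meson order_trans)

text \<open>\<open>crit\<close> is monotone in \<open>l\<close>, so the smallest order is at most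
  \<open>l\<close> if and only if \<open>crit\<close> holds at \<open>l\<close> itself.\<close>

theorem injectivity_order_le_iff:
  assumes "g \<noteq> 0" "finite Q" and V: "V = range (\<lambda>c. \<Sum>i\<in>Q. cst (c i) * (mon (ex i) * g))"
    and ind: "\<And>c i. (\<Sum>j\<in>Q. cst (c j) * (mon (ex j) * g)) = 0 \<Longrightarrow> i \<in> Q \<Longrightarrow> c i = 0"
  shows "injectivity_order kk alg (regular_module (ring_on ((\<lambda>f. f * g) ` A))) V \<le> enat l \<longleftrightarrow> crit Q ex l"
proof -
  have "inj_on (taylor_fibre kk alg (regular_module (ring_on ((\<lambda>f. f * g) ` A))) l)
      (carrier (fibre_source kk alg (regular_module (ring_on ((\<lambda>f. f * g) ` A))) V)) \<longleftrightarrow> crit Q ex l" for l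
    by (rule taylor_inj_iff[OF assms(1-3)]) (rule ind)
  then show ?thesis
    unfolding injectivity_order_def INF_enat_le_iff mem_Collect_eq Bex_def using crit_mono[of Q ex] by blast
qed

abbreviation tcF :: "'e set \<Rightarrow> ('e \<Rightarrow> nat) \<Rightarrow> ('e \<Rightarrow> nat) \<Rightarrow> 'f"
  where "tcF F p \<alpha> \<equiv> (\<Prod>e\<in>F. of_nat (p e choose \<alpha> e) * x e ^ (p e - \<alpha> e))"

lemma tcF_in: "F \<subseteq> B \<Longrightarrow> tcF F p \<alpha> \<in> A"
  using x_in by (intro A_prod A_mult A_of_nat A_power) auto

text \<open>Where \<alpha> is smaller than \<open>p\<close>, a positive power of a nonunit is left;
  where it is larger, the binomial coefficient is 0. Modulo \<open>mm\<close> only \<alpha> =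
  \<open>p\<close> survives in these directions.\<close>

lemma tcF_mm:
  assumes "F \<subseteq> B" "\<And>e. e \<in> F \<Longrightarrow> x e \<in> mm" "e \<in> F" "\<alpha> e \<noteq> p e"
  shows "tcF F p \<alpha> \<in> mm"
proof (rule mm_prod[OF _ assms(3)])
  show "finite F" using assms(1) B_finite finite_subset by blast
  show "of_nat (p e choose \<alpha> e) * x e ^ (p e - \<alpha> e) \<in> mm"
  proof (cases "p e < \<alpha> e")
    case False
    then obtain n where "p e - \<alpha> e = Suc n" using assms(4) by (metis Suc_diff_Suc linorder_cases)
    then have "x e ^ (p e - \<alpha> e) = x e ^ n * x e" by (simp add: mult.commute)
    also have "\<dots> \<in> mm" using assms x_in by (intro mm_mult A_power) auto
    finally show ?thesis by (rule mm_mult[OF A_of_nat])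
  qed (simp add: binomial_eq_0 mm_0)
  show "of_nat (p e choose \<alpha> e) * x e ^ (p e - \<alpha> e) \<in> A" if "e \<in> F" for e
    using that assms(1) x_in by (intro A_mult A_of_nat A_power) auto
qed

definition slice :: "'i set \<Rightarrow> ('i \<Rightarrow> 'e \<Rightarrow> nat) \<Rightarrow> 'e set \<Rightarrow> 'i \<Rightarrow> 'i set"
  where "slice Q ex E i0 = {i \<in> Q. \<forall>e\<in>B - E. ex i e = ex i0 e}"

text \<open>Modulo \<open>mm\<close> the equation for \<alpha> involves only the sections whose
  exponents in the nonunit directions equal those of \<alpha>. The system splits into slices;
  matching the transverse exponents costs their sum, and in the unit directions the powers of x can
  be scaled away, which leaves binomial coefficients.\<close>

theorem crit_iff_slices:
  assumes E: "E \<subseteq> B" and Q: "finite Q"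
    and unit: "\<And>e. e \<in> E \<Longrightarrow> x e \<notin> mm" and nonunit: "\<And>e. e \<in> B - E \<Longrightarrow> x e \<in> mm"
  shows "crit Q ex l \<longleftrightarrow> (\<forall>i0\<in>Q. (\<Sum>e\<in>B - E. ex i0 e) \<le> l \<and>
    separated TYPE('k) (slice Q ex E i0) E ex (l - (\<Sum>e\<in>B - E. ex i0 e)))"
proof -
  have tc: "tc p \<alpha> = tcF E p \<alpha> * tcF (B - E) p \<alpha>" for p \<alpha>
    unfolding tc_def using prod.subset_diff[OF E B_finite] by (simp add: mult.commute)
  have deg: "deg \<alpha> = (\<Sum>e\<in>E. \<alpha> e) + (\<Sum>e\<in>B - E. \<alpha> e)" for \<alpha>
    unfolding deg_def using sum.subset_diff[OF E B_finite, of \<alpha>] by simp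
  have x_unit: "x e \<noteq> 0" "inverse (x e) \<in> A" "inverse (x e) \<notin> mm" if "e \<in> E" for e
  proof -
    have "x e \<in> A" using that E x_in by blast
    then show "x e \<noteq> 0" "inverse (x e) \<in> A" "inverse (x e) \<notin> mm" using unit[OF that] by (auto simp: mm_iff)
  qed
  have tc_mm: "tc p \<alpha> \<in> mm" if "e \<in> B - E" "\<alpha> e \<noteq> p e" for p \<alpha> e
    unfolding tc using tcF_mm[OF _ nonunit that(1), of \<alpha> p] that E by (intro mm_mult tcF_in) auto
  have tc_slice: "tc p \<alpha> = tcF E p \<alpha>" if "\<And>e. e \<in> B - E \<Longrightarrow> \<alpha> e = p e" for p \<alpha>
    unfolding tc using that by simp
  show ?thesis
  proof
    assume crit: "crit Q ex l"
    show "\<forall>i0\<in>Q. (\<Sum>e\<in>B - E. ex i0 e) \<le> l \<and>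
      separated TYPE('k) (slice Q ex E i0) E ex (l - (\<Sum>e\<in>B - E. ex i0 e))"
    proof (intro ballI conjI)
      fix i0 assume i0: "i0 \<in> Q"
      define q where "q = (\<Sum>e\<in>B - E. ex i0 e)"
      show ql: "(\<Sum>e\<in>B - E. ex i0 e) \<le> l"
      proof (rule ccontr)
        assume "\<not> ?thesis"
        then have lq: "l < q" by (simp add: q_def)
        \<comment> \<open>If the transverse degree exceeds \<open>l\<close>, no admissible \<alpha>
          matches \<open>i0\<close>, so the indicator of \<open>i0\<close> solves all equations
          modulo \<open>mm\<close>.\<close>
        define a :: "_ \<Rightarrow> 'f" where "a i = (if i = i0 then 1 else 0)" for i
        have "(\<Sum>i\<in>Q. a i * tc (ex i) \<alpha>) \<in> mm" if "deg \<alpha> \<le> l" for \<alpha>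
        proof -
          have "(\<Sum>i\<in>Q. a i * tc (ex i) \<alpha>) = (\<Sum>i\<in>Q. if i = i0 then tc (ex i) \<alpha> else 0)"
            by (intro sum.cong) (auto simp: a_def)
          also have "\<dots> = tc (ex i0) \<alpha>" using i0 Q by simp
          also have "\<dots> \<in> mm"
          proof -
            have "\<exists>e\<in>B - E. \<alpha> e \<noteq> ex i0 e"
            proof (rule ccontr)
              assume "\<not> ?thesis"
              then have "(\<Sum>e\<in>B - E. \<alpha> e) = q" by (simp add: q_def)
              with that lq show False by (simp add: deg)
            qed
            then show ?thesis using tc_mm by blast
          qed
          finally show ?thesis .
        qed
        then have "a i0 \<in> mm" by (intro critD[where a = a, OF crit _ _ i0]) (simp_all add: a_def A_0 A_1)
        then show False by (simp add: a_def mm_iff A_1)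
      qed
      show "separated TYPE('k) (slice Q ex E i0) E ex (l - (\<Sum>e\<in>B - E. ex i0 e))"
        unfolding separated_def
      proof (intro allI impI ballI)
        fix c :: "_ \<Rightarrow> 'k" and i
        assume c: "\<forall>\<alpha>. (\<Sum>e\<in>E. \<alpha> e) \<le> l - (\<Sum>e\<in>B - E. ex i0 e) \<longrightarrow>
            (\<Sum>i\<in>slice Q ex E i0. c i * of_nat (\<Prod>e\<in>E. ex i e choose \<alpha> e)) = 0"
          and i: "i \<in> slice Q ex E i0"
        \<comment> \<open>Inverse unit monomials strip the powers of x that depend on
          \<open>i\<close>, leaving a binomial coefficient times a factor that depends on \<alpha>
          alone.\<close>
        define u where "u i = (\<Prod>e\<in>E. inverse (x e) ^ ex i e)" for i
        define a where "a i = (if i \<in> slice Q ex E i0 then cst (c i) * u i else 0)" for i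
        have u: "u i \<in> A" for i unfolding u_def using x_unit by (intro A_prod A_power)
        have a: "a i \<in> A" for i unfolding a_def using u by (auto intro: A_mult cst_in A_0)
        have "(\<Sum>i\<in>Q. a i * tc (ex i) \<alpha>) \<in> mm" if "deg \<alpha> \<le> l" for \<alpha>
        \<comment> \<open>If \<alpha> differs from \<open>i0\<close> in a transverse direction, each
          term of the slice lies in \<open>mm\<close>. Otherwise the sum is a multiple of one of the
          equations satisfied by \<open>c\<close>.\<close>
        proof (cases "\<exists>e\<in>B - E. \<alpha> e \<noteq> ex i0 e")
          case True
          then obtain e where e: "e \<in> B - E" "\<alpha> e \<noteq> ex i0 e" by blast
          show ?thesis
          proof (rule mm_sum)
            fix i assume "i \<in> Q"
            show "a i * tc (ex i) \<alpha> \<in> mm"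
            proof (cases "i \<in> slice Q ex E i0")
              case True
              then have "\<alpha> e \<noteq> ex i e" using e by (auto simp: slice_def)
              then show ?thesis using tc_mm[OF e(1)] a by (intro mm_mult) auto
            qed (simp add: a_def mm_0)
          qed
        next
          case False
          have "(\<Sum>e\<in>B - E. \<alpha> e) = q" unfolding q_def using False by (intro sum.cong) auto
          with that have le: "(\<Sum>e\<in>E. \<alpha> e) \<le> l - (\<Sum>e\<in>B - E. ex i0 e)" by (simp add: deg q_def)
          define w where "w = (\<Prod>e\<in>E. inverse (x e) ^ \<alpha> e)"
          have uw: "u i * tcF E (ex i) \<alpha> = w * of_nat (\<Prod>e\<in>E. ex i e choose \<alpha> e)" for i
            unfolding u_def w_def of_nat_prod prod.distrib[symmetric]
          proof (rule prod.cong[OF HOL.refl])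
            fix e assume "e \<in> E"
            then have "x e \<noteq> 0" by (rule x_unit)
            show "inverse (x e) ^ ex i e * (of_nat (ex i e choose \<alpha> e) * x e ^ (ex i e - \<alpha> e))
                = inverse (x e) ^ \<alpha> e * of_nat (ex i e choose \<alpha> e)"
            proof (cases "\<alpha> e \<le> ex i e")
              case True
              then have "x e ^ ex i e = x e ^ \<alpha> e * x e ^ (ex i e - \<alpha> e)" by (simp flip: power_add)
              with \<open>x e \<noteq> 0\<close> show ?thesis by (simp add: power_inverse field_simps)
            qed (simp add: binomial_eq_0)
          qed
          have "(\<Sum>i\<in>Q. a i * tc (ex i) \<alpha>) = (\<Sum>i\<in>slice Q ex E i0. a i * tc (ex i) \<alpha>)"
            using Q by (intro sum.mono_neutral_right) (auto simp: slice_def a_def)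
          also have "\<dots> = (\<Sum>i\<in>slice Q ex E i0. w * cst (c i * of_nat (\<Prod>e\<in>E. ex i e choose \<alpha> e)))"
          proof (rule sum.cong[OF HOL.refl])
            fix i assume i: "i \<in> slice Q ex E i0"
            then have "tc (ex i) \<alpha> = tcF E (ex i) \<alpha>" using False by (intro tc_slice) (auto simp: slice_def)
            then have "a i * tc (ex i) \<alpha> = cst (c i) * (u i * tcF E (ex i) \<alpha>)"
              using i by (simp add: a_def)
            then show "a i * tc (ex i) \<alpha> = w * cst (c i * of_nat (\<Prod>e\<in>E. ex i e choose \<alpha> e))"
              unfolding uw cst_mult cst_of_nat by (simp only: mult_ac)
          qed
          also have "\<dots> = w * cst (\<Sum>i\<in>slice Q ex E i0. c i * of_nat (\<Prod>e\<in>E. ex i e choose \<alpha> e))"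
          proof -
            have "cst (sum h F) = (\<Sum>i\<in>F. cst (h i))" for h and F :: "'a set"
              by (induction F rule: infinite_finite_induct) (auto simp: cst_0 cst_add)
            then show ?thesis by (simp only: sum_distrib_left)
          qed
          also have "\<dots> = 0" using c le by (simp add: cst_0 del: of_nat_prod)
          finally show ?thesis by (simp add: mm_0)
        qed
        then have "a i \<in> mm" using i by (intro critD[where a = a, OF crit a]) (auto simp: slice_def)
        then have "u i * cst (c i) \<in> mm" using i by (simp add: a_def mult.commute)
        moreover have "u i \<notin> mm"
          unfolding u_def by (intro mm_prod_not conjI A_power mm_power_not x_unit)
        ultimately have "cst (c i) \<in> mm" using mm_cancel[of "cst (c i)" "u i"] u cst_in by (simp add: mult.commute)
        then show "c i = 0" using cst_not_mm by blast
      qed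
    qed
  next
    assume sl: "\<forall>i0\<in>Q. (\<Sum>e\<in>B - E. ex i0 e) \<le> l \<and>
      separated TYPE('k) (slice Q ex E i0) E ex (l - (\<Sum>e\<in>B - E. ex i0 e))"
    show "crit Q ex l"
      unfolding crit_def
    proof (intro allI impI ballI)
      fix a i0 assume a: "\<forall>i. a i \<in> A" and i0: "i0 \<in> Q"
        and m: "\<forall>\<alpha>. deg \<alpha> \<le> l \<longrightarrow> (\<Sum>i\<in>Q. a i * tc (ex i) \<alpha>) \<in> mm"
      define q where "q = (\<Sum>e\<in>B - E. ex i0 e)"
      have q: "q \<le> l" and sep: "separated TYPE('k) (slice Q ex E i0) E ex (l - q)"
        using sl i0 by (auto simp: q_def)
      \<comment> \<open>The inverse of the scaling in the other direction: the unknowns that satisfy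
        equations with integer coefficients are \<open>a i * u i\<close>.\<close>
      define u where "u i = (\<Prod>e\<in>E. x e ^ ex i e)" for i
      have xE: "x e \<in> A" if "e \<in> E" for e using that E x_in by blast
      have "a i * u i \<in> mm" if "i \<in> slice Q ex E i0" for i
      proof (rule separated_residue[OF sep _ that])
        fix \<alpha>0 assume le: "(\<Sum>e\<in>E. \<alpha>0 e) \<le> l - q"
        \<comment> \<open>Completing the exponent by those of \<open>i0\<close> raises its degree by
          exactly \<open>q\<close>, so it stays at most \<open>l\<close>, and selects the slice of
          \<open>i0\<close> modulo \<open>mm\<close>.\<close>
        define \<alpha> where "\<alpha> e = (if e \<in> E then \<alpha>0 e else ex i0 e)" for e
        define w where "w = (\<Prod>e\<in>E. x e ^ \<alpha> e)"
        have "(\<Sum>e\<in>E. \<alpha> e) = (\<Sum>e\<in>E. \<alpha>0 e)" "(\<Sum>e\<in>B - E. \<alpha> e) = q" by (auto simp: \<alpha>_def q_def)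
        then have "deg \<alpha> \<le> l" using le q by (simp add: deg)
        with m have sum: "(\<Sum>i\<in>Q. a i * tc (ex i) \<alpha>) \<in> mm" by blast
        have split: "(\<Sum>i\<in>Q. a i * tc (ex i) \<alpha>)
            = (\<Sum>i\<in>slice Q ex E i0. a i * tc (ex i) \<alpha>) + (\<Sum>i\<in>Q - slice Q ex E i0. a i * tc (ex i) \<alpha>)"
          using sum.subset_diff[of "slice Q ex E i0" Q] Q by (auto simp: slice_def add.commute)
        have "(\<Sum>i\<in>Q - slice Q ex E i0. a i * tc (ex i) \<alpha>) \<in> mm"
        proof (rule mm_sum)
          fix i assume "i \<in> Q - slice Q ex E i0"
          then obtain e where "e \<in> B - E" "ex i e \<noteq> ex i0 e" by (auto simp: slice_def)
          then have "tc (ex i) \<alpha> \<in> mm" by (intro tc_mm) (auto simp: \<alpha>_def)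
          then show "a i * tc (ex i) \<alpha> \<in> mm" using a by (intro mm_mult) auto
        qed
        from mm_diff[OF sum this] have "(\<Sum>i\<in>slice Q ex E i0. a i * tc (ex i) \<alpha>) \<in> mm"
          unfolding split by simp
        then have "w * (\<Sum>i\<in>slice Q ex E i0. a i * tc (ex i) \<alpha>) \<in> mm"
          unfolding w_def using xE by (intro mm_mult A_prod A_power)
        also have "w * (\<Sum>i\<in>slice Q ex E i0. a i * tc (ex i) \<alpha>)
            = (\<Sum>i\<in>slice Q ex E i0. a i * u i * of_nat (\<Prod>e\<in>E. ex i e choose \<alpha>0 e))"
          unfolding sum_distrib_left
        proof (rule sum.cong[OF HOL.refl])
          fix i assume "i \<in> slice Q ex E i0"
          then have "tc (ex i) \<alpha> = tcF E (ex i) \<alpha>" by (intro tc_slice) (auto simp: slice_def \<alpha>_def)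
          moreover have "w * tcF E (ex i) \<alpha> = u i * of_nat (\<Prod>e\<in>E. ex i e choose \<alpha>0 e)"
            unfolding u_def w_def of_nat_prod prod.distrib[symmetric]
          proof (rule prod.cong[OF HOL.refl])
            fix e assume "e \<in> E"
            show "x e ^ \<alpha> e * (of_nat (ex i e choose \<alpha> e) * x e ^ (ex i e - \<alpha> e))
                = x e ^ ex i e * of_nat (ex i e choose \<alpha>0 e)"
            proof (cases "\<alpha> e \<le> ex i e")
              case True
              then have "x e ^ ex i e = x e ^ \<alpha> e * x e ^ (ex i e - \<alpha> e)" by (simp flip: power_add)
              with \<open>e \<in> E\<close> show ?thesis by (simp add: \<alpha>_def)
            qed (use \<open>e \<in> E\<close> in \<open>simp add: binomial_eq_0 \<alpha>_def\<close>)
          qed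
          ultimately show "w * (a i * tc (ex i) \<alpha>) = a i * u i * of_nat (\<Prod>e\<in>E. ex i e choose \<alpha>0 e)"
            by (simp only: mult.assoc mult.left_commute[of w])
        qed
        finally show "(\<Sum>i\<in>slice Q ex E i0. a i * u i * of_nat (\<Prod>e\<in>E. ex i e choose \<alpha>0 e)) \<in> mm" .
      qed
      moreover have "i0 \<in> slice Q ex E i0" using i0 by (simp add: slice_def)
      ultimately have "a i0 * u i0 \<in> mm" by blast
      moreover have "u i0 \<notin> mm" unfolding u_def by (intro mm_prod_not conjI A_power mm_power_not xE unit)
      moreover have "u i0 \<in> A" unfolding u_def by (intro A_prod A_power xE)
      ultimately show "a i0 \<in> mm" using a mm_cancel[of "a i0" "u i0"] by blast
    qed
  qed
qed

text \<open>
  Taylor expansion is an invertible substitution once no monomial is truncated; \<open>binom(p, \<alpha>)\<close> is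
  unitriangular, so the coefficients vanish one by one, starting from the largest exponents.
\<close>

lemma crit_of_deg_le:
  assumes Q: "finite Q" and inj: "\<And>i j. i \<in> Q \<Longrightarrow> j \<in> Q \<Longrightarrow> (\<And>e. e \<in> B \<Longrightarrow> ex i e = ex j e) \<Longrightarrow> i = j"
    and deg: "\<And>i. i \<in> Q \<Longrightarrow> deg (ex i) \<le> l"
  shows "crit Q ex l"
  unfolding crit_def
proof (intro allI impI ballI)
  fix a i assume a: "\<forall>i. a i \<in> A" and "i \<in> Q"
    and m: "\<forall>\<alpha>. deg \<alpha> \<le> l \<longrightarrow> (\<Sum>i\<in>Q. a i * tc (ex i) \<alpha>) \<in> mm"
  then show "a i \<in> mm"
  proof (induction "l - deg (ex i)" arbitrary: i rule: less_induct)
    case less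
    let ?R = "{j \<in> Q - {i}. \<forall>e\<in>B. ex i e \<le> ex j e}"
    \<comment> \<open>The equation with \<alpha> = \<open>ex i\<close>: its diagonal coefficient is
      1, and another section contributes only if its exponents dominate, hence if its degree is
      strictly larger.\<close>
    have "(\<Sum>j\<in>Q. a j * tc (ex j) (ex i)) \<in> mm" using m deg[OF less.prems(2)] by blast
    also have "(\<Sum>j\<in>Q. a j * tc (ex j) (ex i)) = a i * tc (ex i) (ex i) + (\<Sum>j\<in>Q - {i}. a j * tc (ex j) (ex i))"
      using Q less.prems(2) by (rule sum.remove)
    also have "tc (ex i) (ex i) = 1" by (simp add: tc_def)
    finally have s: "a i * 1 + (\<Sum>j\<in>Q - {i}. a j * tc (ex j) (ex i)) \<in> mm" .
    have "(\<Sum>j\<in>Q - {i}. a j * tc (ex j) (ex i)) \<in> mm"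
    proof (rule mm_sum)
      fix j assume j: "j \<in> Q - {i}"
      show "a j * tc (ex j) (ex i) \<in> mm"
      proof (cases "\<forall>e\<in>B. ex i e \<le> ex j e")
        case True
        obtain e where e: "e \<in> B" "ex i e \<noteq> ex j e" using inj[of i j] j less.prems(2) by blast
        have "deg (ex i) < deg (ex j)"
          unfolding deg_def using True e B_finite by (intro sum_strict_mono_ex1) (auto intro!: bexI[OF _ e(1)])
        then have "a j \<in> mm" using j deg[of j] less.prems by (intro less.hyps) auto
        then show ?thesis by (intro mm_mult_right tc_in)
      next
        case False
        then obtain e where "e \<in> B" "ex j e < ex i e" by (auto simp: not_le)
        then have "tc (ex j) (ex i) = 0" unfolding tc_def by (intro prod_zero[OF B_finite] bexI[of _ e]) (simp_all add: binomial_eq_0)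
        then show ?thesis by (simp add: mm_0)
      qed
    qed
    from mm_diff[OF s this] show ?case by simp
  qed
qed

end

section \<open>Laurent polynomials and their fractions\<close>

lift_definition lcoeff :: "('k::comm_ring_1, 'n::finite) laurent \<Rightarrow> int ^ 'n \<Rightarrow> 'k" is Poly_Mapping.lookup .

text \<open>The diagonal operator multiplying x^m by \<open>w m\<close>. For additive
  \<open>w\<close> it is a derivation; for an indicator function it truncates the support.\<close>

lift_definition euler :: "(int ^ 'n::finite \<Rightarrow> 'k) \<Rightarrow> ('k::comm_ring_1, 'n) laurent \<Rightarrow> ('k, 'n) laurent"
  is "\<lambda>w. Poly_Mapping.mapp (\<lambda>m c. w m * c)" .

lemma laurent_eqI: "(\<And>m. lcoeff f m = lcoeff g m) \<Longrightarrow> f = g"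
  by transfer (rule poly_mapping_eqI)

lemma support_iff: "m \<in> support f \<longleftrightarrow> lcoeff f m \<noteq> 0"
  by transfer (simp add: in_keys_iff)

lemma finite_support: "finite (support f)"
  by transfer simp

lemma lcoeff_add [simp]: "lcoeff (f + g) m = lcoeff f m + lcoeff g m"
  by transfer (simp add: lookup_add)

lemma lcoeff_uminus [simp]: "lcoeff (- f) m = - lcoeff f m"
  by transfer simp

lemma lcoeff_diff [simp]: "lcoeff (f - g) m = lcoeff f m - lcoeff g m"
  by transfer (simp add: lookup_minus)

lemma lcoeff_0 [simp]: "lcoeff 0 m = 0"
  by transfer simp

lemma lcoeff_sum: "lcoeff (sum f S) m = (\<Sum>i\<in>S. lcoeff (f i) m)"
  by (induction S rule: infinite_finite_induct) auto

lemma lcoeff_const_monomial: "lcoeff (const c * monomial a) m = (if m = a then c else 0)"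
  by transfer (simp add: mult_single lookup_single when_def)

lemma lcoeff_monomial: "lcoeff (monomial a) m = (if m = a then 1 else 0)"
  by transfer (simp add: lookup_single when_def)

lemma lcoeff_euler [simp]: "lcoeff (euler w f) m = w m * lcoeff f m"
  by transfer (simp add: mapp.rep_eq in_keys_iff)

lemma monomial_add: "monomial (a + b) = monomial a * monomial b"
  by transfer (simp add: mult_single)

lemma monomial_0: "monomial 0 = 1"
  by transfer (rule single_one)

lemma monomial_inverse: "monomial a * monomial (- a) = 1"
  using monomial_add[of a "- a"] by (simp add: monomial_0)

lemma monomial_nonzero: "(monomial a :: ('k::comm_ring_1, 'n::finite) laurent) \<noteq> 0"
  using lcoeff_monomial[of a a] by (metis lcoeff_0 zero_neq_one)

lemma const_hom: "const 0 = 0" "const 1 = 1" "const (c + d) = const c + const d" "const (c * d) = const c * const d"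
  by (transfer; simp add: single_add mult_single single_one)+

lemma laurent_expansion: "f = (\<Sum>m\<in>support f. const (lcoeff f m) * monomial m)"
proof (rule laurent_eqI)
  fix a
  have "(\<Sum>m\<in>support f. lcoeff (const (lcoeff f m) * monomial m) a) = (\<Sum>m\<in>support f. if a = m then lcoeff f m else 0)"
    by (rule sum.cong) (auto simp: lcoeff_const_monomial)
  also have "\<dots> = lcoeff f a" using finite_support[of f] by (simp add: support_iff)
  finally show "lcoeff f a = lcoeff (\<Sum>m\<in>support f. const (lcoeff f m) * monomial m) a"
    by (simp add: lcoeff_sum)
qed

lemma laurent_induct:
  assumes "P 0" "\<And>c m. P (const c * monomial m)" "\<And>f g. P f \<Longrightarrow> P g \<Longrightarrow> P (f + g)"
  shows "P f"
proof -
  have "P (\<Sum>m\<in>S. const (lcoeff f m) * monomial m)" if "finite S" for S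
    using that by (induction S rule: finite_induct) (use assms in auto)
  from this[OF finite_support] show ?thesis by (subst laurent_expansion)
qed

lemma lcoeff_mult_monomial: "lcoeff (f * monomial a) m = lcoeff f (m - a)"
proof (induction f rule: laurent_induct)
  case (2 c b)
  have "const c * monomial b * monomial a = const c * monomial (b + a)" by (simp add: monomial_add mult.assoc)
  then show ?case by (simp only: lcoeff_const_monomial) (auto simp: algebra_simps)
qed (simp_all add: distrib_right)

lemma support_mult:
  fixes f g :: "('k::comm_ring_1, 'n::finite) laurent"
  assumes m: "m \<in> support (f * g)"
  shows "\<exists>a\<in>support f. \<exists>b\<in>support g. m = a + b"
proof -
  have "f * g = (\<Sum>b\<in>support g. const (lcoeff g b) * (f * monomial b))"
    by (subst laurent_expansion[of g]) (simp add: sum_distrib_left mult_ac)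
  have "lcoeff (const c * h) a = c * lcoeff h a" for c a and h :: "('k, 'n) laurent"
  proof (induction h rule: laurent_induct)
    case (2 d b)
    have "const c * (const d * monomial b) = const (c * d) * monomial b" by (simp add: const_hom mult.assoc)
    then show ?case by (simp only: lcoeff_const_monomial) simp
  qed (simp_all add: distrib_left)
  then have "lcoeff (f * g) m = (\<Sum>b\<in>support g. lcoeff g b * lcoeff f (m - b))"
    by (subst \<open>f * g = _\<close>) (simp add: lcoeff_sum lcoeff_mult_monomial)
  then obtain b where "b \<in> support g" "lcoeff f (m - b) \<noteq> 0"
    using m by (metis (no_types, lifting) mult_zero_right sum.neutral support_iff)
  then show ?thesis by (intro bexI[of _ "m - b"] bexI[of _ b]) (auto simp: support_iff)
qed

lemma euler_add: "euler w (f + g) = euler w f + euler w g"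
  by (rule laurent_eqI) (simp add: algebra_simps)

lemma euler_single: "euler w (const c * monomial m) = const (w m * c) * monomial m"
  by (rule laurent_eqI) (simp add: lcoeff_const_monomial)

lemma euler_zero: "euler w 0 = 0"
  by (rule laurent_eqI) simp

lemma euler_mult:
  assumes w: "\<And>a b. w (a + b) = w a + w b"
  shows "euler w (f * g) = f * euler w g + euler w f * g"
proof (induction f rule: laurent_induct)
  case (2 c a)
  show ?case
  proof (induction g rule: laurent_induct)
    case (2 d b)
    have "const c * monomial a * (const d * monomial b) = const (c * d) * monomial (a + b)"
      by (simp add: const_hom monomial_add mult_ac)
    then show ?case by (simp only: euler_single) (simp add: w const_hom monomial_add algebra_simps)
  qed (simp_all add: euler_add euler_zero algebra_simps)
qed (simp_all add: euler_add euler_zero algebra_simps)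

section \<open>Extension of derivations to the fraction field\<close>

definition fderiv :: "('a::idom \<Rightarrow> 'a) \<Rightarrow> 'a fract \<Rightarrow> 'a fract"
  where "fderiv d z = (THE y. \<forall>f g. g \<noteq> 0 \<and> z = Fract f g \<longrightarrow> y = Fract (g * d f - f * d g) (g * g))"

lemma fderiv_Fract:
  assumes add: "\<And>f g. d (f + g) = d f + d g" and mult: "\<And>f g. d (f * g) = f * d g + d f * g" and g: "g \<noteq> 0"
  shows "fderiv d (Fract f g) = Fract (g * d f - f * d g) (g * g)"
  unfolding fderiv_def
proof (rule the_equality)
  show "\<forall>f' g'. g' \<noteq> 0 \<and> Fract f g = Fract f' g' \<longrightarrow>
    Fract (g * d f - f * d g) (g * g) = Fract (g' * d f' - f' * d g') (g' * g')"
  proof (intro allI impI, elim conjE)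
    fix f' g' assume g': "g' \<noteq> 0" and "Fract f g = Fract f' g'"
    then have eq: "f * g' = f' * g" using g by (simp add: eq_fract)
    then have "f * d g' + d f * g' = f' * d g + d f' * g" by (metis mult)
    \<comment> \<open>Well-definedness of the quotient rule: the cross difference is a combination
      of the relation f g' = f' g and of its derivative.\<close>
    moreover have "(g * d f - f * d g) * (g' * g') - (g' * d f' - f' * d g') * (g * g)
      = g * g' * ((f * d g' + d f * g') - (f' * d g + d f' * g)) - (g * d g' + g' * d g) * (f * g' - f' * g)"
      by (simp add: algebra_simps)
    ultimately have "(g * d f - f * d g) * (g' * g') = (g' * d f' - f' * d g') * (g * g)"
      using eq by simp
    then show "Fract (g * d f - f * d g) (g * g) = Fract (g' * d f' - f' * d g') (g' * g')"
      using g g' by (simp add: eq_fract)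
  qed
qed (use g in blast)

lemma fderiv_add:
  assumes add: "\<And>f g. d (f + g) = d f + d g" and mult: "\<And>f g. d (f * g) = f * d g + d f * g"
  shows "fderiv d (y + z) = fderiv d y + fderiv d z"
proof -
  obtain f g f' g' where *: "y = Fract f g" "g \<noteq> 0" "z = Fract f' g'" "g' \<noteq> 0" by (metis Fract_cases)
  then show ?thesis by (simp add: fderiv_Fract[OF add mult] eq_fract) (simp add: add mult algebra_simps)
qed

lemma fderiv_mult:
  assumes add: "\<And>f g. d (f + g) = d f + d g" and mult: "\<And>f g. d (f * g) = f * d g + d f * g"
  shows "fderiv d (y * z) = y * fderiv d z + fderiv d y * z"
proof -
  obtain f g f' g' where *: "y = Fract f g" "g \<noteq> 0" "z = Fract f' g'" "g' \<noteq> 0" by (metis Fract_cases)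
  then show ?thesis by (simp add: fderiv_Fract[OF add mult] eq_fract) (simp add: mult algebra_simps)
qed

section \<open>Local rings of affine charts\<close>

definition is_subring :: "'a::comm_ring_1 set \<Rightarrow> bool"
  where "is_subring S \<longleftrightarrow> 1 \<in> S \<and> (\<forall>a\<in>S. - a \<in> S) \<and> (\<forall>a\<in>S. \<forall>b\<in>S. a + b \<in> S \<and> a * b \<in> S)"

lemma is_subringD:
  assumes "is_subring S"
  shows "1 \<in> S" "0 \<in> S" "a \<in> S \<Longrightarrow> - a \<in> S" "a \<in> S \<Longrightarrow> b \<in> S \<Longrightarrow> a + b \<in> S" "a \<in> S \<Longrightarrow> b \<in> S \<Longrightarrow> a * b \<in> S"
    "a \<in> S \<Longrightarrow> b \<in> S \<Longrightarrow> a - b \<in> S"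
proof -
  show 1: "1 \<in> S" and u: "a \<in> S \<Longrightarrow> - a \<in> S" and p: "a \<in> S \<Longrightarrow> b \<in> S \<Longrightarrow> a + b \<in> S"
    and "a \<in> S \<Longrightarrow> b \<in> S \<Longrightarrow> a * b \<in> S" for a b using assms by (auto simp: is_subring_def)
  show "0 \<in> S" using p[OF 1 u[OF 1]] by simp
  show "a \<in> S \<Longrightarrow> b \<in> S \<Longrightarrow> a - b \<in> S" using p[of a "- b"] u[of b] by simp
qed

lemma ring_on_simps [simp]: "carrier (ring_on S) = S" "a \<otimes>\<^bsub>ring_on S\<^esub> b = a * b" "\<one>\<^bsub>ring_on S\<^esub> = 1"
  "\<zero>\<^bsub>ring_on S\<^esub> = 0" "a \<oplus>\<^bsub>ring_on S\<^esub> b = a + b"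
  by (simp_all add: ring_on_def)

lemma ring_on_cring: "is_subring S \<Longrightarrow> cring (ring_on S)"
proof (rule cringI)
  assume S: "is_subring S"
  show "abelian_group (ring_on S)"
  proof (rule abelian_groupI)
    fix x assume "x \<in> carrier (ring_on S)"
    then show "\<exists>y\<in>carrier (ring_on S). y \<oplus>\<^bsub>ring_on S\<^esub> x = \<zero>\<^bsub>ring_on S\<^esub>"
      using is_subringD[OF S] by (intro bexI[of _ "- x"]) auto
  qed (use is_subringD[OF S] in auto)
  show "comm_monoid (ring_on S)" by (rule comm_monoidI) (use is_subringD[OF S] in auto)
qed (auto simp: algebra_simps)

text \<open>Prime ideals of \<open>ring_on S\<close>, expressed by the operations of the ambient
  ring.\<close>

definition prime_on :: "'a::comm_ring_1 set \<Rightarrow> 'a set \<Rightarrow> bool"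
  where "prime_on \<pp> S \<longleftrightarrow> \<pp> \<subseteq> S \<and> 0 \<in> \<pp> \<and> (\<forall>a\<in>\<pp>. \<forall>b\<in>\<pp>. a + b \<in> \<pp>) \<and> (\<forall>r\<in>S. \<forall>a\<in>\<pp>. r * a \<in> \<pp>)
    \<and> 1 \<notin> \<pp> \<and> (\<forall>a\<in>S. \<forall>b\<in>S. a * b \<in> \<pp> \<longrightarrow> a \<in> \<pp> \<or> b \<in> \<pp>)"

lemma prime_onD:
  assumes "prime_on \<pp> S"
  shows "\<pp> \<subseteq> S" "0 \<in> \<pp>" "a \<in> \<pp> \<Longrightarrow> b \<in> \<pp> \<Longrightarrow> a + b \<in> \<pp>" "r \<in> S \<Longrightarrow> a \<in> \<pp> \<Longrightarrow> r * a \<in> \<pp>"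
    "1 \<notin> \<pp>" "a \<in> S \<Longrightarrow> b \<in> S \<Longrightarrow> a * b \<in> \<pp> \<Longrightarrow> a \<in> \<pp> \<or> b \<in> \<pp>"
  using assms by (auto simp: prime_on_def)

lemma ideal_on:
  assumes S: "is_subring S" and "\<pp> \<subseteq> S" "0 \<in> \<pp>" "\<And>a b. a \<in> \<pp> \<Longrightarrow> b \<in> \<pp> \<Longrightarrow> a + b \<in> \<pp>"
    "\<And>r a. r \<in> S \<Longrightarrow> a \<in> \<pp> \<Longrightarrow> r * a \<in> \<pp>"
  shows "ideal \<pp> (ring_on S)"
proof -
  interpret R: cring "ring_on S" by (rule ring_on_cring[OF S])
  show ?thesis
  proof (rule idealI)
    show "ring (ring_on S)" by (rule R.ring_axioms)
    have "\<pp> \<subseteq> carrier (ring_on S)" using assms(2) by simp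
    then show "subgroup \<pp> (add_monoid (ring_on S))"
    proof (rule R.add.subgroupI)
      fix a assume a: "a \<in> \<pp>"
      then have "a \<in> S" using assms(2) by blast
      then have "\<ominus>\<^bsub>ring_on S\<^esub> a = - a" using is_subringD[OF S] by (intro R.minus_equality) auto
      moreover have "- 1 * a \<in> \<pp>" using is_subringD[OF S] a by (intro assms(5)) auto
      ultimately show "\<ominus>\<^bsub>ring_on S\<^esub> a \<in> \<pp>" by simp
    qed (use assms in auto)
    fix a r assume "a \<in> \<pp>" "r \<in> carrier (ring_on S)"
    then show "r \<otimes>\<^bsub>ring_on S\<^esub> a \<in> \<pp>" "a \<otimes>\<^bsub>ring_on S\<^esub> r \<in> \<pp>" using assms(5)[of r a] by (simp_all add: mult.commute)
  qed
qed

lemma primeideal_on_iff: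
  assumes S: "is_subring S"
  shows "primeideal \<pp> (ring_on S) \<longleftrightarrow> prime_on \<pp> S"
proof
  assume p: "primeideal \<pp> (ring_on S)"
  then have i: "ideal \<pp> (ring_on S)" by (rule primeideal.axioms)
  have a: "additive_subgroup \<pp> (ring_on S)" by (rule ideal.axioms(1)[OF i])
  have "1 \<notin> \<pp>" using primeideal.I_notcarr[OF p] ideal.one_imp_carrier[OF i] by auto
  then show "prime_on \<pp> S"
    using additive_subgroup.a_subset[OF a] additive_subgroup.zero_closed[OF a] additive_subgroup.a_closed[OF a]
      ideal.I_l_closed[OF i] primeideal.I_prime[OF p] by (auto simp: prime_on_def)
next
  assume p: "prime_on \<pp> S"
  show "primeideal \<pp> (ring_on S)"
  proof (rule primeidealI)
    show "ideal \<pp> (ring_on S)" using prime_onD[OF p] by (intro ideal_on[OF S]) auto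
    show "cring (ring_on S)" by (rule ring_on_cring[OF S])
  qed (use prime_onD[OF p] is_subringD[OF S] in auto)
qed

lemma monomial_span_iff: "f \<in> monomial_span S \<longleftrightarrow> (\<forall>m. lcoeff f m \<noteq> 0 \<longrightarrow> m \<in> S)"
  by (auto simp: monomial_span_def support_iff subset_iff)

lemma monomial_span_subring:
  assumes "0 \<in> S" "\<And>a b. a \<in> S \<Longrightarrow> b \<in> S \<Longrightarrow> a + b \<in> S"
  shows "is_subring (monomial_span S :: ('k::comm_ring_1, 'n::finite) laurent set)"
  unfolding is_subring_def
proof (intro conjI ballI)
  show "(1 :: ('k, 'n) laurent) \<in> monomial_span S" unfolding monomial_0[symmetric] using assms(1) by (simp add: monomial_span_iff lcoeff_monomial)
  fix f :: "('k, 'n) laurent" assume f: "f \<in> monomial_span S"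
  then show "- f \<in> monomial_span S" by (simp add: monomial_span_iff)
  fix g :: "('k, 'n) laurent" assume g: "g \<in> monomial_span S"
  show "f + g \<in> monomial_span S" using f g unfolding monomial_span_iff lcoeff_add by (metis add_0)
  show "f * g \<in> monomial_span S"
    using support_mult[of _ f g] f g assms(2) unfolding monomial_span_def by blast
qed

lemma monomial_in_span: "m \<in> S \<Longrightarrow> monomial m \<in> monomial_span S"
  by (simp add: monomial_span_iff lcoeff_monomial)

lemma const_in_span:
  assumes "0 \<in> S"
  shows "(const c :: ('k::comm_ring_1, 'n::finite) laurent) \<in> monomial_span S"
proof -
  have "lcoeff (const c :: ('k, 'n) laurent) m = (if m = 0 then c else 0)" for m
    using lcoeff_const_monomial[of c "0 :: int ^ 'n" m] by (simp add: monomial_0)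
  then show ?thesis using assms by (simp add: monomial_span_iff)
qed

abbreviation fconst :: "'k::field_char_0 \<Rightarrow> ('k, 'n::finite) laurent fract" where "fconst c \<equiv> Fract (const c) 1"

locale prime_localization =
  fixes R \<pp> :: "('k::field_char_0, 'n::finite) laurent set"
  assumes R: "is_subring R" and R_const: "\<And>c. const c \<in> R" and prime: "prime_on \<pp> R"
begin

abbreviation A :: "('k, 'n) laurent fract set" where "A \<equiv> local_ring R \<pp>"

lemma in_A: "f \<in> R \<Longrightarrow> g \<in> R \<Longrightarrow> g \<notin> \<pp> \<Longrightarrow> Fract f g \<in> A"
  by (auto simp: local_ring_def)

lemma A_cases:
  assumes "z \<in> A" obtains f g where "f \<in> R" "g \<in> R" "g \<notin> \<pp>" "g \<noteq> 0" "z = Fract f g"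
  using assms prime_onD(2)[OF prime] by (auto simp: local_ring_def)

lemma embed_in_A: "f \<in> R \<Longrightarrow> embed f \<in> A"
  unfolding embed_def using is_subringD(1)[OF R] prime_onD(5)[OF prime] by (intro in_A)

sublocale subalgebra fconst A
proof
  show "fconst 0 = (0 :: ('k, 'n) laurent fract)" "fconst 1 = (1 :: ('k, 'n) laurent fract)"
    "fconst (c + d) = (fconst c + fconst d :: ('k, 'n) laurent fract)"
    "fconst (c * d) = (fconst c * fconst d :: ('k, 'n) laurent fract)" for c d
    by (simp_all add: const_hom Zero_fract_def One_fract_def)
  show "fconst c \<in> A" for c using embed_in_A[OF R_const] by (simp add: embed_def)
  fix a b assume "a \<in> A" "b \<in> A"
  then obtain f g f' g' where *: "f \<in> R" "g \<in> R" "g \<notin> \<pp>" "g \<noteq> 0" "a = Fract f g"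
    "f' \<in> R" "g' \<in> R" "g' \<notin> \<pp>" "g' \<noteq> 0" "b = Fract f' g'" by (metis A_cases)
  then have "g * g' \<notin> \<pp>" using prime_onD(6)[OF prime] by blast
  with * show "a + b \<in> A" "a * b \<in> A" using is_subringD[OF R] by (auto intro!: in_A)
qed

text \<open>Numerators are not unique. A second presentation f' / g' of the inverse gives g g' = f'
  f, whose left side is outside the prime, and so \<open>f\<close> is outside as well.\<close>

lemma Units_Fract:
  assumes "f \<in> R" "g \<in> R" "g \<notin> \<pp>"
  shows "Fract f g \<in> Units alg \<longleftrightarrow> f \<notin> \<pp>"
proof
  have g0: "g \<noteq> 0" using assms(3) prime_onD(2)[OF prime] by blast
  assume "Fract f g \<in> Units alg"
  then have "Fract g f \<in> A" "Fract f g \<noteq> 0" by (auto simp: Units_alg)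
  then have f0: "f \<noteq> 0" using g0 by (auto simp: Zero_fract_def eq_fract)
  obtain f' g' where *: "f' \<in> R" "g' \<in> R" "g' \<notin> \<pp>" "g' \<noteq> 0" "Fract g f = Fract f' g'"
    using A_cases[OF \<open>Fract g f \<in> A\<close>] by metis
  then have "g * g' = f' * f" using f0 by (simp add: eq_fract)
  moreover have "g * g' \<notin> \<pp>" using prime_onD(6)[OF prime] assms * by blast
  ultimately show "f \<notin> \<pp>" using prime_onD(4)[OF prime \<open>f' \<in> R\<close>] by metis
next
  assume f: "f \<notin> \<pp>"
  have "g \<noteq> 0" "f \<noteq> 0" using assms(3) f prime_onD(2)[OF prime] by blast+
  then show "Fract f g \<in> Units alg"
    using in_A[OF assms] in_A[OF assms(2,1) f] by (simp add: Units_alg Zero_fract_def eq_fract)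
qed

sublocale local_subalgebra fconst A
proof
  fix a b assume ab: "a \<in> max_ideal alg" "b \<in> max_ideal alg"
  then have "a \<in> A" "b \<in> A" by auto
  then obtain f g f' g' where *: "f \<in> R" "g \<in> R" "g \<notin> \<pp>" "g \<noteq> 0" "a = Fract f g"
    "f' \<in> R" "g' \<in> R" "g' \<notin> \<pp>" "g' \<noteq> 0" "b = Fract f' g'" by (metis A_cases)
  then have "f \<in> \<pp>" "f' \<in> \<pp>" using ab Units_Fract by auto
  then have n: "g' * f + g * f' \<in> \<pp>" using prime_onD(3,4)[OF prime] * by simp
  have d: "g * g' \<notin> \<pp>" using prime_onD(6)[OF prime] * by blast
  have "a + b = Fract (g' * f + g * f') (g * g')" using * by (simp add: mult.commute)
  then show "a + b \<in> max_ideal alg"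
    using n d * is_subringD[OF R] in_A Units_Fract[of "g' * f + g * f'" "g * g'"] by auto
qed

lemma embed_mm_iff: "f \<in> R \<Longrightarrow> embed f \<in> mm \<longleftrightarrow> f \<in> \<pp>"
  using Units_Fract[of f 1] embed_in_A[of f] is_subringD(1)[OF R] prime_onD(5)[OF prime]
  by (simp add: mm_def embed_def)

lemma alg_eq: "algebra_on A = alg"
  by (simp add: algebra_on_def alg_def)

end

lemma embed_hom: "embed 0 = 0" "embed 1 = 1" "embed (f + g) = embed f + embed g" "embed (f * g) = embed f * embed g"
  by (simp_all add: embed_def Zero_fract_def One_fract_def)

lemma embed_eq_0_iff: "embed f = 0 \<longleftrightarrow> f = 0"
  by (simp add: embed_def Zero_fract_def eq_fract)

lemma embed_sum: "embed (sum f S) = (\<Sum>i\<in>S. embed (f i))"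
  by (induction S rule: infinite_finite_induct) (auto simp: embed_hom)

lemma embed_prod: "embed (prod f S) = (\<Prod>i\<in>S. embed (f i))"
  by (induction S rule: infinite_finite_induct) (auto simp: embed_hom)

lemma embed_power: "embed (f ^ n) = embed f ^ n"
  by (induction n) (auto simp: embed_hom)

text \<open>For a lattice basis, the semigroup freely generated by it; its semigroup algebra is the
  polynomial ring in the basis monomials.\<close>

definition lattice_cone :: "(int ^ 'n) set \<Rightarrow> (int ^ 'n) set"
  where "lattice_cone B = {m. \<forall>e\<in>B. 0 \<le> coord B m e}"

section \<open>Coordinates in a lattice basis\<close>

locale lattice =
  fixes B :: "(int ^ 'n::finite) set"
  assumes lattice_basis: "lattice_basis B"
begin

lemma finite_B: "finite B"
  using lattice_basis by (simp add: lattice_basis_def)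

lemma ex1_coordinates: "\<exists>!c. coordinates B m c"
  using lattice_basis by (simp add: lattice_basis_def)

lemma coord_coordinates: "coordinates B m (coord B m)"
  unfolding coord_def by (rule theI'[OF ex1_coordinates])

lemma coord_unique: "coordinates B m c \<Longrightarrow> coord B m = c"
  unfolding coord_def by (rule the1_equality[OF ex1_coordinates])

lemma coord_expansion: "m = (\<Sum>e\<in>B. coord B m e *s e)"
  using coord_coordinates[of m] by (simp add: coordinates_def)

lemma coord_outside: "e \<notin> B \<Longrightarrow> coord B m e = 0"
  using coord_coordinates[of m] by (simp add: coordinates_def)

lemma coord_add: "coord B (a + b) e = coord B a e + coord B b e"
proof -
  have "coordinates B (a + b) (\<lambda>e. coord B a e + coord B b e)"
    unfolding coordinates_def using coord_outside coord_expansion[of a] coord_expansion[of b]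
    by (auto simp: vector_sadd_rdistrib sum.distrib)
  then show ?thesis using coord_unique by metis
qed

lemma coord_zero: "coord B 0 e = 0"
  using coord_add[of 0 0 e] by simp

lemma coord_uminus: "coord B (- a) e = - coord B a e"
  using coord_add[of a "- a" e] by (simp add: coord_zero)

lemma coord_diff: "coord B (a - b) e = coord B a e - coord B b e"
  using coord_add[of a "- b" e] by (simp add: coord_uminus)

lemma coord_combination:
  assumes "\<And>e. e \<notin> B \<Longrightarrow> c e = 0"
  shows "coord B (\<Sum>e\<in>B. c e *s e) = c"
  by (rule coord_unique) (use assms in \<open>simp add: coordinates_def\<close>)

lemma coord_basis: "e' \<in> B \<Longrightarrow> coord B e' e = (if e = e' then 1 else 0)"
proof -
  assume e': "e' \<in> B"
  have "(\<Sum>e\<in>B. (if e = e' then 1 else 0) *s e) = (\<Sum>e\<in>B. if e = e' then e else 0)"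
    by (rule sum.cong) auto
  also have "\<dots> = e'" using e' finite_B by simp
  finally have *: "(\<Sum>e\<in>B. (if e = e' then 1 else 0) *s e) = e'" .
  have "coord B (\<Sum>e\<in>B. (if e = e' then 1 else 0) *s e) = (\<lambda>e. if e = e' then 1 else 0)"
    by (rule coord_combination) (use e' in auto)
  then have "coord B e' = (\<lambda>e. if e = e' then 1 else 0)" by (simp only: *)
  then show ?thesis by simp
qed

lemma coord_inject: "(\<And>e. e \<in> B \<Longrightarrow> coord B a e = coord B b e) \<Longrightarrow> a = b"
  by (subst coord_expansion[of a], subst coord_expansion[of b]) simp

lemma cone_zero: "0 \<in> lattice_cone B"
  by (simp add: lattice_cone_def coord_zero)

lemma cone_add: "a \<in> lattice_cone B \<Longrightarrow> b \<in> lattice_cone B \<Longrightarrow> a + b \<in> lattice_cone B"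
  by (simp add: lattice_cone_def coord_add)

lemma basis_in_cone: "e \<in> B \<Longrightarrow> e \<in> lattice_cone B"
  by (simp add: lattice_cone_def coord_basis)

lemma monomial_scale: "monomial (int n *s e) = monomial e ^ n"
proof (induction n)
  case (Suc n)
  have "int (Suc n) *s e = e + int n *s e" by (simp add: vector_sadd_rdistrib)
  with Suc show ?case by (simp add: monomial_add)
qed (simp add: monomial_0)

lemma monomial_prod:
  assumes "m \<in> lattice_cone B"
  shows "(monomial m :: ('k::comm_ring_1, 'n) laurent) = (\<Prod>e\<in>B. monomial e ^ nat (coord B m e))"
proof -
  have "(monomial (\<Sum>e\<in>F. coord B m e *s e) :: ('k, 'n) laurent) = (\<Prod>e\<in>F. monomial e ^ nat (coord B m e))" if "finite F" "F \<subseteq> B" for F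
    using that
  proof (induction F rule: finite_induct)
    case (insert e F)
    then have "0 \<le> coord B m e" using assms by (simp add: lattice_cone_def)
    then have "(monomial (coord B m e *s e) :: ('k, 'n) laurent) = monomial e ^ nat (coord B m e)"
      using monomial_scale[of "nat (coord B m e)" e] by simp
    with insert show ?case by (simp add: monomial_add)
  qed (simp add: monomial_0)
  from this[OF finite_B order.refl] show ?thesis by (simp flip: coord_expansion)
qed

end

section \<open>The local ring at a point of a smooth chart as a coordinate algebra\<close>

locale lattice_chart = lattice B for B :: "(int ^ 'n::finite) set" +
  fixes \<pp> :: "('k::field_char_0, 'n) laurent set"
  assumes prime_chart: "prime_on \<pp> (monomial_span (lattice_cone B))"
begin

sublocale prime_localization "monomial_span (lattice_cone B)" \<pp>
  by unfold_locales (auto intro: monomial_span_subring const_in_span cone_zero cone_add prime_chart)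

definition x :: "int ^ 'n \<Rightarrow> ('k, 'n) laurent fract" where "x e = embed (monomial e)"

definition wt :: "int ^ 'n \<Rightarrow> int ^ 'n \<Rightarrow> 'k" where "wt e m = of_int (coord B m e)"

text \<open>The partial derivative d/dx_e: the Euler operator x_e d/dx_e is diagonal on monomials,
  and its factor x_e is divided out in the function field.\<close>

definition der :: "int ^ 'n \<Rightarrow> ('k, 'n) laurent fract \<Rightarrow> ('k, 'n) laurent fract"
  where "der e z = inverse (x e) * fderiv (euler (wt e)) z"

lemma wt_add: "wt e (a + b) = wt e a + wt e b"
  by (simp add: wt_def coord_add)

lemmas euler_wt_mult = euler_mult[of "wt e" for e, OF wt_add]

lemma fderiv_const: "fderiv (euler (wt e)) (fconst c) = 0"
proof -
  have 1: "euler (wt e) (const c) = 0" for c :: 'k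
    using euler_single[of "wt e" c 0] by (simp add: monomial_0 wt_def coord_zero const_hom)
  show ?thesis
    using fderiv_Fract[of "euler (wt e)" 1 "const c", OF euler_add euler_wt_mult] 1[of c] 1[of 1]
    by (simp add: const_hom Zero_fract_def eq_fract)
qed

lemma x_nonzero: "x e \<noteq> 0"
  by (simp add: x_def embed_eq_0_iff monomial_nonzero)

lemma der_in_A:
  assumes e: "e \<in> B" and z: "z \<in> A"
  shows "der e z \<in> A"
proof -
  \<comment> \<open>The Euler operator kills the exponents with e-coordinate 0; from all others
    \<open>e\<close> can be subtracted within the cone.\<close>
  have div: "\<exists>h\<in>monomial_span (lattice_cone B). euler (wt e) f = monomial e * h"
    if f: "f \<in> monomial_span (lattice_cone B)" for f :: "('k, 'n) laurent"
  proof
    let ?h = "euler (wt e) f * monomial (- e)"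
    have "monomial e * ?h = (monomial e * monomial (- e)) * euler (wt e) f" by (simp only: mult_ac)
    then show "euler (wt e) f = monomial e * ?h" by (simp add: monomial_inverse)
    show "?h \<in> monomial_span (lattice_cone B)"
      unfolding monomial_span_iff lcoeff_mult_monomial
    proof (intro allI impI)
      fix m assume nz: "lcoeff (euler (wt e) f) (m - - e) \<noteq> 0"
      then have "m + e \<in> lattice_cone B" "coord B (m + e) e \<noteq> 0" using f by (auto simp: monomial_span_iff wt_def)
      then have "0 \<le> coord B m e'" if "e' \<in> B" for e'
        using that e by (cases "e' = e") (force simp: lattice_cone_def coord_add coord_basis)+
      then show "m \<in> lattice_cone B" by (simp add: lattice_cone_def)
    qed
  qed
  obtain f g where fg: "f \<in> monomial_span (lattice_cone B)" "g \<in> monomial_span (lattice_cone B)" "g \<notin> \<pp>" "g \<noteq> 0" "z = Fract f g"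
    using A_cases[OF z] by metis
  obtain f' g' where f': "f' \<in> monomial_span (lattice_cone B)" "euler (wt e) f = monomial e * f'"
    and g': "g' \<in> monomial_span (lattice_cone B)" "euler (wt e) g = monomial e * g'" using div fg by metis
  have "der e z = inverse (x e) * Fract (monomial e * (g * f' - f * g')) (g * g)"
    unfolding der_def fg(5) fderiv_Fract[of "euler (wt e)", OF euler_add euler_wt_mult fg(4)] f'(2) g'(2)
    by (simp add: algebra_simps)
  also have "\<dots> = Fract (g * f' - f * g') (g * g)"
    using fg(4) by (simp add: x_def embed_def eq_fract monomial_nonzero)
  also have "\<dots> \<in> A"
    using fg(1-3) f'(1) g'(1) prime_onD(6)[OF prime_chart fg(2) fg(2)]
    by (intro in_A is_subringD(5,6)[OF R]) auto
  finally show ?thesis .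
qed

sublocale coordinate_algebra fconst A B x der
proof
  show "finite B" by (rule finite_B)
  fix e assume e: "e \<in> B"
  show "x e \<in> A" unfolding x_def using e by (intro embed_in_A monomial_in_span basis_in_cone)
  have m: "der e (a * b) = a * der e b + der e a * b" for a b
    unfolding der_def using fderiv_mult[of "euler (wt e)" a b, OF euler_add euler_wt_mult] by (simp add: algebra_simps)
  then show "der e (a * b) = a * der e b + der e a * b" for a b .
  show "lin (der e)"
    unfolding lin_def
  proof (intro conjI ballI allI)
    show "der e (a + b) = der e a + der e b" for a b
      unfolding der_def using fderiv_add[of "euler (wt e)" a b, OF euler_add euler_wt_mult] by (simp add: algebra_simps)
    show "der e (fconst c * a) = fconst c * der e a" for c a
      unfolding m using fderiv_const by (simp add: der_def)
  qed (rule der_in_A[OF e])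
  fix e' assume e': "e' \<in> B"
  have "euler (wt e) (monomial e') = const (if e = e' then 1 else 0) * monomial e'"
    using euler_single[of "wt e" 1 e'] e' by (simp add: const_hom wt_def coord_basis)
  moreover have "euler (wt e) 1 = 0"
    using euler_single[of "wt e" 1 0] by (simp add: const_hom monomial_0 wt_def coord_zero)
  ultimately have "fderiv (euler (wt e)) (x e') = (if e = e' then x e else 0)"
    using fderiv_Fract[of "euler (wt e)" 1 "monomial e'", OF euler_add euler_wt_mult]
    by (auto simp: x_def embed_def const_hom Zero_fract_def eq_fract)
  then show "der e (x e') = (if e = e' then 1 else 0)" by (auto simp: der_def x_nonzero)
qed

abbreviation exps :: "int ^ 'n \<Rightarrow> int ^ 'n \<Rightarrow> int ^ 'n \<Rightarrow> nat"
  where "exps v u e \<equiv> nat (coord B (u - v) e)"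

lemma mon_exps:
  assumes "u - v \<in> lattice_cone B"
  shows "mon (exps v u) * embed (monomial v) = embed (monomial u)"
proof -
  have "mon (exps v u) = embed (monomial (u - v))"
    unfolding mon_def x_def monomial_prod[OF assms] embed_prod embed_power ..
  then show ?thesis by (simp flip: embed_hom(4) monomial_add)
qed

text \<open>Relative to the generator x^v, the section x^u is the coordinate monomial with the
  exponents of u - v; distinct lattice points give linearly independent sections.\<close>

theorem stalk_order_le_iff:
  assumes Q: "finite Q" "\<And>u. u \<in> Q \<Longrightarrow> u - v \<in> lattice_cone B"
  shows "stalk_injectivity_order A ((\<lambda>f. f * embed (monomial v)) ` A) (embed ` monomial_span Q) \<le> enat l
    \<longleftrightarrow> crit Q (exps v) l"
proof -
  have eq: "(\<Sum>u\<in>Q. fconst (c u) * (mon (exps v u) * embed (monomial v)))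
      = embed (\<Sum>u\<in>Q. const (c u) * monomial u)" for c
    unfolding embed_sum embed_hom using mon_exps[OF Q(2)] by (intro sum.cong) (auto simp: embed_def)
  have lc: "lcoeff (\<Sum>u\<in>Q. const (c u) * monomial u) m = (if m \<in> Q then c m else 0)" for c m
  proof -
    have "lcoeff (\<Sum>u\<in>Q. const (c u) * monomial u) m = (\<Sum>u\<in>Q. if m = u then c u else 0)"
      unfolding lcoeff_sum by (intro sum.cong) (auto simp: lcoeff_const_monomial)
    then show ?thesis using Q(1) by simp
  qed
  have V: "embed ` monomial_span Q = range (\<lambda>c. \<Sum>u\<in>Q. fconst (c u) * (mon (exps v u) * embed (monomial v)))"
    unfolding eq
  proof (intro equalityI subsetI)
    fix z :: "('k, 'n) laurent fract" assume "z \<in> embed ` monomial_span Q"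
    then obtain f where f: "f \<in> monomial_span Q" "z = embed f" by blast
    have exp: "f = (\<Sum>u\<in>Q. const (lcoeff f u) * monomial u)"
      by (rule laurent_eqI) (use f(1) in \<open>auto simp: lc monomial_span_iff\<close>)
    show "z \<in> range (\<lambda>c. embed (\<Sum>u\<in>Q. const (c u) * monomial u))"
      by (rule range_eqI[where x = "lcoeff f"]) (rule HOL.trans[OF f(2) arg_cong[OF exp, of embed]])
  next
    fix z :: "('k, 'n) laurent fract" assume "z \<in> range (\<lambda>c. embed (\<Sum>u\<in>Q. const (c u) * monomial u))"
    then show "z \<in> embed ` monomial_span Q" by (auto simp: monomial_span_iff lc split: if_splits)
  qed
  have g0: "embed (monomial v) \<noteq> (0 :: ('k, 'n) laurent fract)" by (simp add: embed_eq_0_iff monomial_nonzero)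
  show ?thesis
    unfolding stalk_injectivity_order_def alg_eq
  proof (rule injectivity_order_le_iff[OF g0 Q(1) V])
    fix c u assume "(\<Sum>u\<in>Q. fconst (c u) * (mon (exps v u) * embed (monomial v))) = 0" "u \<in> Q"
    then show "c u = 0" unfolding eq embed_eq_0_iff using lc[of c u] by simp
  qed
qed

end

section \<open>Lattice polytopes at a vertex\<close>

text \<open>
  The proof uses the vertex figure: a hyperplane separating \<open>v\<close> from the other vertices cuts \<open>P\<close> in
  a polytope whose extreme points lie on the edges through \<open>v\<close>.
\<close>

lemma polytope_vertex_cone:
  fixes P :: "'a::euclidean_space set"
  assumes P: "polytope P" and v: "v extreme_point_of P" and X: "convex X"
    and scale: "\<And>y t. y \<in> X \<Longrightarrow> 0 \<le> t \<Longrightarrow> v + t *\<^sub>R (y - v) \<in> X"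
    and edges: "\<And>E. E edge_of P \<Longrightarrow> v \<in> E \<Longrightarrow> E \<subseteq> X" and vX: "v \<in> X"
  shows "P \<subseteq> X"
proof -
  define W where "W = {w. w extreme_point_of P} - {v}"
  have hull: "P = convex hull {x. x extreme_point_of P}"
    using P by (intro Krein_Milman_Minkowski polytope_imp_compact polytope_imp_convex)
  have W_ins: "{x. x extreme_point_of P} = insert v W" using v by (auto simp: W_def)
  obtain S where S: "finite S" "P = convex hull S" using P by (auto simp: polytope_def)
  then have "W \<subseteq> S" using extreme_points_of_convex_hull[of S] by (auto simp: W_def)
  then have "finite W" using S(1) finite_subset by blast
  \<comment> \<open>Vertices of polyhedra are exposed, which supplies the functional
    \<open>a\<close> of the separating hyperplane.\<close>
  have "{v} exposed_face_of P"
    using v exposed_face_of_polyhedron[OF polytope_imp_polyhedron[OF P]] by (simp add: face_of_singleton)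
  then obtain a b where ab: "P \<subseteq> {x. a \<bullet> x \<le> b}" "{v} = P \<inter> {x. a \<bullet> x = b}"
    unfolding exposed_face_of_def by blast
  have av: "a \<bullet> v = b" using ab(2) by blast
  have aW: "a \<bullet> w < b" if "w \<in> W" for w
  proof -
    have "w \<in> P" "w \<noteq> v" using that by (auto simp: W_def extreme_point_of_def)
    then have "a \<bullet> w \<le> b" "a \<bullet> w \<noteq> b" using ab by blast+
    then show ?thesis by simp
  qed
  show ?thesis
  proof (cases "W = {}")
    case True
    from hull have "P = {v}" unfolding W_ins True convex_hull_singleton .
    then show ?thesis using vX by simp
  next
    case False
    define c0 where "c0 = Max ((\<lambda>w. a \<bullet> w) ` W)"
    have c0: "a \<bullet> w \<le> c0" if "w \<in> W" for w unfolding c0_def using \<open>finite W\<close> that by simp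
    have "c0 < b" unfolding c0_def using \<open>finite W\<close> False aW by simp
    define c where "c = (c0 + b) / 2"
    have c: "c0 < c" "c < b" using \<open>c0 < b\<close> by (auto simp: c_def)
    define H where "H = {x. a \<bullet> x = c}"
    have "polytope (P \<inter> H)" unfolding H_def by (intro polytope_Int_polyhedron P polyhedron_hyperplane)
    then have hullQ: "P \<inter> H = convex hull {x. x extreme_point_of (P \<inter> H)}"
      by (intro Krein_Milman_Minkowski polytope_imp_compact polytope_imp_convex)
    have ext: "q \<in> X" if q: "q extreme_point_of (P \<inter> H)" for q
    proof -
      have qP: "q \<in> P" "a \<bullet> q = c" using q by (auto simp: extreme_point_of_def H_def)
      \<comment> \<open>The smallest face through \<open>q\<close>; then \<open>q\<close> lies in
        its relative interior. It will turn out to be an edge through \<open>v\<close>.\<close>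
      define G where "G = \<Inter>{F. F face_of P \<and> q \<in> F}"
      have GP: "G face_of P" unfolding G_def
        using qP P by (intro face_of_Inter) (auto intro!: exI[of _ P] face_of_refl polytope_imp_convex)
      have qG: "q \<in> G" by (auto simp: G_def)
      have G: "polytope G" using P GP by (rule face_of_polytope_polytope)
      have "q \<in> rel_interior G"
      proof (rule ccontr)
        assume "q \<notin> rel_interior G"
        then have "q \<in> rel_frontier G" using qG closure_subset by (auto simp: rel_frontier_def)
        then obtain F where F: "F face_of G" "F \<noteq> G" "q \<in> F"
          using rel_frontier_of_polyhedron_alt[OF polytope_imp_polyhedron[OF G]] by auto
        then have "F face_of P" using GP face_of_trans by blast
        then have "G \<subseteq> F" unfolding G_def using F(3) by blast
        then show False using F(1,2) face_of_imp_subset by blast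
      qed
      then obtain \<epsilon> where \<epsilon>: "\<epsilon> > 0" "cball q \<epsilon> \<inter> affine hull G \<subseteq> G" using mem_rel_interior_cball by blast
      \<comment> \<open>A face that misses \<open>v\<close> is spanned by vertices where
        \<open>a\<close> is at most \<open>c0 < c\<close>, so it cannot contain
        \<open>q\<close>.\<close>
      have "v \<in> G"
      proof (rule ccontr)
        assume "v \<notin> G"
        have "G = convex hull {x. x extreme_point_of G}"
          using G by (intro Krein_Milman_Minkowski polytope_imp_compact polytope_imp_convex)
        also have "\<dots> \<subseteq> {x. a \<bullet> x \<le> c0}"
        proof (rule hull_minimal)
          show "{x. x extreme_point_of G} \<subseteq> {x. a \<bullet> x \<le> c0}"
            using extreme_point_of_face[OF GP] \<open>v \<notin> G\<close> c0 by (auto simp: W_def)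
        qed (rule convex_halfspace_le)
        finally show False using qG qP(2) c(1) by auto
      qed
      \<comment> \<open>In dimension at least 2 the hyperplane would cut the face in a set
        containing a segment centred at \<open>q\<close>, and \<open>q\<close> would not be extreme
        in the vertex figure.\<close>
      have "aff_dim G \<le> 1"
      proof (rule ccontr)
        assume "\<not> ?thesis"
        moreover have "\<not> affine hull G \<subseteq> {x. a \<bullet> x = c}"
          using \<open>v \<in> G\<close> av c(2) hull_inc[of v G affine] by auto
        moreover have "q \<in> affine hull G \<inter> {x. a \<bullet> x = c}" using qG qP(2) hull_inc[of q G affine] by auto
        ultimately have "aff_dim (affine hull G \<inter> {x. a \<bullet> x = c}) \<ge> 1"
          using aff_dim_affine_Int_hyperplane[of "affine hull G" a c] by auto
        then have "affine hull G \<inter> {x. a \<bullet> x = c} \<noteq> {q}" by (metis aff_dim_sing not_one_le_zero)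
        then obtain y where y: "y \<in> affine hull G" "a \<bullet> y = c" "y \<noteq> q"
          using \<open>q \<in> affine hull G \<inter> _\<close> by blast
        define \<delta> where "\<delta> = \<epsilon> / norm (y - q)"
        have \<delta>: "\<delta> > 0" using y(3) \<epsilon>(1) by (simp add: \<delta>_def)
        have pm: "q + s *\<^sub>R (y - q) \<in> P \<inter> H" if "\<bar>s\<bar> \<le> \<delta>" for s
        proof -
          have "(1 - s) *\<^sub>R q + s *\<^sub>R y \<in> affine hull G"
            using y(1) qG by (intro mem_affine[OF affine_affine_hull]) (auto intro: hull_inc)
          moreover have "(1 - s) *\<^sub>R q + s *\<^sub>R y = q + s *\<^sub>R (y - q)" by (simp add: algebra_simps)
          moreover have "\<bar>s\<bar> * norm (y - q) \<le> \<epsilon>" using that y(3) by (simp add: \<delta>_def pos_le_divide_eq)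
          then have "norm (s *\<^sub>R (y - q)) \<le> \<epsilon>" by (simp only: norm_scaleR)
          then have "q + s *\<^sub>R (y - q) \<in> cball q \<epsilon>" by (simp add: dist_norm)
          ultimately have "q + s *\<^sub>R (y - q) \<in> G" using \<epsilon>(2) by auto
          then show ?thesis using GP face_of_imp_subset y(2) qP(2) by (auto simp: H_def inner_add_right inner_diff_right)
        qed
        have "q \<in> open_segment (q + (- \<delta>) *\<^sub>R (y - q)) (q + \<delta> *\<^sub>R (y - q))"
          unfolding in_segment
        proof (intro conjI exI[of _ "1 / 2"])
          show "q + (- \<delta>) *\<^sub>R (y - q) \<noteq> q + \<delta> *\<^sub>R (y - q)" using \<delta> y(3)
            by (simp add: scaleR_left.minus[symmetric] del: scaleR_minus_left)
          show "q = (1 - 1 / 2) *\<^sub>R (q + (- \<delta>) *\<^sub>R (y - q)) + (1 / 2) *\<^sub>R (q + \<delta> *\<^sub>R (y - q))"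
            using scaleR_half_double[of q] by (simp flip: scaleR_add_right)
        qed auto
        then show False using q pm[of "- \<delta>"] pm[of \<delta>] \<delta> unfolding extreme_point_of_def by auto
      qed
      moreover have "aff_dim G \<noteq> 0" using qG \<open>v \<in> G\<close> av qP(2) c(2) by (auto simp: aff_dim_eq_0)
      moreover have "aff_dim G \<noteq> - 1" using qG aff_dim_empty[of G] by auto
      ultimately have "aff_dim G = 1" using aff_dim_geq[of G] by linarith
      then show ?thesis using edges[of G] GP \<open>v \<in> G\<close> qG by (auto simp: edge_of_def)
    qed
    have QX: "P \<inter> H \<subseteq> X"
      by (subst hullQ) (rule hull_minimal, use ext X in auto)
    show ?thesis
    proof
      fix p assume p: "p \<in> P"
      then obtain u y where y: "0 \<le> u" "u \<le> 1" "y \<in> convex hull W" "p = (1 - u) *\<^sub>R v + u *\<^sub>R y"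
        using hull W_ins False convex_hull_insert_alt[of v W] by auto
      have "convex hull W \<subseteq> {x. a \<bullet> x \<le> c0}"
        by (rule hull_minimal) (use c0 convex_halfspace_le in auto)
      then have ay: "a \<bullet> y < c" using y(3) c(1) by auto
      have "W \<subseteq> P" by (auto simp: W_def extreme_point_of_def)
      then have yP: "y \<in> P" using y(3) hull_minimal[of W P convex] polytope_imp_convex[OF P] by auto
      have vP: "v \<in> P" using v by (simp add: extreme_point_of_def)
      \<comment> \<open>The parameter at which the segment from \<open>v\<close> to \<open>y\<close>
        crosses the hyperplane. The point \<open>p\<close> lies on the ray from \<open>v\<close>
        through the crossing point \<open>z\<close>, at ratio \<open>u / s\<close>.\<close>
      define s where "s = (b - c) / (b - a \<bullet> y)"
      have s: "0 < s" "s < 1" using ay c(2) by (auto simp: s_def field_simps)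
      define z where "z = (1 - s) *\<^sub>R v + s *\<^sub>R y"
      have "z \<in> P" unfolding z_def using s vP yP polytope_imp_convex[OF P] by (intro convexD_alt) auto
      moreover have "a \<bullet> z = c"
      proof -
        have "s * (b - a \<bullet> y) = b - c" using ay c(2) by (simp add: s_def)
        then show ?thesis by (simp add: z_def inner_add_right av algebra_simps)
      qed
      ultimately have "z \<in> X" using QX by (auto simp: H_def)
      then have "v + (u / s) *\<^sub>R (z - v) \<in> X" using y(1) s(1) by (intro scale) auto
      moreover have zv: "z - v = s *\<^sub>R (y - v)" by (simp add: z_def algebra_simps)
      have "v + (u / s) *\<^sub>R (z - v) = v + u *\<^sub>R (y - v)" unfolding zv using s(1) by simp
      then have "v + (u / s) *\<^sub>R (z - v) = p" by (simp add: y(4) algebra_simps)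
      ultimately show "p \<in> X" by simp
    qed
  qed
qed

section \<open>Lattice points and real extensions of additive functions\<close>

lemma lattice_pt_add: "lattice_pt (a + b) = lattice_pt a + lattice_pt b"
  by (simp add: lattice_pt_def vec_eq_iff)

lemma lattice_pt_diff: "lattice_pt (a - b) = lattice_pt a - lattice_pt b"
  by (simp add: lattice_pt_def vec_eq_iff)

lemma lattice_pt_eq_iff: "lattice_pt a = lattice_pt b \<longleftrightarrow> a = b"
  by (simp add: lattice_pt_def vec_eq_iff)

lemma lattice_pt_zero: "lattice_pt 0 = 0"
  by (simp add: lattice_pt_def vec_eq_iff)

lemma finite_lattice_points:
  assumes "bounded P"
  shows "finite (lattice_points P)"
proof -
  obtain N where N: "\<And>y. y \<in> P \<Longrightarrow> norm y \<le> N" using assms by (auto simp: bounded_iff)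
  have "vec_nth m \<in> PiE UNIV (\<lambda>_. {- \<lceil>N\<rceil>..\<lceil>N\<rceil>})" if "m \<in> lattice_points P" for m
  proof -
    have "\<bar>m $ i\<bar> \<le> \<lceil>N\<rceil>" for i
    proof -
      have "\<bar>real_of_int (m $ i)\<bar> \<le> N"
        using component_le_norm_cart[of "lattice_pt m" i] N[of "lattice_pt m"] that
        by (simp add: lattice_points_def lattice_pt_def)
      then show ?thesis by linarith
    qed
    then have "m $ i \<in> {- \<lceil>N\<rceil>..\<lceil>N\<rceil>}" for i using abs_le_D1[of "m $ i"] abs_le_D2[of "m $ i"] by fastforce
    then show ?thesis by (intro PiE_I) auto
  qed
  then have "vec_nth ` lattice_points P \<subseteq> PiE UNIV (\<lambda>_. {- \<lceil>N\<rceil>..\<lceil>N\<rceil>})" by blast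
  then have "finite (vec_nth ` lattice_points P)" by (rule finite_subset) (intro finite_PiE, auto)
  then show ?thesis by (rule finite_imageD) (auto intro!: inj_onI simp: vec_nth_inject)
qed

text \<open>The real-linear extension of an additive function on the lattice, built from its values
  on unit vectors; it transports integral coordinates to convexity arguments.\<close>

definition real_extension :: "(int ^ 'n::finite \<Rightarrow> int) \<Rightarrow> real ^ 'n \<Rightarrow> real"
  where "real_extension s y = (\<Sum>i\<in>UNIV. y $ i * real_of_int (s (axis i 1)))"

lemma real_extension_linear: "linear (real_extension s)"
  by (rule linearI) (simp_all add: real_extension_def sum.distrib distrib_right sum_distrib_left mult.assoc)

lemma real_extension_lattice_pt:
  assumes "\<And>a b. s (a + b) = s a + s b"
  shows "real_extension s (lattice_pt m) = of_int (s m)"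
proof -
  have s0: "s 0 = 0" using assms[of 0 0] by simp
  have sm: "s (- a) = - s a" for a using assms[of a "- a"] s0 by simp
  have nat: "s (int n *s a) = int n * s a" for n a
  proof (induction n)
    case (Suc n)
    have "int (Suc n) *s a = a + int n *s a" by (simp add: vector_sadd_rdistrib)
    with Suc show ?case by (simp add: assms algebra_simps)
  qed (simp add: s0)
  have scale: "s (k *s a) = k * s a" for k a
  proof (cases "0 \<le> k")
    case True
    then show ?thesis using nat[of "nat k" a] by simp
  next
    case False
    then have "k *s a = - (int (nat (- k)) *s a)" by (simp add: vec_eq_iff)
    then show ?thesis using False sm nat[of "nat (- k)" a] by simp
  qed
  have sum: "s (\<Sum>i\<in>F. f i) = (\<Sum>i\<in>F. s (f i))" for f and F :: "'a set"
    by (induction F rule: infinite_finite_induct) (auto simp: s0 assms)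
  have "s m = s (\<Sum>i\<in>UNIV. m $ i *s axis i 1)" by (simp add: basis_expansion)
  also have "\<dots> = (\<Sum>i\<in>UNIV. m $ i * s (axis i 1))" by (simp add: sum scale)
  finally show ?thesis by (simp add: real_extension_def lattice_pt_def)
qed

section \<open>Lattice polytopes satisfying the basis condition\<close>

locale smooth_lattice_polytope =
  fixes P :: "(real ^ 'n::finite) set"
  assumes lattice_polytope: "lattice_polytope P" and basis_condition: "basis_condition P"
begin

lemma polytope: "polytope P" and nonempty: "P \<noteq> {}"
  and vertices_lattice: "w extreme_point_of P \<Longrightarrow> w \<in> range lattice_pt"
  using lattice_polytope by (auto simp: lattice_polytope_def)

lemma finite_points: "finite (lattice_points P)"
  by (rule finite_lattice_points[OF polytope_imp_bounded[OF polytope]])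

lemma vertex_point: "m \<in> lattice_vertices P \<Longrightarrow> m \<in> lattice_points P"
  by (simp add: lattice_vertices_def lattice_points_def extreme_point_of_def)

lemma finite_vertices: "finite (lattice_vertices P)"
  using finite_points vertex_point by (meson finite_subset subsetI)

lemma hull_vertices: "P = convex hull (lattice_pt ` lattice_vertices P)"
proof -
  have "{x. x extreme_point_of P} = lattice_pt ` lattice_vertices P"
    using vertices_lattice by (auto simp: lattice_vertices_def)
  then show ?thesis
    using Krein_Milman_Minkowski[OF polytope_imp_compact[OF polytope] polytope_imp_convex[OF polytope]] by simp
qed

lemma vertices_nonempty: "lattice_vertices P \<noteq> {}"
  using hull_vertices nonempty by auto

text \<open>Otherwise all vertices, and with them their convex hull, lie in an open half-space that
  misses \<open>p\<close>.\<close>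

lemma vertex_maximizes:
  assumes s: "\<And>a b. s (a + b) = s a + s b" and p: "p \<in> lattice_points P"
  shows "\<exists>w\<in>lattice_vertices P. s p \<le> (s w :: int)"
proof (rule ccontr)
  assume "\<not> ?thesis"
  then have "lattice_pt ` lattice_vertices P \<subseteq> {y. real_extension s y < of_int (s p)}"
    by (auto simp: real_extension_lattice_pt[OF s])
  moreover have "convex {y. real_extension s y < of_int (s p)}"
    using convex_linear_vimage[OF real_extension_linear, of "{..<of_int (s p)}" s] by (simp add: vimage_def)
  ultimately have "P \<subseteq> {y. real_extension s y < of_int (s p)}"
    by (subst hull_vertices) (rule hull_minimal)
  then show False using p real_extension_lattice_pt[OF s, of p] by (auto simp: lattice_points_def)
qed

text \<open>An edge is collinear and has the vertex as an end point, so it points in a single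
  direction. A shortest lattice vector along it exists because the other end is also a lattice point
  and only finitely many lattice points are available.\<close>

lemma edge_ray:
  assumes m: "m \<in> lattice_vertices P" and E: "E edge_of P" "lattice_pt m \<in> E"
  obtains e where "edge_vector m E e" "\<And>q. q \<in> E \<Longrightarrow> \<exists>t\<ge>0. q - lattice_pt m = t *\<^sub>R lattice_pt e"
proof -
  let ?v = "lattice_pt m"
  have face: "E face_of P" "aff_dim E = 1" using E by (auto simp: edge_of_def)
  have "polytope E" using polytope face(1) by (rule face_of_polytope_polytope)
  then have hull: "E = convex hull {x. x extreme_point_of E}"
    by (intro Krein_Milman_Minkowski polytope_imp_compact polytope_imp_convex)
  have v: "?v extreme_point_of E"
    using m E(2) extreme_point_of_face[OF face(1)] by (simp add: lattice_vertices_def)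
  have "\<exists>w. w extreme_point_of E \<and> w \<noteq> ?v"
  proof (rule ccontr)
    assume "\<not> ?thesis"
    then have ext: "{x. x extreme_point_of E} = {?v}" using v by blast
    from hull have "E = {?v}" unfolding ext convex_hull_singleton .
    then have "aff_dim E = 0" by (simp only: aff_dim_sing)
    then show False using face(2) by simp
  qed
  then obtain w where w: "w extreme_point_of E" "w \<noteq> ?v" by blast
  then obtain w' where w': "w = lattice_pt w'" using extreme_point_of_face[OF face(1)] vertices_lattice by blast
  define Z where "Z = {e. e \<noteq> 0 \<and> lattice_pt (m + e) \<in> E}"
  have "(+) m ` Z \<subseteq> lattice_points P"
    using face_of_imp_subset[OF face(1)] by (auto simp: Z_def lattice_points_def)
  then have "finite ((+) m ` Z)" using finite_points finite_subset by blast
  then have "finite Z" by (rule finite_imageD) simp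
  have "w' - m \<in> Z" using w w' by (auto simp: Z_def extreme_point_of_def)
  define N where "N = Min ((\<lambda>e. norm (lattice_pt e)) ` Z)"
  have "N \<in> (\<lambda>e. norm (lattice_pt e)) ` Z"
    unfolding N_def using \<open>finite Z\<close> \<open>w' - m \<in> Z\<close> by (intro Min_in) auto
  then obtain e where e: "e \<in> Z" "N = norm (lattice_pt e)" by blast
  have "norm (lattice_pt e) \<le> norm (lattice_pt e')" if "e' \<in> Z" for e'
    unfolding e(2)[symmetric] N_def using \<open>finite Z\<close> that by simp
  with e(1) have ev: "edge_vector m E e" by (auto simp: edge_vector_def Z_def)
  have "\<exists>t\<ge>0. q - ?v = t *\<^sub>R lattice_pt e" if q: "q \<in> E" for q
  proof -
    have "collinear E" using face(2) by (simp add: collinear_aff_dim)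
    then obtain u where u: "\<And>x y. x \<in> E \<Longrightarrow> y \<in> E \<Longrightarrow> \<exists>c. x - y = c *\<^sub>R u" unfolding collinear_def by blast
    have eE: "?v + lattice_pt e \<in> E" "e \<noteq> 0" using e(1) by (auto simp: Z_def lattice_pt_add)
    obtain c1 where c1: "q - ?v = c1 *\<^sub>R u" using u[OF q E(2)] by blast
    obtain c2 where "(?v + lattice_pt e) - ?v = c2 *\<^sub>R u" using u[OF eE(1) E(2)] by blast
    then have c2: "lattice_pt e = c2 *\<^sub>R u" by simp
    have "c2 \<noteq> 0" using c2 eE(2) lattice_pt_eq_iff[of e 0] by (auto simp: lattice_pt_zero)
    define t where "t = c1 / c2"
    have t: "q - ?v = t *\<^sub>R lattice_pt e" using c1 c2 \<open>c2 \<noteq> 0\<close> by (simp add: t_def)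
    have "0 \<le> t"
    proof (rule ccontr)
      assume "\<not> 0 \<le> t"
      then have t0: "t < 0" by simp
      \<comment> \<open>For negative \<open>t\<close> the vertex lies strictly between
        \<open>q\<close> and the point reached by \<open>e\<close>; the weight
        \<open>- t / (1 - t)\<close> solves (1 - s) t + s = 0.\<close>
      have "?v \<in> open_segment q (?v + lattice_pt e)"
        unfolding in_segment
      proof (intro conjI exI[of _ "- t / (1 - t)"])
        have q': "q = ?v + t *\<^sub>R lattice_pt e" using t by (simp add: algebra_simps)
        have "lattice_pt e \<noteq> 0" using eE(2) lattice_pt_eq_iff[of e 0] by (simp add: lattice_pt_zero)
        then show "q \<noteq> ?v + lattice_pt e" using t0 scaleR_cancel_right[of t "lattice_pt e" 1] by (simp add: q')
        have k: "1 - - t / (1 - t) = 1 / (1 - t)" using t0 by (simp add: field_simps)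
        have "(1 / (1 - t)) *\<^sub>R (?v + t *\<^sub>R lattice_pt e) + (- t / (1 - t)) *\<^sub>R (?v + lattice_pt e)
          = (1 / (1 - t) + - t / (1 - t)) *\<^sub>R ?v + (t / (1 - t) + - t / (1 - t)) *\<^sub>R lattice_pt e"
          by (simp add: algebra_simps)
        also have "1 / (1 - t) + - t / (1 - t) = 1" using t0 by (simp add: field_simps)
        finally show "?v = (1 - - t / (1 - t)) *\<^sub>R q + (- t / (1 - t)) *\<^sub>R (?v + lattice_pt e)"
          unfolding k q' by simp
      qed (use t0 in \<open>auto simp: field_simps\<close>)
      then show False using v q eE(1) by (auto simp: extreme_point_of_def)
    qed
    with t show ?thesis by blast
  qed
  with ev show thesis by (rule that)
qed

lemma basis_lattice: "m \<in> lattice_vertices P \<Longrightarrow> lattice (edge_basis P m)"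
  using basis_condition by unfold_locales (simp add: basis_condition_def)

lemma basis_point: "e \<in> edge_basis P m \<Longrightarrow> m + e \<in> lattice_points P"
  using edge_of_imp_subset by (auto simp: edge_basis_def edge_vector_def lattice_points_def)

text \<open>Each coordinate functional is nonnegative along the edges at the vertex, since their
  directions are the basis vectors, and these edges span a cone at the vertex that contains the
  polytope.\<close>

theorem points_in_cone:
  assumes m: "m \<in> lattice_vertices P" and p: "p \<in> lattice_points P"
  shows "p - m \<in> lattice_cone (edge_basis P m)"
  unfolding lattice_cone_def
proof (intro CollectI ballI)
  interpret lattice "edge_basis P m" by (rule basis_lattice[OF m])
  fix e assume e: "e \<in> edge_basis P m"
  let ?s = "\<lambda>a. coord (edge_basis P m) a e"
  let ?X = "{y. 0 \<le> real_extension ?s (y - lattice_pt m)}"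
  interpret h: linear "real_extension ?s" by (rule real_extension_linear)
  have s: "real_extension ?s (lattice_pt a) = of_int (?s a)" for a
    by (rule real_extension_lattice_pt) (rule coord_add)
  have "P \<subseteq> ?X"
  proof (rule polytope_vertex_cone[OF polytope])
    show "lattice_pt m extreme_point_of P" using m by (simp add: lattice_vertices_def)
    have "?X = {y. real_extension ?s (lattice_pt m) \<le> real_extension ?s y}" by (simp add: h.diff)
    then show "convex ?X"
      using convex_linear_vimage[OF real_extension_linear, of "{real_extension ?s (lattice_pt m)..}" ?s]
      by (simp add: vimage_def)
    show "lattice_pt m + t *\<^sub>R (y - lattice_pt m) \<in> ?X" if "y \<in> ?X" "0 \<le> t" for y t
      using that by (simp add: h.scaleR)
    show "lattice_pt m \<in> ?X" by (simp add: h.zero)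
    fix E assume E: "E edge_of P" "lattice_pt m \<in> E"
    show "E \<subseteq> ?X"
    proof
      fix q assume q: "q \<in> E"
      obtain e' where e': "edge_vector m E e'" "\<And>q. q \<in> E \<Longrightarrow> \<exists>t\<ge>0. q - lattice_pt m = t *\<^sub>R lattice_pt e'"
        using edge_ray[OF m E] by blast
      then obtain t where t: "t \<ge> 0" "q - lattice_pt m = t *\<^sub>R lattice_pt e'" using q by blast
      have "e' \<in> edge_basis P m" using e'(1) E by (auto simp: edge_basis_def)
      then show "q \<in> ?X" using t by (simp add: h.scaleR s coord_basis)
    qed
  qed
  then have "lattice_pt p \<in> ?X" using p by (auto simp: lattice_points_def)
  then show "0 \<le> coord (edge_basis P m) (p - m) e" by (simp add: s flip: lattice_pt_diff)
qed

text \<open>The generators lie in the cone by \<open>points_in_cone\<close>; conversely, every basis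
  vector is itself a difference of a lattice point of the polytope and the vertex.\<close>

theorem vertex_semigroup_eq:
  assumes m: "m \<in> lattice_vertices P"
  shows "vertex_semigroup P m = lattice_cone (edge_basis P m)"
proof (intro equalityI subsetI)
  interpret lattice "edge_basis P m" by (rule basis_lattice[OF m])
  fix s
  {
    assume "s \<in> vertex_semigroup P m"
    then show "s \<in> lattice_cone (edge_basis P m)"
      unfolding vertex_semigroup_def
      by (induction rule: generated_semigroup.induct) (auto simp: points_in_cone[OF m] cone_add)
  next
    assume s: "s \<in> lattice_cone (edge_basis P m)"
    have zero: "0 \<in> vertex_semigroup P m"
      unfolding vertex_semigroup_def using vertex_point[OF m] by (intro generated_semigroup.gen) force
    have mult: "int n *s e \<in> vertex_semigroup P m" if "e \<in> edge_basis P m" for n e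
    proof (induction n)
      case (Suc n)
      have "e \<in> vertex_semigroup P m"
        unfolding vertex_semigroup_def using basis_point[OF that] by (intro generated_semigroup.gen) force
      with Suc have "e + int n *s e \<in> vertex_semigroup P m"
        unfolding vertex_semigroup_def by (intro generated_semigroup.add)
      then show ?case by (simp add: vector_sadd_rdistrib)
    qed (use zero in simp)
    have "(\<Sum>e\<in>F. coord (edge_basis P m) s e *s e) \<in> vertex_semigroup P m" if "finite F" "F \<subseteq> edge_basis P m" for F
      using that
    proof (induction F rule: finite_induct)
      case (insert e F)
      then have "coord (edge_basis P m) s e *s e \<in> vertex_semigroup P m"
        using s mult[of e "nat (coord (edge_basis P m) s e)"] by (auto simp: lattice_cone_def)
      with insert show ?case unfolding vertex_semigroup_def by (simp add: generated_semigroup.add)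
    qed (use zero in simp)
    from this[OF finite_B order.refl] show "s \<in> vertex_semigroup P m" by (simp flip: coord_expansion)
  }
qed

text \<open>The sum of coordinates is additive, so it is maximised at a vertex.\<close>

lemma vertex_length_maximizes:
  assumes m: "m \<in> lattice_vertices P" and p: "p \<in> lattice_points P"
  shows "\<exists>w\<in>lattice_vertices P. (\<Sum>e\<in>edge_basis P m. coord (edge_basis P m) (p - m) e) \<le> vertex_length P m w"
proof -
  interpret lattice "edge_basis P m" by (rule basis_lattice[OF m])
  let ?s = "\<lambda>a. \<Sum>e\<in>edge_basis P m. coord (edge_basis P m) a e"
  have "?s (a + b) = ?s a + ?s b" for a b by (simp add: coord_add sum.distrib)
  then obtain w where "w \<in> lattice_vertices P" "?s p \<le> ?s w" using vertex_maximizes[of ?s, OF _ p] by blast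
  then show ?thesis by (intro bexI[of _ w]) (simp_all add: coord_diff sum_subtractf vertex_length_def)
qed

end

section \<open>Points of the toric variety and their stalks\<close>

text \<open>\<open>S\<close> arises from \<open>R\<close> by inverting \<open>w\<close>. As
  \<open>w\<close> is a unit of \<open>S\<close>, its powers avoid the prime and may be used to
  clear both numerator and denominator.\<close>

lemma local_ring_localization:
  fixes R S :: "('k::idom, 'n::finite) laurent set"
  assumes R: "is_subring R" "R \<subseteq> S" and \<qq>: "prime_on \<qq> S" and w: "w \<in> R" "w' \<in> S" "w * w' = 1"
    and clear: "\<And>f. f \<in> S \<Longrightarrow> \<exists>N. w ^ N * f \<in> R"
  shows "local_ring R (\<qq> \<inter> R) = local_ring S \<qq>"
proof
  show "local_ring R (\<qq> \<inter> R) \<subseteq> local_ring S \<qq>"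
    using R(2) by (fastforce simp: local_ring_def)
  have wS: "w \<in> S" using w R(2) by blast
  have w_pow: "w ^ N \<notin> \<qq> \<and> w ^ N \<in> R" for N
  proof (induction N)
    case (Suc N)
    have "w \<notin> \<qq>"
    proof
      assume "w \<in> \<qq>"
      then have "w' * w \<in> \<qq>" by (rule prime_onD(4)[OF \<qq> w(2)])
      then show False using w(3) prime_onD(5)[OF \<qq>] by (simp add: mult.commute)
    qed
    then show ?case using Suc prime_onD(6)[OF \<qq> wS, of "w ^ N"] R w(1) is_subringD(5)[OF R(1)] by auto
  qed (use is_subringD[OF R(1)] prime_onD[OF \<qq>] in auto)
  show "local_ring S \<qq> \<subseteq> local_ring R (\<qq> \<inter> R)"
  proof
    fix z assume "z \<in> local_ring S \<qq>"
    then obtain f g where fg: "f \<in> S" "g \<in> S" "g \<notin> \<qq>" "z = Fract f g" by (auto simp: local_ring_def)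
    obtain M N where MN: "w ^ M * f \<in> R" "w ^ N * g \<in> R" using clear fg by metis
    have eq: "w ^ (M + N) * f = w ^ N * (w ^ M * f)" "w ^ (M + N) * g = w ^ M * (w ^ N * g)"
      by (simp_all only: power_add mult_ac)
    have in_R: "w ^ (M + N) * f \<in> R" "w ^ (M + N) * g \<in> R"
      unfolding eq using is_subringD(5)[OF R(1)] w_pow MN by blast+
    have "w ^ (M + N) * g \<notin> \<qq>"
      using prime_onD(6)[OF \<qq> _ fg(2), of "w ^ (M + N)"] w_pow[of "M + N"] R(2) fg(3) by blast
    moreover have "w ^ (M + N) \<noteq> 0" using w_pow[of "M + N"] prime_onD(2)[OF \<qq>] by metis
    then have "z = Fract (w ^ (M + N) * f) (w ^ (M + N) * g)"
      unfolding fg(4) by (rule mult_fract_cancel[symmetric])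
    ultimately show "z \<in> local_ring R (\<qq> \<inter> R)" using in_R by (auto simp: local_ring_def)
  qed
qed

lemma monomial_power: "monomial a ^ n = monomial (int n *s a)"
proof (induction n)
  case (Suc n)
  have "int (Suc n) *s a = a + int n *s a" by (simp add: vector_sadd_rdistrib)
  with Suc show ?case by (simp add: monomial_add)
qed (simp add: monomial_0)

lemma support_monomial: "support (monomial a :: ('k::comm_ring_1, 'n::finite) laurent) = {a}"
  by (auto simp: support_iff lcoeff_monomial split: if_splits)

lemma image_mult_unit:
  fixes A :: "'f::field set"
  assumes "\<And>a b. a \<in> A \<Longrightarrow> b \<in> A \<Longrightarrow> a * b \<in> A" "u \<in> A" "u' \<in> A" "u * u' = 1"
  shows "(\<lambda>f. f * (u * g)) ` A = (\<lambda>f. f * g) ` A"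
proof (intro equalityI subsetI)
  fix z assume "z \<in> (\<lambda>f. f * (u * g)) ` A"
  then obtain f where "f \<in> A" "z = (f * u) * g" by (auto simp: mult.assoc)
  then show "z \<in> (\<lambda>f. f * g) ` A" using assms by blast
next
  fix z assume "z \<in> (\<lambda>f. f * g) ` A"
  then obtain f where f: "f \<in> A" "z = f * g" by blast
  have "f * u' * (u * g) = (u * u') * (f * g)" by (simp only: mult_ac)
  then have "z = (f * u') * (u * g)" using assms(4) f(2) by simp
  then show "z \<in> (\<lambda>f. f * (u * g)) ` A" using assms f(1) by blast
qed

section \<open>Monomial prime ideals of a smooth chart\<close>

context lattice begin

text \<open>The ideal generated by the monomials of \<open>C\<close>, described by supports; in this
  form sums, products and primality can be read off the exponents.\<close>

definition orbit_ideal :: "(int ^ 'n) set \<Rightarrow> ('k::comm_ring_1, 'n) laurent set"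
  where "orbit_ideal C = {f \<in> monomial_span (lattice_cone B). \<forall>s\<in>support f. \<exists>e\<in>C. coord B s e \<noteq> 0}"

lemma chart_subring: "is_subring (monomial_span (lattice_cone B) :: ('k::comm_ring_1, 'n) laurent set)"
  by (intro monomial_span_subring cone_zero cone_add)

lemma orbit_ideal_ideal:
  assumes C: "C \<subseteq> B"
  shows "0 \<in> orbit_ideal C" "f \<in> orbit_ideal C \<Longrightarrow> g \<in> orbit_ideal C \<Longrightarrow> f + g \<in> orbit_ideal C"
    "r \<in> monomial_span (lattice_cone B) \<Longrightarrow> f \<in> orbit_ideal C \<Longrightarrow> r * f \<in> orbit_ideal C"
proof -
  show "0 \<in> orbit_ideal C" by (auto simp: orbit_ideal_def support_iff monomial_span_iff)
next
  assume fg: "f \<in> orbit_ideal C" "g \<in> orbit_ideal C"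
  have "s \<in> support f \<or> s \<in> support g" if "s \<in> support (f + g)" for s
    using that by (auto simp: support_iff)
  then show "f + g \<in> orbit_ideal C"
    using fg is_subringD(4)[OF chart_subring] unfolding orbit_ideal_def by blast
next
  assume r: "r \<in> monomial_span (lattice_cone B)" and f: "f \<in> orbit_ideal C"
  have "\<exists>e\<in>C. coord B s e \<noteq> 0" if s: "s \<in> support (r * f)" for s
  proof -
    obtain a b where ab: "a \<in> support r" "b \<in> support f" "s = a + b" using support_mult[OF s] by blast
    obtain e where e: "e \<in> C" "coord B b e \<noteq> 0" using f ab(2) by (auto simp: orbit_ideal_def)
    have "a \<in> lattice_cone B" "b \<in> lattice_cone B"
      using ab r f by (auto simp: orbit_ideal_def monomial_span_def)
    then have "0 \<le> coord B a e" "0 \<le> coord B b e" using e(1) C by (auto simp: lattice_cone_def)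
    then have "coord B s e \<noteq> 0" using e(2) by (simp add: ab(3) coord_add)
    then show ?thesis using e(1) by blast
  qed
  then show "r * f \<in> orbit_ideal C"
    using is_subringD(5)[OF chart_subring r, of f] f by (simp add: orbit_ideal_def)
qed

lemma orbit_ideal_eq_genideal:
  assumes C: "C \<subseteq> B"
  shows "genideal (ring_on (monomial_span (lattice_cone B))) (monomial ` C) = (orbit_ideal C :: ('k::comm_ring_1, 'n) laurent set)"
proof
  let ?R = "monomial_span (lattice_cone B) :: ('k, 'n) laurent set"
  interpret R: cring "ring_on ?R" by (rule ring_on_cring[OF chart_subring])
  have gens: "(monomial ` C :: ('k, 'n) laurent set) \<subseteq> orbit_ideal C"
  proof
    fix f :: "('k, 'n) laurent" assume "f \<in> monomial ` C"
    then obtain e where e: "e \<in> C" "f = monomial e" by blast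
    then have "coord B e e \<noteq> 0" using C coord_basis by auto
    then show "f \<in> orbit_ideal C"
      using e C basis_in_cone monomial_in_span[of e "lattice_cone B"]
      by (auto simp: orbit_ideal_def support_iff lcoeff_monomial split: if_splits)
  qed
  have carr: "(monomial ` C :: ('k, 'n) laurent set) \<subseteq> carrier (ring_on ?R)"
    using gens by (auto simp: orbit_ideal_def)
  have "ideal (orbit_ideal C) (ring_on ?R)"
  proof (rule ideal_on[OF chart_subring])
    show "orbit_ideal C \<subseteq> ?R" by (auto simp: orbit_ideal_def)
  qed (rule orbit_ideal_ideal[OF C]; assumption)+
  then show "genideal (ring_on ?R) (monomial ` C) \<subseteq> orbit_ideal C"
    using gens by (rule R.genideal_minimal)
  let ?I = "genideal (ring_on ?R) (monomial ` C)"
  have I: "ideal ?I (ring_on ?R)" by (rule R.genideal_ideal[OF carr])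
  have zero: "0 \<in> ?I" using additive_subgroup.zero_closed[OF ideal.axioms(1)[OF I]] by simp
  have add: "a + b \<in> ?I" if "a \<in> ?I" "b \<in> ?I" for a b
    using additive_subgroup.a_closed[OF ideal.axioms(1)[OF I] that] by simp
  have mult: "r * a \<in> ?I" if "r \<in> ?R" "a \<in> ?I" for r a
    using ideal.I_l_closed[OF I that(2), of r] that(1) by simp
  show "orbit_ideal C \<subseteq> ?I"
  proof
    fix f :: "('k, 'n) laurent" assume f: "f \<in> orbit_ideal C"
    have terms: "const (lcoeff f s) * monomial s \<in> ?I" if "s \<in> support f" for s
    proof -
      obtain e where e: "e \<in> C" "coord B s e \<noteq> 0" using f \<open>s \<in> support f\<close> by (auto simp: orbit_ideal_def)
      have s: "s \<in> lattice_cone B" using f \<open>s \<in> support f\<close> by (auto simp: orbit_ideal_def monomial_span_def)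
      \<comment> \<open>The e-coordinate of \<open>s\<close> is nonzero and nonnegative, hence at
        least 1, and \<open>monomial e\<close> can be split off.\<close>
      have "s - e \<in> lattice_cone B"
        unfolding lattice_cone_def
      proof (intro CollectI ballI)
        fix e' assume "e' \<in> B"
        then have "0 \<le> coord B s e'" using s by (simp add: lattice_cone_def)
        then show "0 \<le> coord B (s - e) e'"
          using e C by (cases "e' = e") (auto simp: coord_diff coord_basis subset_iff)
      qed
      then have "const (lcoeff f s) * monomial (s - e) \<in> ?R"
        using is_subringD(5)[OF chart_subring] const_in_span[OF cone_zero] monomial_in_span by blast
      moreover have "monomial e \<in> ?I" using R.genideal_self[OF carr] e(1) by blast
      ultimately have "const (lcoeff f s) * monomial (s - e) * monomial e \<in> ?I" by (rule mult)
      then show ?thesis by (simp add: mult.assoc flip: monomial_add)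
    qed
    have sums: "(\<Sum>s\<in>S. h s) \<in> ?I" if "\<And>s. s \<in> S \<Longrightarrow> h s \<in> ?I" for S :: "(int ^ 'n) set" and h
      using that by (induction S rule: infinite_finite_induct) (auto simp: zero add)
    show "f \<in> ?I"
      by (rule ssubst[of _ _ "\<lambda>z. z \<in> ?I", OF laurent_expansion[of f]]) (rule sums[OF terms])
  qed
qed

text \<open>The quotient is represented by the polynomials in the coordinates outside
  \<open>C\<close>. If a product lies in the ideal, then so does the product of the truncations;
  having no coordinate from \<open>C\<close> it is 0, and Laurent polynomials form a domain.\<close>

lemma orbit_ideal_prime:
  assumes C: "C \<subseteq> B"
  shows "prime_on (orbit_ideal C) (monomial_span (lattice_cone B) :: ('k::idom, 'n) laurent set)"
proof -
  let ?R = "monomial_span (lattice_cone B) :: ('k, 'n) laurent set"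
  define w :: "int ^ 'n \<Rightarrow> 'k" where "w s = (if \<forall>e\<in>C. coord B s e = 0 then 1 else 0)" for s
  have split: "euler w f \<in> ?R" "f - euler w f \<in> orbit_ideal C" if "f \<in> ?R" for f
  proof -
    show *: "euler w f \<in> ?R" using that by (auto simp: monomial_span_iff)
    have "f - euler w f \<in> ?R" using is_subringD(6)[OF chart_subring that *] .
    then show "f - euler w f \<in> orbit_ideal C"
      unfolding orbit_ideal_def by (auto simp: support_iff w_def split: if_splits)
  qed
  have zero: "h = 0" if "h \<in> orbit_ideal C" "\<And>s e. s \<in> support h \<Longrightarrow> e \<in> C \<Longrightarrow> coord B s e = 0" for h :: "('k, 'n) laurent"
  proof (rule laurent_eqI)
    fix s show "lcoeff h s = lcoeff 0 s" using that by (force simp: orbit_ideal_def support_iff)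
  qed
  have sup: "coord B s e = 0" if "s \<in> support (euler w f)" "e \<in> C" for s e f
    using that by (auto simp: support_iff w_def split: if_splits)
  note I = orbit_ideal_ideal[OF C]
  have neg: "- f \<in> orbit_ideal C" if "f \<in> orbit_ideal C" for f :: "('k, 'n) laurent"
    using that is_subringD(3)[OF chart_subring] by (auto simp: orbit_ideal_def support_iff)
  have prime: "f \<in> orbit_ideal C \<or> g \<in> orbit_ideal C" if f: "f \<in> ?R" and g: "g \<in> ?R" and fg: "f * g \<in> orbit_ideal C" for f g
  proof -
    let ?f = "euler w f" and ?g = "euler w g"
    \<comment> \<open>The difference of f g and this element is the product of the
      truncations.\<close>
    have "g * (f - ?f) + ?f * (g - ?g) \<in> orbit_ideal C" using split f g by (intro I) auto
    from I(2)[OF fg neg[OF this]] have prod: "?f * ?g \<in> orbit_ideal C" by (simp add: algebra_simps)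
    have "?f * ?g = 0"
    proof (rule zero[OF prod])
      fix s e assume "s \<in> support (?f * ?g)" "e \<in> C"
      then show "coord B s e = 0" using support_mult[of s ?f ?g] sup by (auto simp: coord_add)
    qed
    then have "?f = 0 \<or> ?g = 0" by simp
    then show ?thesis using split(2)[OF f] split(2)[OF g] by auto
  qed
  have one: "(1 :: ('k, 'n) laurent) \<notin> orbit_ideal C"
    unfolding monomial_0[symmetric] by (simp add: orbit_ideal_def support_monomial coord_zero)
  have sub: "orbit_ideal C \<subseteq> ?R" by (auto simp: orbit_ideal_def)
  have prime': "\<forall>f\<in>?R. \<forall>g\<in>?R. f * g \<in> orbit_ideal C \<longrightarrow> f \<in> orbit_ideal C \<or> g \<in> orbit_ideal C"
    using prime by blast
  show ?thesis
    unfolding prime_on_def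
    by (intro conjI; (rule sub one I(1) prime' | (intro ballI; rule I; assumption)))
qed

lemma monomial_in_orbit_ideal: "e \<in> B \<Longrightarrow> C \<subseteq> B \<Longrightarrow> (monomial e :: ('k::comm_ring_1, 'n) laurent) \<in> orbit_ideal C \<longleftrightarrow> e \<in> C"
  using monomial_in_span[OF basis_in_cone, of e] by (auto simp: orbit_ideal_def support_monomial coord_basis)

end

section \<open>Gluing of charts and independence of stalks from the chart\<close>

context smooth_lattice_polytope begin

lemma chart_eq: "m \<in> lattice_vertices P \<Longrightarrow> chart P m = monomial_span (lattice_cone (edge_basis P m))"
  by (simp add: chart_def vertex_semigroup_eq)

lemma semigroup_zero: "m \<in> lattice_vertices P \<Longrightarrow> 0 \<in> vertex_semigroup P m"
  unfolding vertex_semigroup_def using vertex_point[of m] by (intro generated_semigroup.gen) force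

lemma semigroup_add: "a \<in> vertex_semigroup P m \<Longrightarrow> b \<in> vertex_semigroup P m \<Longrightarrow> a + b \<in> vertex_semigroup P m"
  unfolding vertex_semigroup_def by (rule generated_semigroup.add)

lemma semigroup_vertex: "m' \<in> lattice_vertices P \<Longrightarrow> m' - m \<in> vertex_semigroup P m"
  unfolding vertex_semigroup_def using vertex_point[of m'] by (intro generated_semigroup.gen) blast

lemma chart_is_subring: "m \<in> lattice_vertices P \<Longrightarrow> is_subring (chart P m :: ('k::comm_ring_1, 'n) laurent set)"
  unfolding chart_def by (intro monomial_span_subring semigroup_zero semigroup_add)

lemma overlap_subring:
  assumes "m \<in> lattice_vertices P" "m' \<in> lattice_vertices P"
  shows "is_subring (overlap P m m' :: ('k::comm_ring_1, 'n) laurent set)"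
  unfolding overlap_def
proof (rule monomial_span_subring)
  let ?O = "{s + t |s t. s \<in> vertex_semigroup P m \<and> t \<in> vertex_semigroup P m'}"
  show "0 \<in> ?O" using semigroup_zero assms by force
  fix a b assume "a \<in> ?O" "b \<in> ?O"
  then obtain s t s' t' where "a + b = (s + s') + (t + t')" "s \<in> vertex_semigroup P m" "s' \<in> vertex_semigroup P m"
    "t \<in> vertex_semigroup P m'" "t' \<in> vertex_semigroup P m'" by (auto simp: ac_simps)
  then show "a + b \<in> ?O" using semigroup_add by blast
qed

lemma overlap_commute: "overlap P m m' = overlap P m' m"
proof -
  have sub: "{s + t |s t. s \<in> S \<and> t \<in> T} \<subseteq> {s + t |s t. s \<in> T \<and> t \<in> S}" for S T :: "(int ^ 'n) set"
  proof
    fix z assume "z \<in> {s + t |s t. s \<in> S \<and> t \<in> T}"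
    then obtain s t where "z = t + s" "s \<in> S" "t \<in> T" by (auto simp: add.commute)
    then show "z \<in> {s + t |s t. s \<in> T \<and> t \<in> S}" by blast
  qed
  have "{s + t |s t. s \<in> vertex_semigroup P m \<and> t \<in> vertex_semigroup P m'}
    = {s + t |s t. s \<in> vertex_semigroup P m' \<and> t \<in> vertex_semigroup P m}"
    by (intro equalityI sub)
  then show ?thesis by (simp add: overlap_def)
qed

lemma overlap_same:
  assumes "m \<in> lattice_vertices P"
  shows "overlap P m m = chart P m"
proof -
  have "{s + t |s t. s \<in> vertex_semigroup P m \<and> t \<in> vertex_semigroup P m} = vertex_semigroup P m"
    using semigroup_add semigroup_zero[OF assms] by force
  then show ?thesis by (simp add: overlap_def chart_def)
qed

lemma semigroup_multiple: "m' \<in> lattice_vertices P \<Longrightarrow> m \<in> lattice_vertices P \<Longrightarrow> int n *s (m' - m) \<in> vertex_semigroup P m"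
proof (induction n)
  case (Suc n)
  have eq: "int (Suc n) *s (m' - m) = (m' - m) + int n *s (m' - m)" by (simp add: vector_sadd_rdistrib)
  show ?case unfolding eq by (rule semigroup_add[OF semigroup_vertex[OF Suc.prems(1)] Suc.IH[OF Suc.prems]])
qed (simp add: semigroup_zero)

text \<open>Adding m' - m turns a generator p - m' at one vertex into the generator p - m at the
  other.\<close>

lemma overlap_shift:
  assumes "t \<in> vertex_semigroup P m'"
  shows "\<exists>n. t + int n *s (m' - m) \<in> vertex_semigroup P m"
  using assms unfolding vertex_semigroup_def
proof (induction rule: generated_semigroup.induct)
  case (gen t)
  then obtain p where "p \<in> lattice_points P" "t = p - m'" by blast
  then have "t + int 1 *s (m' - m) \<in> (\<lambda>p. p - m) ` lattice_points P" by (simp add: image_iff)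
  then show ?case by (blast intro: generated_semigroup.gen)
next
  case (add s t)
  then obtain k n where kn: "s + int k *s (m' - m) \<in> generated_semigroup ((\<lambda>p. p - m) ` lattice_points P)"
    "t + int n *s (m' - m) \<in> generated_semigroup ((\<lambda>p. p - m) ` lattice_points P)" by blast
  have eq: "s + t + int (k + n) *s (m' - m) = (s + int k *s (m' - m)) + (t + int n *s (m' - m))"
    by (simp add: vector_sadd_rdistrib)
  have "s + t + int (k + n) *s (m' - m) \<in> generated_semigroup ((\<lambda>p. p - m) ` lattice_points P)"
    unfolding eq by (rule generated_semigroup.add[OF kn])
  then show ?case by blast
qed

text \<open>The overlap is the chart at \<open>m\<close> with x^(m' - m) inverted; since supports
  are finite, one power clears all terms.\<close>

lemma overlap_clear:
  fixes f :: "('k::comm_ring_1, 'n) laurent"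
  assumes m: "m \<in> lattice_vertices P" "m' \<in> lattice_vertices P" and f: "f \<in> overlap P m m'"
  shows "\<exists>n. monomial (m' - m) ^ n * f \<in> chart P m"
proof -
  have "\<exists>n. u + int n *s (m' - m) \<in> vertex_semigroup P m" if u: "u \<in> support f" for u
  proof -
    obtain s t where st: "u = s + t" "s \<in> vertex_semigroup P m" "t \<in> vertex_semigroup P m'"
      using f u by (auto simp: overlap_def monomial_span_def)
    obtain n where "t + int n *s (m' - m) \<in> vertex_semigroup P m" using overlap_shift[OF st(3)] by blast
    from semigroup_add[OF st(2) this] show ?thesis by (auto simp: st(1) add.assoc)
  qed
  then obtain n where n: "\<And>u. u \<in> support f \<Longrightarrow> u + int (n u) *s (m' - m) \<in> vertex_semigroup P m" by metis
  \<comment> \<open>Any common bound will do, because further multiples of m' - m stay in the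
    semigroup.\<close>
  define N where "N = (\<Sum>u\<in>support f. n u)"
  have "f * monomial (int N *s (m' - m)) \<in> chart P m"
    unfolding chart_def monomial_span_iff lcoeff_mult_monomial
  proof (intro allI impI)
    fix u assume "lcoeff f (u - int N *s (m' - m)) \<noteq> 0"
    then have sup: "u - int N *s (m' - m) \<in> support f" (is "?u \<in> _") by (simp add: support_iff)
    then have "n ?u \<le> N" unfolding N_def using finite_support[of f] by (intro member_le_sum) auto
    then have "int N *s (m' - m) = int (n ?u) *s (m' - m) + int (N - n ?u) *s (m' - m)"
      by (simp flip: vector_sadd_rdistrib)
    then have "u = (?u + int (n ?u) *s (m' - m)) + int (N - n ?u) *s (m' - m)" by (simp add: algebra_simps)
    then show "u \<in> vertex_semigroup P m"
      by (rule ssubst[of _ _ "\<lambda>u. u \<in> vertex_semigroup P m"])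
        (rule semigroup_add[OF n[OF sup] semigroup_multiple[OF m(2,1)]])
  qed
  then have "monomial (m' - m) ^ N * f \<in> chart P m" by (simp add: monomial_power mult.commute)
  then show ?thesis by blast
qed

lemma overlap_local_ring:
  fixes \<qq> :: "('k::idom, 'n) laurent set"
  assumes m: "m \<in> lattice_vertices P" "m' \<in> lattice_vertices P" and \<qq>: "prime_on \<qq> (overlap P m m')"
  shows "local_ring (chart P m) (\<qq> \<inter> chart P m) = local_ring (overlap P m m') \<qq>"
proof (rule local_ring_localization[OF chart_is_subring[OF m(1)] _ \<qq>])
  show "chart P m \<subseteq> (overlap P m m' :: ('k, 'n) laurent set)"
    using semigroup_zero[OF m(2)] unfolding chart_def overlap_def monomial_span_def by force
  show "monomial (m' - m) \<in> (chart P m :: ('k, 'n) laurent set)"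
    unfolding chart_def by (intro monomial_in_span semigroup_vertex m)
  have "0 + (m - m') \<in> {s + t |s t. s \<in> vertex_semigroup P m \<and> t \<in> vertex_semigroup P m'}"
    using semigroup_zero[OF m(1)] semigroup_vertex[OF m(1)] by blast
  then show "monomial (m - m') \<in> (overlap P m m' :: ('k, 'n) laurent set)"
    unfolding overlap_def by (intro monomial_in_span) simp
  show "monomial (m' - m) * monomial (m - m') = (1 :: ('k, 'n) laurent)"
    using monomial_inverse[of "m' - m"] by simp
qed (rule overlap_clear[OF m])

lemma chart_pointsD:
  assumes "(m, \<pp>) \<in> (chart_points P :: (_ \<times> ('k::comm_ring_1, 'n) laurent set) set)"
  shows "m \<in> lattice_vertices P" "prime_on \<pp> (chart P m)"
  using assms primeideal_on_iff[OF chart_is_subring] by (auto simp: chart_points_def)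

text \<open>Both local rings equal that of the overlap at \<qq>. The generators of the bundle differ
  by x^(m' - m), which lies in one chart and has its inverse in the other, hence is a unit of the
  common local ring.\<close>

lemma glue_stalks:
  fixes \<pp> \<pp>' :: "('k::field_char_0, 'n) laurent set"
  assumes "((m, \<pp>), (m', \<pp>')) \<in> glue P"
  shows "local_ring (chart P m') \<pp>' = local_ring (chart P m) \<pp>"
    and "(\<lambda>f. f * embed (monomial m')) ` local_ring (chart P m') \<pp>' = (\<lambda>f. f * embed (monomial m)) ` local_ring (chart P m) \<pp>"
proof -
  from assms obtain \<qq> where pts: "(m, \<pp>) \<in> chart_points P" "(m', \<pp>') \<in> chart_points P"
    and q: "primeideal \<qq> (ring_on (overlap P m m'))" "\<qq> \<inter> chart P m = \<pp>" "\<qq> \<inter> chart P m' = \<pp>'"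
    by (auto simp: glue_def)
  have m: "m \<in> lattice_vertices P" "m' \<in> lattice_vertices P" using pts chart_pointsD(1) by blast+
  have prime: "prime_on \<qq> (overlap P m m')" using q(1) primeideal_on_iff[OF overlap_subring[OF m]] by blast
  have 1: "local_ring (chart P m) \<pp> = local_ring (overlap P m m') \<qq>"
    using overlap_local_ring[OF m prime] q(2) by simp
  have comm: "overlap P m m' = (overlap P m' m :: ('k, 'n) laurent set)" by (rule overlap_commute)
  have "local_ring (chart P m') \<pp>' = local_ring (overlap P m' m) \<qq>"
    using overlap_local_ring[OF m(2,1) prime[unfolded comm]] q(3) by simp
  with 1 show eq: "local_ring (chart P m') \<pp>' = local_ring (chart P m) \<pp>"
    by (simp only: comm)
  have c: "const c \<in> (chart P n :: ('k, 'n) laurent set)" if "n \<in> lattice_vertices P" for n c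
    unfolding chart_def by (intro const_in_span semigroup_zero that)
  interpret l: prime_localization "chart P m" \<pp>
    using chart_pointsD(2)[OF pts(1)] chart_is_subring[OF m(1)] c[OF m(1)] by unfold_locales
  interpret l': prime_localization "chart P m'" \<pp>'
    using chart_pointsD(2)[OF pts(2)] chart_is_subring[OF m(2)] c[OF m(2)] by unfold_locales
  let ?u = "embed (monomial (m' - m)) :: ('k, 'n) laurent fract"
    and ?u' = "embed (monomial (m - m')) :: ('k, 'n) laurent fract"
  have u: "?u \<in> local_ring (chart P m) \<pp>"
    unfolding chart_def by (intro l.embed_in_A[unfolded chart_def] monomial_in_span semigroup_vertex m)
  have "?u' \<in> local_ring (chart P m') \<pp>'"
    unfolding chart_def by (intro l'.embed_in_A[unfolded chart_def] monomial_in_span semigroup_vertex m)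
  then have u': "?u' \<in> local_ring (chart P m) \<pp>" by (simp add: eq)
  have "monomial (m' - m) * monomial (m - m') = (1 :: ('k, 'n) laurent)"
    using monomial_inverse[of "m' - m"] by simp
  then have uu: "?u * ?u' = 1" by (simp flip: embed_hom(2,4))
  have m'_eq: "embed (monomial m') = ?u * embed (monomial m)" by (simp flip: embed_hom(4) monomial_add)
  show "(\<lambda>f. f * embed (monomial m')) ` local_ring (chart P m') \<pp>' = (\<lambda>f. f * embed (monomial m)) ` local_ring (chart P m) \<pp>"
    unfolding eq m'_eq by (rule image_mult_unit[OF l.A_mult u u' uu])
qed

lemma glue_refl:
  assumes "(m, \<pp>) \<in> (chart_points P :: (_ \<times> ('k::comm_ring_1, 'n) laurent set) set)"
  shows "((m, \<pp>), (m, \<pp>)) \<in> glue P"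
proof -
  have same: "overlap P m m = (chart P m :: ('k, 'n) laurent set)"
    by (rule overlap_same[OF chart_pointsD(1)[OF assms]])
  have "primeideal \<pp> (ring_on (overlap P m m))" "\<pp> \<subseteq> chart P m"
    using assms same prime_onD(1)[OF chart_pointsD(2)[OF assms]]
    by (auto simp: chart_points_def)
  then show ?thesis using assms by (auto simp: glue_def)
qed

text \<open>All members of the class contribute the same set, and reflexivity of \<open>glue\<close>
  ensures that the union is not empty.\<close>

lemma stalks_eq:
  fixes \<pp> :: "('k::field_char_0, 'n) laurent set"
  assumes "(m, \<pp>) \<in> chart_points P"
  shows "structure_stalk P (glue P `` {(m, \<pp>)}) = local_ring (chart P m) \<pp>"
    and "bundle_stalk P (glue P `` {(m, \<pp>)}) = (\<lambda>f. f * embed (monomial m)) ` local_ring (chart P m) \<pp>"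
proof -
  have "structure_stalk P (glue P `` {(m, \<pp>)}) = (\<Union>x\<in>glue P `` {(m, \<pp>)}. local_ring (chart P m) \<pp>)"
    unfolding structure_stalk_def by (intro SUP_cong) (auto simp: glue_stalks(1))
  then show "structure_stalk P (glue P `` {(m, \<pp>)}) = local_ring (chart P m) \<pp>"
    using glue_refl[OF assms] by blast
  have "bundle_stalk P (glue P `` {(m, \<pp>)}) = (\<Union>x\<in>glue P `` {(m, \<pp>)}. (\<lambda>f. f * embed (monomial m)) ` local_ring (chart P m) \<pp>)"
    unfolding bundle_stalk_def
  proof (rule SUP_cong[OF HOL.refl])
    fix x assume x: "x \<in> glue P `` {(m, \<pp>)}"
    obtain m' \<pp>' where "x = (m', \<pp>')" by force
    with x glue_stalks(2)[of m \<pp> m' \<pp>'] show "(case x of (n, \<rr>) \<Rightarrow> (\<lambda>f. f * embed (monomial n)) ` local_ring (chart P n) \<rr>)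
      = (\<lambda>f. f * embed (monomial m)) ` local_ring (chart P m) \<pp>" by simp
  qed
  then show "bundle_stalk P (glue P `` {(m, \<pp>)}) = (\<lambda>f. f * embed (monomial m)) ` local_ring (chart P m) \<pp>"
    using glue_refl[OF assms] by blast
qed

end

section \<open>Injectivity orders on the toric variety\<close>

lemma enat_add_le_iff: "N + enat q \<le> enat l \<longleftrightarrow> q \<le> l \<and> N \<le> enat (l - q)"
  by (cases N) auto

lemma enat_eqI:
  assumes "\<And>l. a \<le> enat l \<longleftrightarrow> b \<le> enat l"
  shows "a = b"
proof (cases a)
  case (enat n)
  show ?thesis
  proof (cases b)
    case (enat n')
    then show ?thesis using assms[of n] assms[of n'] \<open>a = enat n\<close> by simp
  next
    case infinity
    then show ?thesis using assms[of n] enat by simp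
  qed
next
  case infinity
  then show ?thesis using assms by (cases b) auto
qed

lemma image_mult_UNIV: "(g :: 'f::field) \<noteq> 0 \<Longrightarrow> (\<lambda>f. f * g) ` UNIV = UNIV"
proof (intro equalityI subsetI)
  fix z :: 'f assume "g \<noteq> 0"
  then have "z = (z / g) * g" by simp
  then show "z \<in> (\<lambda>f. f * g) ` UNIV" by blast
qed simp

section \<open>The generic point of the torus seen from a chart\<close>

context lattice begin

lemma cone_differences: "\<exists>a\<in>lattice_cone B. \<exists>b\<in>lattice_cone B. m = a - b"
proof -
  define a where "a = (\<Sum>e\<in>B. max (coord B m e) 0 *s e)"
  define b where "b = (\<Sum>e\<in>B. max (- coord B m e) 0 *s e)"
  have a: "coord B a = (\<lambda>e. max (coord B m e) 0)" and b: "coord B b = (\<lambda>e. max (- coord B m e) 0)"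
    unfolding a_def b_def by (rule coord_combination, simp add: coord_outside)+
  have "m = a - b" by (rule coord_inject) (simp add: coord_diff a b max_def)
  moreover have "a \<in> lattice_cone B" "b \<in> lattice_cone B" by (simp_all add: lattice_cone_def a b)
  ultimately show ?thesis by blast
qed

lemma zero_prime: "prime_on {0} (monomial_span (lattice_cone B) :: ('k::idom, 'n) laurent set)"
  using is_subringD(2)[OF chart_subring] by (auto simp: prime_on_def)

text \<open>Every exponent is a difference of two elements of the cone, so each Laurent monomial is
  a fraction of elements of the chart and both rings have the same fraction field.\<close>

lemma generic_local_ring: "local_ring (monomial_span (lattice_cone B)) {0} = (UNIV :: ('k::field_char_0, 'n) laurent fract set)"
proof -
  interpret lattice_chart B "{0} :: ('k, 'n) laurent set" by unfold_locales (rule zero_prime)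
  have embed: "embed f \<in> A" for f
  proof (induction f rule: laurent_induct)
    case (2 c m)
    obtain a b where ab: "a \<in> lattice_cone B" "b \<in> lattice_cone B" "m = a - b" using cone_differences by blast
    have "Fract (monomial a) (monomial b) \<in> A"
      using ab monomial_in_span monomial_nonzero by (intro in_A) auto
    moreover have "monomial m * monomial b = (monomial a :: ('k, 'n) laurent)"
      by (simp add: ab(3) flip: monomial_add)
    then have "Fract (monomial a) (monomial b) = (embed (monomial m) :: ('k, 'n) laurent fract)"
      by (simp add: embed_def eq_fract monomial_nonzero)
    ultimately have "embed (monomial m) \<in> A" by simp
    from A_mult[OF cst_in[of c] this] show ?case unfolding embed_hom(4) by (simp only: embed_def)
  qed (use A_add A_0 in \<open>auto simp: embed_hom\<close>)
  have inverse: "inverse z \<in> A" if z: "z \<in> A" for z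
  proof -
    obtain f g where fg: "f \<in> monomial_span (lattice_cone B)" "g \<in> monomial_span (lattice_cone B)" "g \<noteq> 0" "z = Fract f g"
      using A_cases[OF z] by metis
    show ?thesis
    proof (cases "f = 0")
      case True
      then show ?thesis using fg A_0 by (simp add: fract_collapse)
    next
      case False
      then show ?thesis using fg by (simp add: in_A)
    qed
  qed
  have "z \<in> A" for z
  proof -
    obtain f g where "g \<noteq> 0" "z = Fract f g" by (metis Fract_cases)
    then have "z = embed f * inverse (embed g)" by (simp add: embed_def)
    then show ?thesis using A_mult[OF embed inverse[OF embed]] by simp
  qed
  then show ?thesis by blast
qed

end

section \<open>Orders expressed by exponents at a vertex\<close>

context smooth_lattice_polytope begin

abbreviation vexps :: "int ^ 'n \<Rightarrow> int ^ 'n \<Rightarrow> int ^ 'n \<Rightarrow> nat"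
  where "vexps m u e \<equiv> nat (coord (edge_basis P m) (u - m) e)"

lemma coord_nonneg:
  "m \<in> lattice_vertices P \<Longrightarrow> u \<in> lattice_points P \<Longrightarrow> e \<in> edge_basis P m \<Longrightarrow> 0 \<le> coord (edge_basis P m) (u - m) e"
  using points_in_cone by (auto simp: lattice_cone_def)

lemma vexps_inject:
  assumes m: "m \<in> lattice_vertices P" and u: "u \<in> lattice_points P" "w \<in> lattice_points P"
    and eq: "\<And>e. e \<in> edge_basis P m \<Longrightarrow> vexps m u e = vexps m w e"
  shows "u = w"
proof -
  interpret lattice "edge_basis P m" by (rule basis_lattice[OF m])
  have "u - m = w - m"
    by (rule coord_inject) (use eq coord_nonneg[OF m u(1)] coord_nonneg[OF m u(2)] in \<open>auto simp: eq_nat_nat_iff\<close>)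
  then show ?thesis by simp
qed

text \<open>An upper bound at every point of the chart, whichever coordinates vanish there: no
  Taylor expansion is truncated.\<close>

lemma n_inj_le:
  fixes \<pp> :: "('k::field_char_0, 'n) laurent set"
  assumes pts: "(m, \<pp>) \<in> chart_points P"
    and deg: "\<And>u. u \<in> lattice_points P \<Longrightarrow> (\<Sum>e\<in>edge_basis P m. vexps m u e) \<le> l"
  shows "n_inj P (glue P `` {(m, \<pp>)}) \<le> enat l"
proof -
  have m: "m \<in> lattice_vertices P" by (rule chart_pointsD(1)[OF pts])
  interpret lattice "edge_basis P m" by (rule basis_lattice[OF m])
  interpret lattice_chart "edge_basis P m" \<pp>
    using chart_pointsD(2)[OF pts] by unfold_locales (simp add: chart_eq[OF m])
  show ?thesis
    unfolding n_inj_def stalks_eq[OF pts] chart_eq[OF m]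
  proof (subst stalk_order_le_iff[OF finite_points])
    show "crit (lattice_points P) (vexps m) l"
    proof (rule crit_of_deg_le[OF finite_points])
      show "u = w" if "u \<in> lattice_points P" "w \<in> lattice_points P"
        "\<And>e. e \<in> edge_basis P m \<Longrightarrow> vexps m u e = vexps m w e" for u w
        using that by (rule vexps_inject[OF m])
    qed (simp add: deg_def deg[simplified])
  qed (rule points_in_cone[OF m])
qed

lemma n_inj_le_iff:
  fixes \<pp> :: "('k::field_char_0, 'n) laurent set"
  assumes pts: "(m, \<pp>) \<in> chart_points P" and E: "E \<subseteq> edge_basis P m"
    and unit: "\<And>e. e \<in> edge_basis P m \<Longrightarrow> monomial e \<in> \<pp> \<longleftrightarrow> e \<notin> E"
  shows "n_inj P (glue P `` {(m, \<pp>)}) \<le> enat l \<longleftrightarrow> (\<forall>w\<in>lattice_points P.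
    (\<Sum>e\<in>edge_basis P m - E. vexps m w e) \<le> l \<and>
    separated TYPE('k) {u \<in> lattice_points P. \<forall>e\<in>edge_basis P m - E. vexps m u e = vexps m w e} E (vexps m)
      (l - (\<Sum>e\<in>edge_basis P m - E. vexps m w e)))"
proof -
  have m: "m \<in> lattice_vertices P" by (rule chart_pointsD(1)[OF pts])
  interpret lattice "edge_basis P m" by (rule basis_lattice[OF m])
  interpret lattice_chart "edge_basis P m" \<pp>
    using chart_pointsD(2)[OF pts] by unfold_locales (simp add: chart_eq[OF m])
  have x: "x e \<in> mm \<longleftrightarrow> e \<notin> E" if "e \<in> edge_basis P m" for e
    unfolding x_def using embed_mm_iff[OF monomial_in_span[OF basis_in_cone[OF that]]] unit[OF that] by simp
  have sl: "slice (lattice_points P) (vexps m) E w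
      = {u \<in> lattice_points P. \<forall>e\<in>edge_basis P m - E. vexps m u e = vexps m w e}" for w
    by (auto simp: slice_def)
  show ?thesis
    unfolding n_inj_def stalks_eq[OF pts] chart_eq[OF m]
  proof (subst stalk_order_le_iff[OF finite_points])
    show "crit (lattice_points P) (vexps m) l \<longleftrightarrow> (\<forall>w\<in>lattice_points P.
      (\<Sum>e\<in>edge_basis P m - E. vexps m w e) \<le> l \<and>
      separated TYPE('k) {u \<in> lattice_points P. \<forall>e\<in>edge_basis P m - E. vexps m u e = vexps m w e} E (vexps m)
        (l - (\<Sum>e\<in>edge_basis P m - E. vexps m w e)))"
      unfolding sl[symmetric] by (rule crit_iff_slices[OF E finite_points]) (use x E in auto)
  qed (rule points_in_cone[OF m])
qed

text \<open>At the zero ideal of the chart every coordinate is a unit, so all of \<open>Q\<close>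
  forms a single slice at distance 0. The twist by x^m does not change the stalk, which is the whole
  function field.\<close>

lemma N_inj_le_iff:
  assumes m: "m \<in> lattice_vertices P" and Q: "Q \<subseteq> lattice_points P"
  shows "N_inj TYPE('k::field_char_0) Q \<le> enat l \<longleftrightarrow> Q = {} \<or> separated TYPE('k) Q (edge_basis P m) (vexps m) l"
proof -
  interpret lattice "edge_basis P m" by (rule basis_lattice[OF m])
  interpret lattice_chart "edge_basis P m" "{0} :: ('k, 'n) laurent set" by unfold_locales (rule zero_prime)
  have A: "A = UNIV" by (rule generic_local_ring)
  have K: "local_ring UNIV {0} = (UNIV :: ('k, 'n) laurent fract set)"
  proof -
    have "z \<in> local_ring UNIV {0}" for z :: "('k, 'n) laurent fract"
    proof -
      obtain f g where "g \<noteq> 0" "z = Fract f g" by (metis Fract_cases)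
      then show ?thesis by (auto simp: local_ring_def)
    qed
    then show ?thesis by blast
  qed
  have L: "(\<lambda>f. f * embed (monomial m)) ` A = UNIV"
    unfolding A by (rule image_mult_UNIV) (simp add: embed_eq_0_iff monomial_nonzero)
  have fin: "finite Q" using Q finite_points finite_subset by blast
  have "N_inj TYPE('k) Q = stalk_injectivity_order A ((\<lambda>f. f * embed (monomial m)) ` A) (embed ` monomial_span Q)"
    unfolding N_inj_def Let_def K L unfolding A ..
  also have "\<dots> \<le> enat l \<longleftrightarrow> crit Q (vexps m) l"
    using Q points_in_cone[OF m] by (intro stalk_order_le_iff fin) auto
  also have "\<dots> \<longleftrightarrow> (\<forall>w\<in>Q. 0 \<le> l \<and> separated TYPE('k) (slice Q (vexps m) (edge_basis P m) w) (edge_basis P m) (vexps m) (l - 0))"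
  proof -
    have "x e \<notin> mm" if "e \<in> edge_basis P m" for e
      unfolding x_def using embed_mm_iff[OF monomial_in_span[OF basis_in_cone[OF that]]] by (simp add: monomial_nonzero)
    then show ?thesis using crit_iff_slices[OF order.refl fin, of "vexps m" l] by simp
  qed
  also have "\<dots> \<longleftrightarrow> Q = {} \<or> separated TYPE('k) Q (edge_basis P m) (vexps m) l"
    by (auto simp: slice_def)
  finally show ?thesis .
qed

lemma face_basis_subset: "face_basis P F m \<subseteq> edge_basis P m"
  by (auto simp: face_basis_def edge_basis_def)

text \<open>A translate of the face lattice fixes exactly the coordinates transverse to the face. At
  lattice points of the polytope these are nonnegative, so they can be read as exponents and d_H as
  their sum.\<close>

lemma face_slice:
  assumes m: "m \<in> lattice_vertices P" and w: "w \<in> (+) u ` face_lattice P F m \<inter> lattice_points P"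
  shows "(+) u ` face_lattice P F m \<inter> lattice_points P
      = {q \<in> lattice_points P. \<forall>e\<in>edge_basis P m - face_basis P F m. vexps m q e = vexps m w e}"
    and "nat (face_distance P F m u) = (\<Sum>e\<in>edge_basis P m - face_basis P F m. vexps m w e)"
proof -
  let ?B = "edge_basis P m" and ?E = "face_basis P F m"
  interpret lattice ?B by (rule basis_lattice[OF m])
  have mem: "q \<in> (+) u ` face_lattice P F m \<longleftrightarrow> (\<forall>e\<in>?B - ?E. coord ?B (q - m) e = coord ?B u e)" for q
  proof
    assume "q \<in> (+) u ` face_lattice P F m"
    then obtain a where q: "q = u + (m + (\<Sum>e\<in>?E. a e *s e))" by (auto simp: face_lattice_def)
    have "(\<Sum>e\<in>?E. a e *s e) = (\<Sum>e\<in>?B. (if e \<in> ?E then a e else 0) *s e)"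
      using finite_B face_basis_subset[of F m] by (intro sum.mono_neutral_cong_left) auto
    moreover have "coord ?B (\<Sum>e\<in>?B. (if e \<in> ?E then a e else 0) *s e) = (\<lambda>e. if e \<in> ?E then a e else 0)"
      by (rule coord_combination) (use face_basis_subset[of F m] in auto)
    ultimately show "\<forall>e\<in>?B - ?E. coord ?B (q - m) e = coord ?B u e"
      by (simp add: q coord_diff coord_add)
  next
    assume q: "\<forall>e\<in>?B - ?E. coord ?B (q - m) e = coord ?B u e"
    define a where "a = coord ?B (q - m - u)"
    have "q - m - u = (\<Sum>e\<in>?B. a e *s e)" unfolding a_def by (rule coord_expansion)
    also have "\<dots> = (\<Sum>e\<in>?E. a e *s e)"
      using q finite_B face_basis_subset[of F m]
      by (intro sum.mono_neutral_right) (auto simp: a_def coord_diff[of "q - m" u])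
    finally have "q = u + (m + (\<Sum>e\<in>?E. a e *s e))" by (simp add: algebra_simps)
    then show "q \<in> (+) u ` face_lattice P F m" by (auto simp: face_lattice_def)
  qed
  have wc: "coord ?B (w - m) e = coord ?B u e" if "e \<in> ?B - ?E" for e using w mem that by blast
  have "(\<forall>e\<in>?B - ?E. coord ?B (q - m) e = coord ?B u e) \<longleftrightarrow> (\<forall>e\<in>?B - ?E. vexps m q e = vexps m w e)"
    if "q \<in> lattice_points P" for q
  proof (rule ball_cong[OF HOL.refl])
    fix e assume e: "e \<in> ?B - ?E"
    then have "0 \<le> coord ?B (q - m) e" "0 \<le> coord ?B (w - m) e"
      using coord_nonneg[OF m] that w by blast+
    then show "coord ?B (q - m) e = coord ?B u e \<longleftrightarrow> vexps m q e = vexps m w e"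
      unfolding wc[OF e, symmetric] by (simp only: eq_nat_nat_iff)
  qed
  then show "(+) u ` face_lattice P F m \<inter> lattice_points P
      = {q \<in> lattice_points P. \<forall>e\<in>?B - ?E. vexps m q e = vexps m w e}"
    using mem by blast
  have "face_distance P F m u = (\<Sum>e\<in>?B - ?E. int (vexps m w e))"
    unfolding face_distance_def
  proof (rule sum.cong[OF HOL.refl])
    fix e assume e: "e \<in> ?B - ?E"
    then have "0 \<le> coord ?B (w - m) e" using coord_nonneg[OF m] w by blast
    then show "coord ?B u e = int (vexps m w e)" unfolding wc[OF e, symmetric] by simp
  qed
  then show "nat (face_distance P F m u) = (\<Sum>e\<in>?B - ?E. vexps m w e)"
    by (simp only: of_nat_sum[symmetric] nat_int)
qed

lemma orbit_point:
  assumes m: "m \<in> lattice_vertices P"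
  obtains \<pp> :: "('k::field_char_0, 'n) laurent set" where "(m, \<pp>) \<in> chart_points P"
    "orbit_generic_point TYPE('k) P F m = glue P `` {(m, \<pp>)}"
    "\<And>e. e \<in> edge_basis P m \<Longrightarrow> monomial e \<in> \<pp> \<longleftrightarrow> e \<notin> face_basis P F m"
proof -
  interpret lattice "edge_basis P m" by (rule basis_lattice[OF m])
  let ?C = "edge_basis P m - face_basis P F m"
  have C: "?C \<subseteq> edge_basis P m" by blast
  have "primeideal (orbit_ideal ?C) (ring_on (chart P m :: ('k, 'n) laurent set))"
    unfolding chart_eq[OF m] primeideal_on_iff[OF chart_subring] by (rule orbit_ideal_prime[OF C])
  then have 1: "(m, orbit_ideal ?C) \<in> (chart_points P :: (_ \<times> ('k, 'n) laurent set) set)"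
    using m by (simp add: chart_points_def)
  have 2: "orbit_generic_point TYPE('k) P F m = glue P `` {(m, orbit_ideal ?C)}"
    unfolding orbit_generic_point_def chart_eq[OF m] orbit_ideal_eq_genideal[OF C] ..
  have 3: "(monomial e :: ('k, 'n) laurent) \<in> orbit_ideal ?C \<longleftrightarrow> e \<notin> face_basis P F m" if "e \<in> edge_basis P m" for e
    using monomial_in_orbit_ideal[OF that C] that by simp
  show thesis by (rule that[OF 1 2 3])
qed

text \<open>Every translate that meets the polytope is the slice through one of its lattice points,
  so the maximum is over a finite set. The degree l - d_H left on a slice turns into the summand d_H
  on the other side of the inequality.\<close>

theorem n_inj_orbit:
  assumes m: "m \<in> lattice_vertices P"
  shows "n_inj P (orbit_generic_point TYPE('k::field_char_0) P F m) =
    Max {N_inj TYPE('k) ((+) u ` face_lattice P F m \<inter> lattice_points P) + enat (nat (face_distance P F m u))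
         | u. (+) u ` face_lattice P F m \<inter> lattice_points P \<noteq> {}}"
proof -
  let ?B = "edge_basis P m" and ?E = "face_basis P F m"
  interpret lattice ?B by (rule basis_lattice[OF m])
  define sl where "sl w = {q \<in> lattice_points P. \<forall>e\<in>?B - ?E. vexps m q e = vexps m w e}" for w
  define q where "q w = (\<Sum>e\<in>?B - ?E. vexps m w e)" for w
  let ?S = "\<lambda>u. (+) u ` face_lattice P F m \<inter> lattice_points P"
  have "{N_inj TYPE('k) (?S u) + enat (nat (face_distance P F m u)) | u. ?S u \<noteq> {}}
      = (\<lambda>w. N_inj TYPE('k) (sl w) + enat (q w)) ` lattice_points P" (is "?M = ?N")
  proof (intro equalityI subsetI)
    fix z assume "z \<in> ?M"
    then obtain u where u: "z = N_inj TYPE('k) (?S u) + enat (nat (face_distance P F m u))" "?S u \<noteq> {}" by blast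
    then obtain w where w: "w \<in> ?S u" by blast
    have "z = N_inj TYPE('k) (sl w) + enat (q w)"
      unfolding u(1) sl_def q_def face_slice(1)[OF m w] face_slice(2)[OF m w] ..
    moreover have "w \<in> lattice_points P" using w by blast
    ultimately show "z \<in> ?N" by (rule image_eqI)
  next
    fix z assume "z \<in> ?N"
    then obtain w where w: "w \<in> lattice_points P" "z = N_inj TYPE('k) (sl w) + enat (q w)" by blast
    have "m \<in> face_lattice P F m" unfolding face_lattice_def by (auto intro!: exI[of _ "\<lambda>_. 0"])
    \<comment> \<open>The slice through \<open>w\<close> is the translate by w - m, as the face
      lattice contains \<open>m\<close>.\<close>
    then have "w - m + m \<in> (+) (w - m) ` face_lattice P F m" by (rule imageI)
    then have ws: "w \<in> ?S (w - m)" using w(1) by simp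
    have "z = N_inj TYPE('k) (?S (w - m)) + enat (nat (face_distance P F m (w - m)))"
      unfolding w(2) sl_def q_def face_slice(1)[OF m ws] face_slice(2)[OF m ws] ..
    then show "z \<in> ?M" using ws by blast
  qed
  moreover have "n_inj P (orbit_generic_point TYPE('k) P F m) = Max ?N"
  proof (rule enat_eqI)
    fix l
    obtain \<pp> :: "('k, 'n) laurent set" where pp: "(m, \<pp>) \<in> chart_points P"
      "orbit_generic_point TYPE('k) P F m = glue P `` {(m, \<pp>)}"
      "\<And>e. e \<in> ?B \<Longrightarrow> monomial e \<in> \<pp> \<longleftrightarrow> e \<notin> ?E"
      using orbit_point[OF m] by metis
    have "n_inj P (orbit_generic_point TYPE('k) P F m) \<le> enat l \<longleftrightarrow>
        (\<forall>w\<in>lattice_points P. q w \<le> l \<and> separated TYPE('k) (sl w) ?E (vexps m) (l - q w))"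
      unfolding pp(2) sl_def q_def by (rule n_inj_le_iff[OF pp(1) face_basis_subset pp(3)])
    also have "\<dots> \<longleftrightarrow> (\<forall>w\<in>lattice_points P. N_inj TYPE('k) (sl w) + enat (q w) \<le> enat l)"
    proof (rule ball_cong[OF HOL.refl])
      fix w assume w: "w \<in> lattice_points P"
      have "sl w \<subseteq> lattice_points P" "sl w \<noteq> {}" using w by (auto simp: sl_def)
      then have "N_inj TYPE('k) (sl w) \<le> enat (l - q w) \<longleftrightarrow> separated TYPE('k) (sl w) ?B (vexps m) (l - q w)"
        using N_inj_le_iff[OF m] by blast
      \<comment> \<open>N_inj tests all directions at the vertex, the orbit only those along the
        face; the transverse exponents are constant on the slice.\<close>
      also have "\<dots> \<longleftrightarrow> separated TYPE('k) (sl w) ?E (vexps m) (l - q w)"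
        by (rule separated_constant[OF finite_B face_basis_subset]) (auto simp: sl_def)
      finally show "q w \<le> l \<and> separated TYPE('k) (sl w) ?E (vexps m) (l - q w) \<longleftrightarrow>
          N_inj TYPE('k) (sl w) + enat (q w) \<le> enat l" unfolding enat_add_le_iff by blast
    qed
    also have "\<dots> \<longleftrightarrow> Max ?N \<le> enat l"
      using finite_points vertex_point[OF m] by (subst Max_le_iff) auto
    finally show "n_inj P (orbit_generic_point TYPE('k) P F m) \<le> enat l \<longleftrightarrow> Max ?N \<le> enat l" .
  qed
  ultimately show ?thesis by simp
qed

lemma vertex_length_eq:
  assumes m: "m \<in> lattice_vertices P" and u: "u \<in> lattice_points P"
  shows "(\<Sum>e\<in>edge_basis P m. coord (edge_basis P m) (u - m) e) = int (\<Sum>e\<in>edge_basis P m. vexps m u e)"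
  unfolding of_nat_sum using coord_nonneg[OF m u] by (intro sum.cong) auto

text \<open>A bound on the length at all vertices extends to all lattice points by linearity; this
  links the formula in vertices to the degrees of sections.\<close>

lemma Max_vertex_length_le_iff:
  assumes m: "m \<in> lattice_vertices P"
  shows "nat (Max {vertex_length P m m' | m'. m' \<in> lattice_vertices P}) \<le> l \<longleftrightarrow>
    (\<forall>u\<in>lattice_points P. (\<Sum>e\<in>edge_basis P m. vexps m u e) \<le> l)"
proof -
  let ?L = "{vertex_length P m m' | m'. m' \<in> lattice_vertices P}"
  have L: "?L = vertex_length P m ` lattice_vertices P" by blast
  have "nat (Max ?L) \<le> l \<longleftrightarrow> (\<forall>w\<in>lattice_vertices P. vertex_length P m w \<le> int l)"
    unfolding nat_le_iff L using finite_vertices vertices_nonempty by (subst Max_le_iff) auto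
  also have "\<dots> \<longleftrightarrow> (\<forall>u\<in>lattice_points P. (\<Sum>e\<in>edge_basis P m. vexps m u e) \<le> l)"
  proof
    assume le: "\<forall>w\<in>lattice_vertices P. vertex_length P m w \<le> int l"
    show "\<forall>u\<in>lattice_points P. (\<Sum>e\<in>edge_basis P m. vexps m u e) \<le> l"
    proof
      fix u assume u: "u \<in> lattice_points P"
      then obtain w where "w \<in> lattice_vertices P"
        "(\<Sum>e\<in>edge_basis P m. coord (edge_basis P m) (u - m) e) \<le> vertex_length P m w"
        using vertex_length_maximizes[OF m] by blast
      then have "int (\<Sum>e\<in>edge_basis P m. vexps m u e) \<le> int l"
        using le vertex_length_eq[OF m u] by fastforce
      then show "(\<Sum>e\<in>edge_basis P m. vexps m u e) \<le> l" by (simp only: of_nat_le_iff)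
    qed
  next
    assume le: "\<forall>u\<in>lattice_points P. (\<Sum>e\<in>edge_basis P m. vexps m u e) \<le> l"
    show "\<forall>w\<in>lattice_vertices P. vertex_length P m w \<le> int l"
    proof
      fix w assume "w \<in> lattice_vertices P"
      then have "w \<in> lattice_points P" by (rule vertex_point)
      with le show "vertex_length P m w \<le> int l"
        unfolding vertex_length_def vertex_length_eq[OF m \<open>w \<in> lattice_points P\<close>] of_nat_le_iff by blast
    qed
  qed
  finally show ?thesis .
qed

text \<open>No edge fits into a point, so every direction is transverse and each slice is a single
  lattice point. Separation is then trivial and only the distances remain.\<close>

theorem n_inj_fixed_point:
  assumes m: "m \<in> lattice_vertices P"
  shows "n_inj P (orbit_generic_point TYPE('k::field_char_0) P {lattice_pt m} m) =
    enat (nat (Max {vertex_length P m m' | m'. m' \<in> lattice_vertices P}))"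
proof (rule enat_eqI)
  fix l
  have E: "face_basis P {lattice_pt m} m = {}"
  proof -
    have "\<not> E \<subseteq> {lattice_pt m}" if "E edge_of P" for E
    proof
      assume "E \<subseteq> {lattice_pt m}"
      then have "aff_dim E \<le> 0" using aff_dim_subset[of E "{lattice_pt m}"] by simp
      then show False using that by (simp add: edge_of_def)
    qed
    then show ?thesis by (auto simp: face_basis_def)
  qed
  obtain \<pp> :: "('k, 'n) laurent set" where pp: "(m, \<pp>) \<in> chart_points P"
    "orbit_generic_point TYPE('k) P {lattice_pt m} m = glue P `` {(m, \<pp>)}"
    "\<And>e. e \<in> edge_basis P m \<Longrightarrow> monomial e \<in> \<pp> \<longleftrightarrow> e \<notin> {}"
    using orbit_point[OF m, where F = "{lattice_pt m}"] unfolding E by metis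
  have "separated TYPE('k) {u \<in> lattice_points P. \<forall>e\<in>edge_basis P m - {}. vexps m u e = vexps m w e} {} (vexps m) d"
    if w: "w \<in> lattice_points P" for w d
  proof -
    have "{u \<in> lattice_points P. \<forall>e\<in>edge_basis P m - {}. vexps m u e = vexps m w e} = {w}"
      using vexps_inject[OF m _ w] w by auto
    then show ?thesis by (simp add: separated_def)
  qed
  note sep = this
  have "n_inj P (orbit_generic_point TYPE('k) P {lattice_pt m} m) \<le> enat l \<longleftrightarrow>
      (\<forall>w\<in>lattice_points P. (\<Sum>e\<in>edge_basis P m - {}. vexps m w e) \<le> l \<and>
      separated TYPE('k) {u \<in> lattice_points P. \<forall>e\<in>edge_basis P m - {}. vexps m u e = vexps m w e} {} (vexps m)
        (l - (\<Sum>e\<in>edge_basis P m - {}. vexps m w e)))"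
    unfolding pp(2) by (rule n_inj_le_iff[OF pp(1) empty_subsetI]) (rule pp(3))
  also have "\<dots> \<longleftrightarrow> (\<forall>w\<in>lattice_points P. (\<Sum>e\<in>edge_basis P m - {}. vexps m w e) \<le> l)"
    by (rule ball_cong[OF HOL.refl]) (simp only: sep simp_thms)
  finally have "n_inj P (orbit_generic_point TYPE('k) P {lattice_pt m} m) \<le> enat l \<longleftrightarrow>
      (\<forall>w\<in>lattice_points P. (\<Sum>e\<in>edge_basis P m - {}. vexps m w e) \<le> l)" .
  then show "n_inj P (orbit_generic_point TYPE('k) P {lattice_pt m} m) \<le> enat l \<longleftrightarrow>
      enat (nat (Max {vertex_length P m m' | m'. m' \<in> lattice_vertices P})) \<le> enat l"
    unfolding enat_ord_simps Max_vertex_length_le_iff[OF m] by simp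
qed

text \<open>The fixed points give the lower bound. For the upper bound, each point lies in the chart
  of some vertex, where \<open>n_inj_le\<close> bounds its order by the order at that fixed
  point.\<close>

theorem n_inj_total_eq:
  "n_inj_total TYPE('k::field_char_0) P =
    enat (nat (Max {Max {vertex_length P m m' | m'. m' \<in> lattice_vertices P} | m. m \<in> lattice_vertices P}))"
proof (rule enat_eqI)
  fix l
  define M where "M m = Max {vertex_length P m m' | m'. m' \<in> lattice_vertices P}" for m
  have "n_inj_total TYPE('k) P \<le> enat l \<longleftrightarrow> (\<forall>x\<in>(toric_variety P :: ('k, 'n) toric_point set). n_inj P x \<le> enat l)"
    unfolding n_inj_total_def by (rule SUP_le_iff)
  also have "\<dots> \<longleftrightarrow> (\<forall>m\<in>lattice_vertices P. nat (M m) \<le> l)"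
  proof
    assume le: "\<forall>x\<in>(toric_variety P :: ('k, 'n) toric_point set). n_inj P x \<le> enat l"
    show "\<forall>m\<in>lattice_vertices P. nat (M m) \<le> l"
    proof
      fix m assume m: "m \<in> lattice_vertices P"
      obtain \<pp> :: "('k, 'n) laurent set" where pp: "(m, \<pp>) \<in> chart_points P"
        "orbit_generic_point TYPE('k) P {lattice_pt m} m = glue P `` {(m, \<pp>)}"
        using orbit_point[OF m, where F = "{lattice_pt m}"] by metis
      then have "orbit_generic_point TYPE('k) P {lattice_pt m} m \<in> toric_variety P"
        unfolding toric_variety_def by (simp add: quotientI)
      with le have "n_inj P (orbit_generic_point TYPE('k) P {lattice_pt m} m) \<le> enat l" by blast
      then show "nat (M m) \<le> l" unfolding n_inj_fixed_point[OF m] M_def by simp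
    qed
  next
    assume le: "\<forall>m\<in>lattice_vertices P. nat (M m) \<le> l"
    show "\<forall>x\<in>(toric_variety P :: ('k, 'n) toric_point set). n_inj P x \<le> enat l"
    proof
      fix x assume "x \<in> (toric_variety P :: ('k, 'n) toric_point set)"
      then obtain m \<pp> where pts: "(m, \<pp>) \<in> (chart_points P :: (_ \<times> ('k, 'n) laurent set) set)"
        and x: "x = glue P `` {(m, \<pp>)}" unfolding toric_variety_def by (auto elim!: quotientE)
      have m: "m \<in> lattice_vertices P" by (rule chart_pointsD(1)[OF pts])
      then have "nat (M m) \<le> l" using le by blast
      then show "n_inj P x \<le> enat l"
        unfolding x M_def Max_vertex_length_le_iff[OF m] by (intro n_inj_le[OF pts]) blast
    qed
  qed
  also have "\<dots> \<longleftrightarrow> nat (Max {M m | m. m \<in> lattice_vertices P}) \<le> l"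
  proof -
    have "{M m | m. m \<in> lattice_vertices P} = M ` lattice_vertices P" by blast
    then show ?thesis
      unfolding nat_le_iff using finite_vertices vertices_nonempty by (simp add: Max_le_iff)
  qed
  finally show "n_inj_total TYPE('k) P \<le> enat l \<longleftrightarrow>
    enat (nat (Max {Max {vertex_length P m m' | m'. m' \<in> lattice_vertices P} | m. m \<in> lattice_vertices P})) \<le> enat l"
    by (simp add: M_def)
qed

end

theorem proposition6p2p2:
  fixes P :: "(real ^ 'n::finite) set"
  assumes "lattice_polytope P"
    and "basis_condition P"
  shows "(\<forall>F m. F face_of P \<and> m \<in> lattice_vertices P \<and> lattice_pt m \<in> F \<longrightarrow>
           n_inj P (orbit_generic_point TYPE('k::{alg_closed_field, field_char_0}) P F m) =
           Max {N_inj TYPE('k) ((+) u ` face_lattice P F m \<inter> lattice_points P)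
                + enat (nat (face_distance P F m u))
               | u. (+) u ` face_lattice P F m \<inter> lattice_points P \<noteq> {}})
       \<and> (\<forall>m \<in> lattice_vertices P.
           n_inj P (orbit_generic_point TYPE('k) P {lattice_pt m} m) =
           enat (nat (Max {vertex_length P m m' | m'. m' \<in> lattice_vertices P})))
       \<and> n_inj_total TYPE('k) P =
           enat (nat (Max {Max {vertex_length P m m' | m'. m' \<in> lattice_vertices P}
                          | m. m \<in> lattice_vertices P}))"
proof -
  interpret smooth_lattice_polytope P by unfold_locales (rule assms)+
  show ?thesis
    by (intro conjI allI ballI impI n_inj_total_eq n_inj_fixed_point; (elim conjE)?; (rule n_inj_orbit)?; assumption?)
qed

end
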